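(* Let $S=\mathbb{Z}[q,q^{-1}]$, let $n,r,N$ be positive integers, and let $V$ be the free $S$-module of rank $rN$ with basis $\{v_i^s \mid 1\le i\le N,\ 1\le s\le r\}$, so that $V^{\otimes n}$ is the right tensor space module of the $bt$-algebra $\mathcal{E}_n(q)$. Let $\alpha$ be a partition of $n$ of length $r$. (1) Let $\boldsymbol{\lambda}\in Comp_{r,n,\le N}$ be of type $\alpha$. Then the $S$-linear map $\iota_{\boldsymbol{\lambda}}: M(\boldsymbol{\lambda})\to V^{\otimes n}$ given by $\iota_{\boldsymbol{\lambda}}(x_{\mathfrak t})=v_{\mathfrak t}$ for $\mathfrak t\in \mathrm{RStd}(\boldsymbol{\lambda})$ is an embedding of $\mathcal{E}_n^\alpha(q)$-modules. (2) Identifying $M(\boldsymbol{\lambda})$ with $\iota_{\boldsymbol{\lambda}}(M(\boldsymbol{\lambda}))$, we have $M(\boldsymbol{\lambda})\subseteq \mathbb{E}_\alpha V^{\otimes n}$ and there is a direct sum decomposition of $\mathcal{E}_n^\alpha(q)$-modules $$\mathbb{E}_\alpha V^{\otimes n}\;\cong\;\bigoplus_{\boldsymbol{\lambda}\in Comp_{r,n,\le N},\ |A_{\boldsymbol{\lambda}}|=\alpha} M(\boldsymbol{\lambda}).$$ The same statements hold with $S$ replaced by a field $\mathcal K$ containing a nonzero element $q$ (with $V$ a $\mathcal K$-vector space of dimension $rN$ and the algebras specialized to $\mathcal K$).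
   Context: **The algebra.** $\mathfrak S_n$ acts on the right on $\mathbf n=\{1,\dots,n\}$, $s_i=(i,i+1)$, $\ell$ is the length function. The $bt$-algebra $\mathcal E_n(q)$ is the associative unital $S$-algebra generated by $g_1,\dots,g_{n-1},e_1,\dots,e_{n-1}$ with relations: $g_ig_j=g_jg_i$ for $|i-j|>1$; $g_ie_i=e_ig_i$; $g_ig_jg_i=g_jg_ig_j$ for $|i-j|=1$; $e_ig_jg_i=g_jg_ie_j$ for $|i-j|=1$; $e_ie_jg_j=e_ig_je_i=g_je_ie_j$ for $|i-j|=1$; $e_ie_j=e_je_i$ for all $i,j$; $g_ie_j=e_jg_i$ for $|i-j|>1$; $e_i^2=e_i$; $g_i^2=1+(q-q^{-1})e_ig_i$. For a reduced expression $w=s_{i_1}\cdots s_{i_k}$ put $g_w=g_{i_1}\cdots g_{i_k}$ (independent of the choice). **Idempotents.** $\mathcal{SP}_n$ is the set of set partitions of $\mathbf n$, with $A\subseteq B$ if every block of $B$ is a union of blocks of $A$; $\mu$ is the Möbius function of this lattice. $E_{i,i+1}=e_i$ and $E_{ij}=g_iE_{i+1,j}g_i^{-1}$ for $j>i+1$; $E_A=\prod E_{ij}$ over pairs $i<j$ in a common block of $A$ (the factors commute); $\mathbb E_A=\sum_{B:A\subseteq B}\mu(A,B)E_B$. These $\mathbb E_A$ are orthogonal idempotents with $\mathbb E_Ag_w=g_w\mathbb E_{Aw}$. $A$ is of type $\alpha$ (written $|A|=\alpha$), $\alpha$ a partition of $n$, if the block sizes of $A$ in decreasing order form $\alpha$.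 $\mathbb E_\alpha=\sum_{|A|=\alpha}\mathbb E_A$ is a central idempotent, and $\mathcal E_n^\alpha(q)=\mathbb E_\alpha\mathcal E_n(q)$. Over a field $\mathcal K$ containing a nonzero element $q$, use $\mathcal E_n^\alpha(q)\otimes_S\mathcal K$. **Multitableaux.** A composition is a finite sequence of nonnegative integers (sequences differing by trailing zeros are identified). An $r$-multicomposition of $n$ is an $r$-tuple $\boldsymbol\lambda=(\lambda^{(1)},\dots,\lambda^{(r)})$ of compositions of total size $n$. $Comp_{r,n,\le N}$ is the set of $r$-multicompositions of $n$ all of whose components have length at most $N$. The Young diagram of $\boldsymbol\lambda$ consists of nodes $(x,y,p)$ with $1\le y\le\lambda^{(p)}_x$ (row $x$, column $y$, component $p$). A $\boldsymbol\lambda$-multitableau is a bijective filling of the nodes by $\mathbf n$; it is row standard if entries increase from left to right in every row of every component; $\mathrm{RStd}(\boldsymbol\lambda)$ is the set of these. $\mathfrak S_n$ acts on the right on multitableaux by acting on entries. $\mathfrak t^{\boldsymbol\lambda}$ is filled with $1,\dots,n$ in order along the rows of the first component, then the second, etc.; $d(\mathfrak t)$ is defined by $\mathfrak t=\mathfrak t^{\boldsymbol\lambda}d(\mathfrak t)$; $\mathfrak S_{\boldsymbol\lambda}$ is the row stabilizer of $\mathfrak t^{\boldsymbol\lambda}$. $A_{\boldsymbol\lambda}$ is the set partition whose blocks are the nonempty sets of entries of the components of $\mathfrak t^{\boldsymbol\lambda}$; $\boldsymbol\lambda$ is of type $\alpha$ if $|A_{\boldsymbol\lambda}|=\alpha$.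 Put $\mathbb E_{\boldsymbol\lambda}=\mathbb E_{A_{\boldsymbol\lambda}}$. **Permutation module.** For $\boldsymbol\lambda$ of type $\alpha$: $x_{\boldsymbol\lambda}=\sum_{w\in\mathfrak S_{\boldsymbol\lambda}}q^{\ell(w)}g_w$, $M(\boldsymbol\lambda)=\mathbb E_{\boldsymbol\lambda}x_{\boldsymbol\lambda}\mathcal E_n^\alpha(q)$ (a right ideal), and $x_{\mathfrak t}=\mathbb E_{\boldsymbol\lambda}x_{\boldsymbol\lambda}g_{d(\mathfrak t)}$ for $\mathfrak t\in\mathrm{RStd}(\boldsymbol\lambda)$; the $x_{\mathfrak t}$ form a basis of $M(\boldsymbol\lambda)$. **Tensor space.** Define operators on $V^{\otimes2}$ (acting on the right): $(v_i^s\otimes v_j^t)\mathbf E=v_i^s\otimes v_j^t$ if $s=t$ and $0$ if $s\ne t$; $(v_i^s\otimes v_j^t)\mathbf G=v_j^t\otimes v_i^s$ if $s\neq t$; $=q\,v_i^s\otimes v_j^t$ if $s=t,i=j$; $=v_j^t\otimes v_i^s$ if $s=t,i<j$; $=(q-q^{-1})v_i^s\otimes v_j^t+v_j^t\otimes v_i^s$ if $s=t,i>j$. Letting $e_i,g_i$ act as $\mathbf E,\mathbf G$ in the $i$-th and $(i+1)$-st tensor factors makes $V^{\otimes n}$ a right $\mathcal E_n(q)$-module. $\mathbb E_\alpha V^{\otimes n}$ denotes the image of the action of the central idempotent $\mathbb E_\alpha$ on $V^{\otimes n}$; it is an $\mathcal E_n^\alpha(q)$-module. For $\mathfrak t\in\mathrm{RStd}(\boldsymbol\lambda)$,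 $\boldsymbol\lambda\in Comp_{r,n,\le N}$, put $v_{\mathfrak t}=v_{i_1}^{s_1}\otimes\cdots\otimes v_{i_n}^{s_n}$ where $j$ lies in row $i_j$ of component $s_j$ of $\mathfrak t$. *)

theory Defs
  imports
    "HOL-Algebra.QuotRing"
    "HOL-Algebra.Module"
    "HOL-Algebra.Algebraic_Closure_Type"
    "HOL-Library.Poly_Mapping"
    "HOL-Library.Disjoint_Sets"
    "HOL-Library.Multiset"
    "HOL-Combinatorics.Permutations"
begin

text \<open>
  Throughout, the ground ring is the type \<^typ>\<open>'s::comm_ring_1\<close> with a distinguished unit
  \<open>q\<close>. Everything is defined uniformly in \<open>q\<close>, and used for the Laurent polynomial ring and for
  fields. The bt-algebra over a field is given by the same presentation over that field, which is
  the base change of the algebra over the Laurent polynomial ring.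
\<close>

section \<open>Ground rings\<close>

text \<open>The group ring of the additive group of integers is the ring of Laurent polynomials; the
  exponent \<open>k\<close> stands for the \<open>k\<close>-th power of the variable.\<close>

type_synonym laurent = "int \<Rightarrow>\<^sub>0 int"

definition laurent_q :: laurent
  where "laurent_q = Poly_Mapping.single 1 1"

definition unit_inv :: "'s::comm_ring_1 \<Rightarrow> 's"
  where "unit_inv q = (THE q'. q * q' = 1)"

abbreviation scalars :: "'s::comm_ring_1 ring"
  where "scalars \<equiv> ring_of_type_algebra"

abbreviation scale :: "'s::comm_ring_1 \<Rightarrow> ('k \<Rightarrow>\<^sub>0 's) \<Rightarrow> ('k \<Rightarrow>\<^sub>0 's)"
  where "scale c \<equiv> Poly_Mapping.map ((*) c)"

definition lin_ext :: "('k \<Rightarrow> ('l \<Rightarrow>\<^sub>0 's)) \<Rightarrow> ('k \<Rightarrow>\<^sub>0 's::comm_ring_1) \<Rightarrow> ('l \<Rightarrow>\<^sub>0 's)"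
  where "lin_ext f u = (\<Sum>k\<in>Poly_Mapping.keys u. scale (Poly_Mapping.lookup u k) (f k))"


section \<open>Right modules over an algebra\<close>

text \<open>
  Algebras over \<^typ>\<open>'s\<close> are records of type \<^typ>\<open>('s, 'a) module\<close>. Following the library, the
  record of a module contains a multiplication and a unit that play no role for modules.
\<close>

record ('s, 'm, 'a) right_module = "('s, 'm) module" +
  ract :: "['m, 'a] \<Rightarrow> 'm"  (infixl \<open>\<lhd>\<index>\<close> 70)

text \<open>
  The identity of \<open>A\<close> is not required to act as the identity: the tensor space is a module over
  the block algebra, whose identity acts on it as a projection.
\<close>

locale right_module =
  fixes A :: "('s::comm_ring_1, 'a, 'x) module_scheme"
    and M :: "('s, 'm, 'a, 'y) right_module_scheme"
  assumes scalar_module: "module (scalars :: 's ring) M"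
    and act_closed: "\<lbrakk>m \<in> carrier M; a \<in> carrier A\<rbrakk> \<Longrightarrow> m \<lhd>\<^bsub>M\<^esub> a \<in> carrier M"
    and act_add_left: "\<lbrakk>m \<in> carrier M; m' \<in> carrier M; a \<in> carrier A\<rbrakk> \<Longrightarrow>
      (m \<oplus>\<^bsub>M\<^esub> m') \<lhd>\<^bsub>M\<^esub> a = (m \<lhd>\<^bsub>M\<^esub> a) \<oplus>\<^bsub>M\<^esub> (m' \<lhd>\<^bsub>M\<^esub> a)"
    and act_add_right: "\<lbrakk>m \<in> carrier M; a \<in> carrier A; b \<in> carrier A\<rbrakk> \<Longrightarrow>
      m \<lhd>\<^bsub>M\<^esub> (a \<oplus>\<^bsub>A\<^esub> b) = (m \<lhd>\<^bsub>M\<^esub> a) \<oplus>\<^bsub>M\<^esub> (m \<lhd>\<^bsub>M\<^esub> b)"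
    and act_mult: "\<lbrakk>m \<in> carrier M; a \<in> carrier A; b \<in> carrier A\<rbrakk> \<Longrightarrow>
      m \<lhd>\<^bsub>M\<^esub> (a \<otimes>\<^bsub>A\<^esub> b) = (m \<lhd>\<^bsub>M\<^esub> a) \<lhd>\<^bsub>M\<^esub> b"
    and act_smult_left: "\<lbrakk>m \<in> carrier M; a \<in> carrier A\<rbrakk> \<Longrightarrow>
      (c \<odot>\<^bsub>M\<^esub> m) \<lhd>\<^bsub>M\<^esub> a = c \<odot>\<^bsub>M\<^esub> (m \<lhd>\<^bsub>M\<^esub> a)"
    and act_smult_right: "\<lbrakk>m \<in> carrier M; a \<in> carrier A\<rbrakk> \<Longrightarrow>
      m \<lhd>\<^bsub>M\<^esub> (c \<odot>\<^bsub>A\<^esub> a) = c \<odot>\<^bsub>M\<^esub> (m \<lhd>\<^bsub>M\<^esub> a)"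

locale unital_right_module = right_module +
  assumes act_one: "m \<in> carrier M \<Longrightarrow> m \<lhd>\<^bsub>M\<^esub> \<one>\<^bsub>A\<^esub> = m"

definition linear_maps ::
    "('s::comm_ring_1, 'm, 'x) module_scheme \<Rightarrow> ('s, 'l, 'y) module_scheme \<Rightarrow> ('m \<Rightarrow> 'l) set"
  where "linear_maps M L = {f \<in> carrier M \<rightarrow> carrier L.
    (\<forall>m\<in>carrier M. \<forall>m'\<in>carrier M. f (m \<oplus>\<^bsub>M\<^esub> m') = f m \<oplus>\<^bsub>L\<^esub> f m') \<and>
    (\<forall>c. \<forall>m\<in>carrier M. f (c \<odot>\<^bsub>M\<^esub> m) = c \<odot>\<^bsub>L\<^esub> f m)}"

definition module_homs ::
    "('s::comm_ring_1, 'a, 'x) module_scheme \<Rightarrow> ('s, 'm, 'a, 'y) right_module_scheme \<Rightarrow>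
     ('s, 'l, 'a, 'z) right_module_scheme \<Rightarrow> ('m \<Rightarrow> 'l) set"
  where "module_homs A M L = {f \<in> linear_maps M L.
    \<forall>m\<in>carrier M. \<forall>a\<in>carrier A. f (m \<lhd>\<^bsub>M\<^esub> a) = f m \<lhd>\<^bsub>L\<^esub> a}"

definition module_embedding ::
    "('s::comm_ring_1, 'a, 'x) module_scheme \<Rightarrow> ('s, 'm, 'a, 'y) right_module_scheme \<Rightarrow>
     ('s, 'l, 'a, 'z) right_module_scheme \<Rightarrow> ('m \<Rightarrow> 'l) \<Rightarrow> bool"
  where "module_embedding A M L f \<longleftrightarrow>
    right_module A M \<and> right_module A L \<and> f \<in> module_homs A M L \<and> inj_on f (carrier M)"

definition module_isomorphism ::
    "('s::comm_ring_1, 'a, 'x) module_scheme \<Rightarrow> ('s, 'm, 'a, 'y) right_module_scheme \<Rightarrow>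
     ('s, 'l, 'a, 'z) right_module_scheme \<Rightarrow> ('m \<Rightarrow> 'l) \<Rightarrow> bool"
  where "module_isomorphism A M L f \<longleftrightarrow>
    unital_right_module A M \<and> unital_right_module A L \<and>
    f \<in> module_homs A M L \<and> bij_betw f (carrier M) (carrier L)"

definition direct_sum ::
    "'i set \<Rightarrow> ('i \<Rightarrow> ('s, 'm, 'a) right_module) \<Rightarrow> ('s, 'i \<Rightarrow> 'm, 'a) right_module"
  where "direct_sum I M = \<lparr>
    carrier = {f \<in> \<Pi>\<^sub>E i\<in>I. carrier (M i). finite {i\<in>I. f i \<noteq> \<zero>\<^bsub>M i\<^esub>}},
    monoid.mult = undefined,
    one = undefined,
    zero = (\<lambda>i\<in>I. \<zero>\<^bsub>M i\<^esub>),
    add = (\<lambda>f g. \<lambda>i\<in>I. f i \<oplus>\<^bsub>M i\<^esub> g i),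
    module.smult = (\<lambda>c f. \<lambda>i\<in>I. c \<odot>\<^bsub>M i\<^esub> f i),
    ract = (\<lambda>f a. \<lambda>i\<in>I. f i \<lhd>\<^bsub>M i\<^esub> a)\<rparr>"


section \<open>The bt-algebra\<close>

text \<open>Words form a monoid under concatenation, written additively so that finitely supported
  functions on words multiply by convolution and form the free associative algebra.\<close>

datatype 'x fword = FWord (letters: "'x list")

instantiation fword :: (type) monoid_add
begin

definition zero_fword :: "'x fword"
  where "zero_fword = FWord []"

definition plus_fword :: "'x fword \<Rightarrow> 'x fword \<Rightarrow> 'x fword"
  where "plus_fword u v = FWord (letters u @ letters v)"

instance
  by standard (simp_all add: zero_fword_def plus_fword_def)

end

datatype bt_gen = GenG nat | GenE nat

type_synonym 's bt_free = "bt_gen fword \<Rightarrow>\<^sub>0 's"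

definition free_const :: "'s::comm_ring_1 \<Rightarrow> 's bt_free"
  where "free_const c = Poly_Mapping.single 0 c"

definition free_g :: "nat \<Rightarrow> 's::comm_ring_1 bt_free"
  where "free_g i = Poly_Mapping.single (FWord [GenG i]) 1"

definition free_e :: "nat \<Rightarrow> 's::comm_ring_1 bt_free"
  where "free_e i = Poly_Mapping.single (FWord [GenE i]) 1"

definition free_algebra :: "nat \<Rightarrow> 's::comm_ring_1 bt_free ring"
  where "free_algebra n = \<lparr>
    carrier = {p. \<forall>w\<in>Poly_Mapping.keys p. set (letters w) \<subseteq> GenG ` {1..<n} \<union> GenE ` {1..<n}},
    monoid.mult = (*), one = 1, zero = 0, add = (+)\<rparr>"

definition index_dist :: "nat \<Rightarrow> nat \<Rightarrow> int"
  where "index_dist i j = \<bar>int i - int j\<bar>"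

inductive_set bt_relators :: "nat \<Rightarrow> 's::comm_ring_1 \<Rightarrow> 's bt_free set"
  for n :: nat and q :: 's
  where
    gg_far: "\<lbrakk>i \<in> {1..<n}; j \<in> {1..<n}; index_dist i j > 1\<rbrakk> \<Longrightarrow>
      free_g i * free_g j - free_g j * free_g i \<in> bt_relators n q"
  | ge: "i \<in> {1..<n} \<Longrightarrow>
      free_g i * free_e i - free_e i * free_g i \<in> bt_relators n q"
  | braid: "\<lbrakk>i \<in> {1..<n}; j \<in> {1..<n}; index_dist i j = 1\<rbrakk> \<Longrightarrow>
      free_g i * free_g j * free_g i - free_g j * free_g i * free_g j \<in> bt_relators n q"
  | egg: "\<lbrakk>i \<in> {1..<n}; j \<in> {1..<n}; index_dist i j = 1\<rbrakk> \<Longrightarrow>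
      free_e i * free_g j * free_g i - free_g j * free_g i * free_e j \<in> bt_relators n q"
  | eeg: "\<lbrakk>i \<in> {1..<n}; j \<in> {1..<n}; index_dist i j = 1\<rbrakk> \<Longrightarrow>
      free_e i * free_e j * free_g j - free_e i * free_g j * free_e i \<in> bt_relators n q"
  | ege: "\<lbrakk>i \<in> {1..<n}; j \<in> {1..<n}; index_dist i j = 1\<rbrakk> \<Longrightarrow>
      free_e i * free_g j * free_e i - free_g j * free_e i * free_e j \<in> bt_relators n q"
  | ee: "\<lbrakk>i \<in> {1..<n}; j \<in> {1..<n}\<rbrakk> \<Longrightarrow>
      free_e i * free_e j - free_e j * free_e i \<in> bt_relators n q"
  | ge_far: "\<lbrakk>i \<in> {1..<n}; j \<in> {1..<n}; index_dist i j > 1\<rbrakk> \<Longrightarrow>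
      free_g i * free_e j - free_e j * free_g i \<in> bt_relators n q"
  | e_idem: "i \<in> {1..<n} \<Longrightarrow>
      free_e i * free_e i - free_e i \<in> bt_relators n q"
  | quad: "i \<in> {1..<n} \<Longrightarrow>
      free_g i * free_g i - (1 + free_const (q - unit_inv q) * free_e i * free_g i)
        \<in> bt_relators n q"

definition bt_ideal :: "nat \<Rightarrow> 's::comm_ring_1 \<Rightarrow> 's bt_free set"
  where "bt_ideal n q = Idl\<^bsub>free_algebra n\<^esub> (bt_relators n q)"

definition bt_class :: "nat \<Rightarrow> 's::comm_ring_1 \<Rightarrow> 's bt_free \<Rightarrow> 's bt_free set"
  where "bt_class n q p = bt_ideal n q +>\<^bsub>free_algebra n\<^esub> p"

definition bt_algebra :: "nat \<Rightarrow> 's::comm_ring_1 \<Rightarrow> ('s, 's bt_free set) module"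
  where "bt_algebra n q = (let Q = free_algebra n Quot bt_ideal n q in \<lparr>
    carrier = carrier Q, monoid.mult = monoid.mult Q, one = one Q, zero = zero Q, add = add Q,
    module.smult = (\<lambda>c a. bt_class n q (free_const c) \<otimes>\<^bsub>Q\<^esub> a)\<rparr>)"

definition bt_g :: "nat \<Rightarrow> 's::comm_ring_1 \<Rightarrow> nat \<Rightarrow> 's bt_free set"
  where "bt_g n q i = bt_class n q (free_g i)"

definition bt_e :: "nat \<Rightarrow> 's::comm_ring_1 \<Rightarrow> nat \<Rightarrow> 's bt_free set"
  where "bt_e n q i = bt_class n q (free_e i)"

definition bt_prod :: "nat \<Rightarrow> 's::comm_ring_1 \<Rightarrow> 's bt_free set list \<Rightarrow> 's bt_free set"
  where "bt_prod n q xs = foldr (monoid.mult (bt_algebra n q)) xs \<one>\<^bsub>bt_algebra n q\<^esub>"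


section \<open>Reduced expressions\<close>

text \<open>Permutations act on the right, so the leftmost letter of a word is applied first.\<close>

definition word_perm :: "nat list \<Rightarrow> nat \<Rightarrow> nat"
  where "word_perm is = fold (\<lambda>i w. Transposition.transpose i (i + 1) \<circ> w) is id"

definition expression_of :: "nat \<Rightarrow> (nat \<Rightarrow> nat) \<Rightarrow> nat list \<Rightarrow> bool"
  where "expression_of n w is \<longleftrightarrow> set is \<subseteq> {1..<n} \<and> word_perm is = w"

definition perm_length :: "nat \<Rightarrow> (nat \<Rightarrow> nat) \<Rightarrow> nat"
  where "perm_length n w = (LEAST k. \<exists>is. expression_of n w is \<and> length is = k)"

definition bt_gw :: "nat \<Rightarrow> 's::comm_ring_1 \<Rightarrow> (nat \<Rightarrow> nat) \<Rightarrow> 's bt_free set"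
  where "bt_gw n q w = bt_prod n q (map (bt_g n q)
    (SOME is. expression_of n w is \<and> length is = perm_length n w))"


section \<open>Set partitions and idempotents\<close>

definition set_partitions :: "nat \<Rightarrow> nat set set set"
  where "set_partitions n = {A. partition_on {1..n} A}"

text \<open>\<open>refines {1..n} A B\<close> is the order relation between \<open>A\<close> and \<open>B\<close> in which \<open>A\<close> is the finer
  set partition.\<close>

function sp_mobius :: "nat \<Rightarrow> nat set set \<Rightarrow> nat set set \<Rightarrow> int"
  where "sp_mobius n A B =
    (if \<not> refines {1..n} A B then 0
     else if A = B then 1
     else - (\<Sum>C | refines {1..n} A C \<and> refines {1..n} C B \<and> C \<noteq> B. sp_mobius n A C))"
  by pat_completeness auto
termination
proof (relation "measure (\<lambda>(n, A, B). card {C. refines {1..n} A C \<and> refines {1..n} C B})")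
  fix n :: nat and A B C :: "nat set set"
  assume AB: "\<not> \<not> refines {1..n} A B"
    and C: "C \<in> {C. refines {1..n} A C \<and> refines {1..n} C B \<and> C \<noteq> B}"
  have sub: "{D. refines {1..n} A D \<and> refines {1..n} D C}
      \<subseteq> {D. refines {1..n} A D \<and> refines {1..n} D B}"
    using C by (auto intro: refines_trans)
  have "refines {1..n} B B"
    using AB by (auto simp: refines_def)
  moreover have "\<not> refines {1..n} B C"
    using C by (auto dest: refines_asym)
  ultimately have "{D. refines {1..n} A D \<and> refines {1..n} D C}
      \<subset> {D. refines {1..n} A D \<and> refines {1..n} D B}"
    using sub AB by blast
  moreover have "finite {D. refines {1..n} A D \<and> refines {1..n} D B}"
    by (rule finite_subset[OF _ finitely_many_partition_on[of "{1..n}"]])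
      (auto simp: refines_def)
  ultimately show "((n, A, C), n, A, B)
      \<in> measure (\<lambda>(n, A, B). card {C. refines {1..n} A C \<and> refines {1..n} C B})"
    by (simp add: psubset_card_mono)
qed simp

declare sp_mobius.simps [simp del]

definition sp_type :: "nat set set \<Rightarrow> nat list"
  where "sp_type A = rev (sorted_list_of_multiset (image_mset card (mset_set A)))"

definition is_partition_of :: "nat list \<Rightarrow> nat \<Rightarrow> bool"
  where "is_partition_of \<alpha> n \<longleftrightarrow>
    sorted_wrt (\<ge>) \<alpha> \<and> (\<forall>a\<in>set \<alpha>. 0 < a) \<and> sum_list \<alpha> = n"

text \<open>Used only for \<open>i < j\<close>.\<close>

function bt_Eij :: "nat \<Rightarrow> 's::comm_ring_1 \<Rightarrow> nat \<Rightarrow> nat \<Rightarrow> 's bt_free set"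
  where "bt_Eij n q i j =
    (if j \<le> i + 1 then bt_e n q i
     else bt_g n q i \<otimes>\<^bsub>bt_algebra n q\<^esub> bt_Eij n q (i + 1) j
       \<otimes>\<^bsub>bt_algebra n q\<^esub> inv\<^bsub>bt_algebra n q\<^esub> bt_g n q i)"
  by pat_completeness auto
termination
  by (relation "measure (\<lambda>(n, q, i, j). j - i)") auto

declare bt_Eij.simps [simp del]

text \<open>The factors commute; the product is taken in lexicographic order.\<close>

definition bt_E :: "nat \<Rightarrow> 's::comm_ring_1 \<Rightarrow> nat set set \<Rightarrow> 's bt_free set"
  where "bt_E n q A = bt_prod n q
    [bt_Eij n q i j. i \<leftarrow> [1..<n+1], j \<leftarrow> [i+1..<n+1], \<exists>B\<in>A. i \<in> B \<and> j \<in> B]"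

definition bt_idem :: "nat \<Rightarrow> 's::comm_ring_1 \<Rightarrow> nat set set \<Rightarrow> 's bt_free set"
  where "bt_idem n q A =
    (\<Oplus>\<^bsub>bt_algebra n q\<^esub>B\<in>{B\<in>set_partitions n. refines {1..n} A B}.
      of_int (sp_mobius n A B) \<odot>\<^bsub>bt_algebra n q\<^esub> bt_E n q B)"

definition bt_central_idem :: "nat \<Rightarrow> 's::comm_ring_1 \<Rightarrow> nat list \<Rightarrow> 's bt_free set"
  where "bt_central_idem n q \<alpha> =
    (\<Oplus>\<^bsub>bt_algebra n q\<^esub>A\<in>{A\<in>set_partitions n. sp_type A = \<alpha>}. bt_idem n q A)"

definition bt_block :: "nat \<Rightarrow> 's::comm_ring_1 \<Rightarrow> nat list \<Rightarrow> ('s, 's bt_free set) module"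
  where "bt_block n q \<alpha> = (bt_algebra n q)\<lparr>
    carrier := (\<lambda>a. bt_central_idem n q \<alpha> \<otimes>\<^bsub>bt_algebra n q\<^esub> a) ` carrier (bt_algebra n q),
    one := bt_central_idem n q \<alpha>\<rparr>"


section \<open>Multicompositions and multitableaux\<close>

text \<open>A composition is represented by its unique list without trailing zeros.\<close>

definition multicomps :: "nat \<Rightarrow> nat \<Rightarrow> nat \<Rightarrow> nat list list set"
  where "multicomps r n N = {\<nu>. length \<nu> = r \<and> sum_list (map sum_list \<nu>) = n \<and>
    (\<forall>c\<in>set \<nu>. length c \<le> N \<and> (c = [] \<or> last c \<noteq> 0))}"

text \<open>Nodes are triples (row, column, component), numbered from 1.\<close>

definition diagram :: "nat list list \<Rightarrow> (nat \<times> nat \<times> nat) set"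
  where "diagram \<nu> = {(x, y, p). p \<in> {1..length \<nu>} \<and> x \<in> {1..length (\<nu> ! (p - 1))} \<and>
    y \<in> {1..\<nu> ! (p - 1) ! (x - 1)}}"

definition tableaux :: "nat \<Rightarrow> nat list list \<Rightarrow> (nat \<times> nat \<times> nat \<Rightarrow> nat) set"
  where "tableaux n \<nu> = {t \<in> extensional (diagram \<nu>). bij_betw t (diagram \<nu>) {1..n}}"

definition RStd :: "nat \<Rightarrow> nat list list \<Rightarrow> (nat \<times> nat \<times> nat \<Rightarrow> nat) set"
  where "RStd n \<nu> = {t \<in> tableaux n \<nu>. \<forall>x y y' p.
    (x, y, p) \<in> diagram \<nu> \<and> (x, y', p) \<in> diagram \<nu> \<and> y < y' \<longrightarrow> t (x, y, p) < t (x, y', p)}"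

definition initial_tableau :: "nat list list \<Rightarrow> nat \<times> nat \<times> nat \<Rightarrow> nat"
  where "initial_tableau \<nu> = (\<lambda>(x, y, p)\<in>diagram \<nu>.
    sum_list (map sum_list (take (p - 1) \<nu>)) + sum_list (take (x - 1) (\<nu> ! (p - 1))) + y)"

definition tableau_perm :: "nat \<Rightarrow> nat list list \<Rightarrow> (nat \<times> nat \<times> nat \<Rightarrow> nat) \<Rightarrow> nat \<Rightarrow> nat"
  where "tableau_perm n \<nu> t = (THE w. w permutes {1..n} \<and>
    (\<forall>u\<in>diagram \<nu>. t u = w (initial_tableau \<nu> u)))"

definition initial_row :: "nat list list \<Rightarrow> nat \<Rightarrow> nat \<Rightarrow> nat set"
  where "initial_row \<nu> x p = {initial_tableau \<nu> (x, y, p) | y. (x, y, p) \<in> diagram \<nu>}"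

definition row_stabilizer :: "nat \<Rightarrow> nat list list \<Rightarrow> (nat \<Rightarrow> nat) set"
  where "row_stabilizer n \<nu> = {w. w permutes {1..n} \<and>
    (\<forall>x p. w ` initial_row \<nu> x p = initial_row \<nu> x p)}"

definition initial_component :: "nat list list \<Rightarrow> nat \<Rightarrow> nat set"
  where "initial_component \<nu> p = {initial_tableau \<nu> (x, y, p) | x y. (x, y, p) \<in> diagram \<nu>}"

definition comp_partition :: "nat list list \<Rightarrow> nat set set"
  where "comp_partition \<nu> = {initial_component \<nu> p | p. p \<in> {1..length \<nu>}} - {{}}"


section \<open>Permutation modules\<close>

definition row_sum :: "nat \<Rightarrow> 's::comm_ring_1 \<Rightarrow> nat list list \<Rightarrow> 's bt_free set"
  where "row_sum n q \<nu> = (\<Oplus>\<^bsub>bt_algebra n q\<^esub>w\<in>row_stabilizer n \<nu>.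
    q ^ perm_length n w \<odot>\<^bsub>bt_algebra n q\<^esub> bt_gw n q w)"

definition perm_gen :: "nat \<Rightarrow> 's::comm_ring_1 \<Rightarrow> nat list list \<Rightarrow> 's bt_free set"
  where "perm_gen n q \<nu> =
    bt_idem n q (comp_partition \<nu>) \<otimes>\<^bsub>bt_algebra n q\<^esub> row_sum n q \<nu>"

definition perm_module ::
    "nat \<Rightarrow> 's::comm_ring_1 \<Rightarrow> nat list list \<Rightarrow> ('s, 's bt_free set, 's bt_free set) right_module"
  where "perm_module n q \<nu> = (let B = bt_algebra n q in \<lparr>
    carrier = (\<lambda>a. perm_gen n q \<nu> \<otimes>\<^bsub>B\<^esub> a) ` carrier (bt_block n q (sp_type (comp_partition \<nu>))),
    monoid.mult = monoid.mult B, one = one B, zero = zero B, add = add B,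
    module.smult = module.smult B,
    ract = monoid.mult B\<rparr>)"

definition perm_basis ::
    "nat \<Rightarrow> 's::comm_ring_1 \<Rightarrow> nat list list \<Rightarrow> (nat \<times> nat \<times> nat \<Rightarrow> nat) \<Rightarrow> 's bt_free set"
  where "perm_basis n q \<nu> t =
    perm_gen n q \<nu> \<otimes>\<^bsub>bt_algebra n q\<^esub> bt_gw n q (tableau_perm n \<nu> t)"


section \<open>Tensor space\<close>

text \<open>
  The pair \<open>(i, s)\<close> stands for the basis vector of \<open>V\<close> with lower index \<open>i\<close> and upper index \<open>s\<close>.
  The \<open>n\<close>-th tensor power of \<open>V\<close> is the free module on the lists of \<open>n\<close> such pairs,
  the list \<open>[b1, ..., bn]\<close> standing for the pure tensor of the basis vectors \<open>b1, ..., bn\<close>.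
\<close>

type_synonym basis_index = "nat \<times> nat"
type_synonym 's tensor = "basis_index list \<Rightarrow>\<^sub>0 's"

fun op_E :: "basis_index \<Rightarrow> basis_index \<Rightarrow> (basis_index \<times> basis_index) \<Rightarrow>\<^sub>0 's::comm_ring_1"
  where "op_E (i, s) (j, t) = (if s = t then Poly_Mapping.single ((i, s), (j, t)) 1 else 0)"

fun op_G :: "'s \<Rightarrow> basis_index \<Rightarrow> basis_index \<Rightarrow> (basis_index \<times> basis_index) \<Rightarrow>\<^sub>0 's::comm_ring_1"
  where "op_G q (i, s) (j, t) =
    (if s \<noteq> t then Poly_Mapping.single ((j, t), (i, s)) 1
     else if i = j then Poly_Mapping.single ((i, s), (j, t)) q
     else if i < j then Poly_Mapping.single ((j, t), (i, s)) 1
     else Poly_Mapping.single ((i, s), (j, t)) (q - unit_inv q)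
       + Poly_Mapping.single ((j, t), (i, s)) 1)"

text \<open>Apply an operator on the tensor square to the factors in positions \<open>k\<close> and \<open>k + 1\<close>,
  counted from 1.\<close>

definition act_at ::
    "nat \<Rightarrow> (basis_index \<Rightarrow> basis_index \<Rightarrow> (basis_index \<times> basis_index) \<Rightarrow>\<^sub>0 's) \<Rightarrow>
     's::comm_ring_1 tensor \<Rightarrow> 's tensor"
  where "act_at k F = lin_ext (\<lambda>w.
    lin_ext (\<lambda>(a, b). Poly_Mapping.single (w[k - 1 := a, k := b]) 1) (F (w ! (k - 1)) (w ! k)))"

fun act_gen :: "'s::comm_ring_1 \<Rightarrow> bt_gen \<Rightarrow> 's tensor \<Rightarrow> 's tensor"
  where
    "act_gen q (GenG k) = act_at k (op_G q)"
  | "act_gen q (GenE k) = act_at k op_E"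

definition act_free :: "'s::comm_ring_1 \<Rightarrow> 's tensor \<Rightarrow> 's bt_free \<Rightarrow> 's tensor"
  where "act_free q v p = lin_ext (\<lambda>w. fold (act_gen q) (letters w) v) p"

text \<open>A class acts by the common value of the actions of its representatives.\<close>

definition tensor_space ::
    "nat \<Rightarrow> 's::comm_ring_1 \<Rightarrow> nat \<Rightarrow> nat \<Rightarrow> ('s, 's tensor, 's bt_free set) right_module"
  where "tensor_space n q r N = \<lparr>
    carrier = {v. \<forall>w\<in>Poly_Mapping.keys v. length w = n \<and> set w \<subseteq> {1..N} \<times> {1..r}},
    monoid.mult = undefined,
    one = undefined,
    zero = 0,
    add = (+),
    module.smult = scale,
    ract = (\<lambda>v a. the_elem (act_free q v ` a))\<rparr>"

definition block_tensor_space ::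
    "nat \<Rightarrow> 's::comm_ring_1 \<Rightarrow> nat \<Rightarrow> nat \<Rightarrow> nat list \<Rightarrow>
     ('s, 's tensor, 's bt_free set) right_module"
  where "block_tensor_space n q r N \<alpha> = (tensor_space n q r N)\<lparr>
    carrier := (\<lambda>v. v \<lhd>\<^bsub>tensor_space n q r N\<^esub> bt_central_idem n q \<alpha>)
      ` carrier (tensor_space n q r N)\<rparr>"

definition position :: "nat list list \<Rightarrow> (nat \<times> nat \<times> nat \<Rightarrow> nat) \<Rightarrow> nat \<Rightarrow> basis_index"
  where "position \<nu> t j = (THE (x, p). \<exists>y. (x, y, p) \<in> diagram \<nu> \<and> t (x, y, p) = j)"

definition tensor_basis ::
    "nat \<Rightarrow> nat list list \<Rightarrow> (nat \<times> nat \<times> nat \<Rightarrow> nat) \<Rightarrow> 's::comm_ring_1 tensor"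
  where "tensor_basis n \<nu> t = Poly_Mapping.single (map (position \<nu> t) [1..<n+1]) 1"

definition is_iota ::
    "nat \<Rightarrow> 's::comm_ring_1 \<Rightarrow> nat \<Rightarrow> nat \<Rightarrow> nat list list \<Rightarrow> ('s bt_free set \<Rightarrow> 's tensor) \<Rightarrow> bool"
  where "is_iota n q r N \<nu> f \<longleftrightarrow>
    f \<in> extensional (carrier (perm_module n q \<nu>)) \<and>
    f \<in> linear_maps (perm_module n q \<nu>) (tensor_space n q r N) \<and>
    (\<forall>t\<in>RStd n \<nu>. f (perm_basis n q \<nu> t) = tensor_basis n \<nu> t)"

definition iota ::
    "nat \<Rightarrow> 's::comm_ring_1 \<Rightarrow> nat \<Rightarrow> nat \<Rightarrow> nat list list \<Rightarrow> 's bt_free set \<Rightarrow> 's tensor"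
  where "iota n q r N \<nu> = (THE f. is_iota n q r N \<nu> f)"

definition multicomps_of_type :: "nat \<Rightarrow> nat \<Rightarrow> nat \<Rightarrow> nat list \<Rightarrow> nat list list set"
  where "multicomps_of_type r n N \<alpha> = {\<nu>\<in>multicomps r n N. sp_type (comp_partition \<nu>) = \<alpha>}"

end

theory Submission
  imports Defs
begin

text \<open>
  Write \<open>c j\<close> for the pair of the row and the component of \<open>j\<close> in the initial tableau. A word in the
  basis of \<open>V\<close> whose letters have the multiplicities prescribed by the multicomposition corresponds
  to a row standard tableau, and these words span a submodule \<open>T\<close> of tensor space. On the generator
  \<open>X\<close> of the permutation module, the elements \<open>X g\<^sub>d\<close> are multiplied by \<open>g\<^sub>i\<close> and \<open>e\<^sub>i\<close> by the same
  formulas as the corresponding words: this uses \<open>X g\<^sub>i = q X\<close> for \<open>s\<^sub>i\<close> in the row stabilizer,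
  Matsumoto's theorem for products \<open>g\<^sub>w g\<^sub>i\<close>, and the fact that \<open>E\<^sub>i\<^sub>j\<close> acts on \<open>X g\<^sub>d\<close> by 0 or 1. Hence
  there is an equivariant surjection from \<open>T\<close> onto the permutation module. It is injective, because
  acting with \<open>X g\<^sub>d\<close> on a tensor with distinct lower indices gives a combination of words that
  determines \<open>d\<close>; its inverse is the embedding. By Moebius inversion, the central idempotent projects
  tensor space to the span of the words in which the multiplicities of the upper indices are
  the parts of \<open>\<alpha>\<close>, and sorting these words by the multiplicities of their letters yields the direct
  sum.
\<close>

section \<open>Permutations and reduced words\<close>

text \<open>No basis of the bt-algebra is available in advance, and the elements
  \<open>X g\<^sub>d\<close> are not known to be independent, so the embedding cannot be built by
  prescribing its values on them. A map in the other direction can, since the words form a basis of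
  the weight space by construction; independence then comes out of the injectivity test. The tensor
  used in that test has lower indices \<open>1, ..., n\<close>, which may exceed \<open>N\<close>.
  For this reason the action is studied on all words of length \<open>n\<close>, and the bounds on
  the letters return only when the modules of the statement are formed. The difference between the
  Laurent ring and a field disappears by carrying an explicit inverse \<open>q'\<close> of
  \<open>q\<close> along.\<close>

abbreviation adj :: "nat \<Rightarrow> nat \<Rightarrow> nat"
  where "adj i \<equiv> Transposition.transpose i (Suc i)"

abbreviation pinv :: "(nat \<Rightarrow> nat) \<Rightarrow> nat \<Rightarrow> nat"
  where "pinv w \<equiv> inv_into UNIV w"

lemma adj_permutes: "i \<in> {1..<n} \<Longrightarrow> adj i permutes {1..n}"
  by (rule permutes_swap_id) auto

lemma adj_comp_adj [simp]: "adj i \<circ> (adj i \<circ> w) = w" "w \<circ> adj i \<circ> adj i = w"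
  by (simp_all add: fun_eq_iff)

lemma inv_adj_comp:
  assumes "bij w"
  shows "pinv (adj i \<circ> w) = pinv w \<circ> adj i" "pinv (w \<circ> adj i) = adj i \<circ> pinv w"
  using assms by (simp_all add: o_inv_distrib)

lemma word_perm_Nil [simp]: "word_perm [] = id"
  by (simp add: word_perm_def)

lemma word_perm_snoc [simp]: "word_perm (is @ [i]) = adj i \<circ> word_perm is"
  by (simp add: word_perm_def)

lemma word_perm_append: "word_perm (is @ js) = word_perm js \<circ> word_perm is"
  by (induction js rule: rev_induct) (simp_all flip: append_assoc add: comp_assoc)

lemma word_perm_Cons: "word_perm (i # is) = word_perm is \<circ> adj i"
  using word_perm_append[of "[i]" "is"] word_perm_snoc[of "[]" i] by simp

lemma word_perm_permutes: "set is \<subseteq> {1..<n} \<Longrightarrow> word_perm is permutes {1..n}"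
proof (induction "is" rule: rev_induct)
  case (snoc i "is")
  then have "word_perm is permutes {1..n}" "i \<in> {1..<n}" by auto
  then show ?case
    unfolding word_perm_snoc by (intro permutes_compose adj_permutes)
qed (simp only: word_perm_Nil permutes_id)

section \<open>Inversions and length of permutations\<close>

definition inversion_set :: "nat \<Rightarrow> (nat \<Rightarrow> nat) \<Rightarrow> (nat \<times> nat) set"
  where "inversion_set n w = {(a, b). 1 \<le> a \<and> a < b \<and> b \<le> n \<and> w b < w a}"

abbreviation inversions :: "nat \<Rightarrow> (nat \<Rightarrow> nat) \<Rightarrow> nat"
  where "inversions n w \<equiv> card (inversion_set n w)"

lemma finite_inversion_set [simp]: "finite (inversion_set n w)"
  by (rule finite_subset[of _ "{1..n} \<times> {1..n}"]) (auto simp: inversion_set_def)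

lemma inversion_set_id [simp]: "inversion_set n id = {}"
  by (auto simp: inversion_set_def)

text \<open>Exchanging the values \<open>i\<close> and \<open>i + 1\<close> affects the relative
  order of no other pair of values. Ascents are read off from \<open>pinv w\<close> because the
  leftmost letter of a word is applied first, so appending a letter composes with
  \<open>adj i\<close> on the left.\<close>

lemma inversion_set_adj_comp:
  assumes w: "w permutes {1..n}" and i: "i \<in> {1..<n}" and asc: "pinv w i < pinv w (Suc i)"
  shows "inversion_set n (adj i \<circ> w) = insert (pinv w i, pinv w (Suc i)) (inversion_set n w)"
    and "(pinv w i, pinv w (Suc i)) \<notin> inversion_set n w"
proof -
  have wi: "w (pinv w x) = x" "pinv w (w x) = x" for x
    using permutes_inverses[OF w] by auto
  have rng: "pinv w i \<in> {1..n}" "pinv w (Suc i) \<in> {1..n}"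
    using permutes_in_image[OF permutes_inv[OF w]] i by auto
  show "(pinv w i, pinv w (Suc i)) \<notin> inversion_set n w"
    by (simp add: inversion_set_def wi)
  have "(a, b) \<in> inversion_set n (adj i \<circ> w) \<longleftrightarrow>
      (a, b) = (pinv w i, pinv w (Suc i)) \<or> (a, b) \<in> inversion_set n w" for a b
  proof (cases "a < b")
    case True
    have ne: "w a \<noteq> w b" using True wi by (metis less_irrefl)
    consider "w a = i" "w b = Suc i" | "w a = Suc i" "w b = i" | "\<not> (w a = i \<and> w b = Suc i)"
        "\<not> (w a = Suc i \<and> w b = i)"
      by blast
    then show ?thesis
    proof cases
      case 1
      then have "a = pinv w i" "b = pinv w (Suc i)" using wi by metis+
      then show ?thesis using rng asc by (auto simp: inversion_set_def wi)
    next
      case 2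
      then have "a = pinv w (Suc i)" "b = pinv w i" using wi by metis+
      then show ?thesis using asc True by simp
    next
      case 3
      have "adj i (w b) < adj i (w a) \<longleftrightarrow> w b < w a"
        using 3 ne unfolding Transposition.transpose_def by (auto split: if_splits)
      moreover have "(a, b) \<noteq> (pinv w i, pinv w (Suc i))"
        using 3 wi by auto
      ultimately show ?thesis by (auto simp: inversion_set_def)
    qed
  next
    case False
    then show ?thesis using asc by (auto simp: inversion_set_def)
  qed
  then show "inversion_set n (adj i \<circ> w) = insert (pinv w i, pinv w (Suc i)) (inversion_set n w)"
    by auto
qed

lemma inversions_adj_comp:
  assumes "w permutes {1..n}" "i \<in> {1..<n}" "pinv w i < pinv w (Suc i)"
  shows "inversions n (adj i \<circ> w) = Suc (inversions n w)"
  using inversion_set_adj_comp[OF assms] by simp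

lemma inv_adj_comp_apply:
  assumes "w permutes {1..n}"
  shows "pinv (adj i \<circ> w) i = pinv w (Suc i)" "pinv (adj i \<circ> w) (Suc i) = pinv w i"
  using inv_adj_comp(1)[OF permutes_bij[OF assms]] by simp_all

lemma inversions_adj_comp_desc:
  assumes w: "w permutes {1..n}" and i: "i \<in> {1..<n}" and desc: "pinv w (Suc i) < pinv w i"
  shows "inversions n w = Suc (inversions n (adj i \<circ> w))"
proof -
  have "adj i \<circ> w permutes {1..n}"
    using w i by (intro permutes_compose adj_permutes)
  from inversions_adj_comp[OF this i] show ?thesis
    using desc inv_adj_comp_apply[OF w] by simp
qed

lemma asc_or_desc:
  assumes "w permutes {1..n}"
  shows "pinv w i < pinv w (Suc i) \<or> pinv w (Suc i) < pinv w i"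
  using permutes_inj[OF permutes_inv[OF assms]] by (metis injD n_not_Suc_n nat_neq_iff)

text \<open>An inversion of \<open>w\<close> is a pair of positions; the values found there, taken
  in exchanged order, form an inversion of \<open>pinv w\<close>.\<close>

lemma inversions_inv:
  assumes w: "w permutes {1..n}"
  shows "inversions n (pinv w) = inversions n w"
proof -
  have wi: "w (pinv w x) = x" "pinv w (w x) = x" for x
    using permutes_inverses[OF w] by auto
  have iff: "1 \<le> x \<and> x \<le> n \<longleftrightarrow> 1 \<le> w x \<and> w x \<le> n" for x
    using permutes_in_image[OF w, of x] by auto
  have "bij_betw (\<lambda>(a, b). (w b, w a)) (inversion_set n w) (inversion_set n (pinv w))"
  proof (rule bij_betw_byWitness[where f' = "\<lambda>(a, b). (pinv w b, pinv w a)"])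
    show "(\<lambda>(a, b). (w b, w a)) ` inversion_set n w \<subseteq> inversion_set n (pinv w)"
    proof clarify
      fix a b assume "(a, b) \<in> inversion_set n w"
      then show "(w b, w a) \<in> inversion_set n (pinv w)"
        using iff[of a] iff[of b] by (simp add: inversion_set_def wi)
    qed
    show "(\<lambda>(a, b). (pinv w b, pinv w a)) ` inversion_set n (pinv w) \<subseteq> inversion_set n w"
    proof clarify
      fix a b assume "(a, b) \<in> inversion_set n (pinv w)"
      then show "(pinv w b, pinv w a) \<in> inversion_set n w"
        using iff[of "pinv w a"] iff[of "pinv w b"] by (simp add: inversion_set_def wi)
    qed
  qed (simp_all add: wi split_beta)
  then show ?thesis by (simp add: bij_betw_same_card)
qed

lemma inversions_comp_adj:
  assumes w: "w permutes {1..n}" and k: "k \<in> {1..<n}" and asc: "w k < w (Suc k)"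
  shows "inversions n (w \<circ> adj k) = Suc (inversions n w)"
proof -
  have "inversions n (w \<circ> adj k) = inversions n (pinv (w \<circ> adj k))"
    by (rule inversions_inv[symmetric]) (intro permutes_compose w adj_permutes k)
  also have "\<dots> = inversions n (adj k \<circ> pinv w)"
    using inv_adj_comp(2)[OF permutes_bij[OF w]] by simp
  also have "\<dots> = Suc (inversions n (pinv w))"
    by (rule inversions_adj_comp)
      (use asc w k in \<open>auto simp: permutes_inv inv_inv_eq[OF permutes_bij[OF w]]\<close>)
  finally show ?thesis by (simp add: inversions_inv[OF w])
qed

text \<open>Monotonicity gives \<open>i \<le> w i\<close> throughout, while both sides have the same
  sum, so no inequality is strict.\<close>

lemma increasing_permutation_eq_id:
  assumes w: "w permutes {1..n}" and inc: "\<And>i. i \<in> {1..<n} \<Longrightarrow> w i < w (Suc i)"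
  shows "w = id"
proof -
  have lower: "i \<in> {1..n} \<Longrightarrow> i \<le> w i" for i
  proof (induction i)
    case (Suc i)
    show ?case
    proof (cases "i = 0")
      case True
      then show ?thesis using permutes_in_image[OF w, of 1] Suc.prems by auto
    next
      case False
      then show ?thesis using Suc inc[of i] by auto
    qed
  qed simp
  have "(\<Sum>i\<in>{1..n}. w i) = (\<Sum>i\<in>{1..n}. i)"
    using sum.permute[OF w, of id] by (simp add: comp_def)
  then have "w i = i" if "i \<in> {1..n}" for i
    using sum_strict_mono_ex1[of "{1..n}" id w] lower that
    by (metis finite_atLeastAtMost id_apply le_neq_implies_less less_irrefl sum.cong)
  then show ?thesis
    using permutes_not_in[OF w] by (auto simp: fun_eq_iff)
qed

lemma exists_descent:
  assumes w: "w permutes {1..n}" and "w \<noteq> id"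
  shows "\<exists>i\<in>{1..<n}. pinv w (Suc i) < pinv w i"
proof (rule ccontr)
  assume "\<not> ?thesis"
  then have "pinv w i < pinv w (Suc i)" if "i \<in> {1..<n}" for i
    using asc_or_desc[OF w, of i] that by auto
  then have "pinv w = id"
    by (intro increasing_permutation_eq_id[OF permutes_inv[OF w]])
  then show False
    using \<open>w \<noteq> id\<close> by (metis inv_id inv_inv_eq permutes_bij w)
qed

lemma inversions_word_perm_le:
  "set is \<subseteq> {1..<n} \<Longrightarrow> inversions n (word_perm is) \<le> length is"
proof (induction "is" rule: rev_induct)
  case (snoc i "is")
  then have s: "set is \<subseteq> {1..<n}" and i: "i \<in> {1..<n}"
    and IH: "inversions n (word_perm is) \<le> length is"
    by simp_all
  have w: "word_perm is permutes {1..n}"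
    by (rule word_perm_permutes[OF s])
  have "inversions n (adj i \<circ> word_perm is) = Suc (inversions n (word_perm is)) \<or>
      inversions n (word_perm is) = Suc (inversions n (adj i \<circ> word_perm is))"
    using asc_or_desc[OF w, of i] inversions_adj_comp[OF w i] inversions_adj_comp_desc[OF w i]
    by blast
  then show ?case
    unfolding word_perm_snoc length_append_singleton using IH by linarith
qed simp

text \<open>Phrased with the inversion count instead of \<open>perm_length\<close>, so that
  reducedness can be tested one letter at a time; \<open>expression_of_perm_length_iff\<close>
  identifies the two notions.\<close>

definition reduced_word :: "nat \<Rightarrow> nat list \<Rightarrow> bool"
  where "reduced_word n is \<longleftrightarrow> set is \<subseteq> {1..<n} \<and> length is = inversions n (word_perm is)"

lemma reduced_word_exists:
  assumes "w permutes {1..n}"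
  shows "\<exists>is. reduced_word n is \<and> word_perm is = w"
  using assms
proof (induction "inversions n w" arbitrary: w rule: less_induct)
  case less
  show ?case
  proof (cases "w = id")
    case True
    then show ?thesis
      by (intro exI[of _ "[]"]) (simp add: reduced_word_def)
  next
    case False
    obtain i where i: "i \<in> {1..<n}" and desc: "pinv w (Suc i) < pinv w i"
      using exists_descent[OF less.prems False] by auto
    have "adj i \<circ> w permutes {1..n}"
      using less.prems i by (intro permutes_compose adj_permutes)
    moreover have l: "inversions n w = Suc (inversions n (adj i \<circ> w))"
      by (rule inversions_adj_comp_desc[OF less.prems i desc])
    ultimately obtain "is" where "reduced_word n is" "word_perm is = adj i \<circ> w"
      using less.hyps[of "adj i \<circ> w"] by auto
    then show ?thesis
      using i l by (intro exI[of _ "is @ [i]"]) (auto simp: reduced_word_def)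
  qed
qed

lemma perm_length_eq_inversions:
  assumes "w permutes {1..n}"
  shows "perm_length n w = inversions n w"
  unfolding perm_length_def
proof (rule Least_equality)
  show "\<exists>is. expression_of n w is \<and> length is = inversions n w"
    using reduced_word_exists[OF assms] by (auto simp: reduced_word_def expression_of_def)
qed (auto simp: expression_of_def inversions_word_perm_le)

lemma expression_of_perm_length_iff:
  assumes "w permutes {1..n}"
  shows "expression_of n w is \<and> length is = perm_length n w \<longleftrightarrow> reduced_word n is \<and> word_perm is = w"
  using perm_length_eq_inversions[OF assms] by (auto simp: expression_of_def reduced_word_def)

text \<open>If the last letter were a descent, the prefix would have more inversions than letters,
  and every letter creates at most one.\<close>

lemma reduced_word_snocD:
  assumes "reduced_word n (is @ [i])"
  shows "reduced_word n is" "i \<in> {1..<n}" "pinv (word_perm is) i < pinv (word_perm is) (Suc i)"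
proof -
  have i: "i \<in> {1..<n}" and s: "set is \<subseteq> {1..<n}"
    and l: "Suc (length is) = inversions n (adj i \<circ> word_perm is)"
    using assms by (auto simp: reduced_word_def)
  have w: "word_perm is permutes {1..n}" by (rule word_perm_permutes[OF s])
  have asc: "pinv (word_perm is) i < pinv (word_perm is) (Suc i)"
  proof (rule ccontr)
    assume "\<not> ?thesis"
    then have "inversions n (word_perm is) = Suc (inversions n (adj i \<circ> word_perm is))"
      using asc_or_desc[OF w] inversions_adj_comp_desc[OF w i] by blast
    then show False
      using inversions_word_perm_le[OF s] l by simp
  qed
  then show "reduced_word n is" "i \<in> {1..<n}" "pinv (word_perm is) i < pinv (word_perm is) (Suc i)"
    using inversions_adj_comp[OF w i] l i s by (auto simp: reduced_word_def)
qed

lemma reduced_word_snocI: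
  assumes "reduced_word n is" "i \<in> {1..<n}" "pinv (word_perm is) i < pinv (word_perm is) (Suc i)"
  shows "reduced_word n (is @ [i])"
  using assms inversions_adj_comp[OF word_perm_permutes] by (auto simp: reduced_word_def)

lemma reduced_word_ConsI:
  assumes "reduced_word n is" "k \<in> {1..<n}" "word_perm is k < word_perm is (Suc k)"
  shows "reduced_word n (k # is)"
  using assms inversions_comp_adj[OF word_perm_permutes]
  by (auto simp: reduced_word_def word_perm_Cons)

text \<open>Matsumoto's theorem for the symmetric group. Two reduced words of \<open>w\<close> ending in \<open>a\<close> and in
  \<open>b\<close> are both compared with a reduced word ending in the longest word in \<open>a\<close> and \<open>b\<close>.\<close>

theorem reduced_words_prod_eq:
  fixes g :: "nat \<Rightarrow> 'a::monoid_mult"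
  assumes far: "\<And>i j. \<lbrakk>i \<in> {1..<n}; j \<in> {1..<n}; Suc i < j\<rbrakk> \<Longrightarrow> g i * g j = g j * g i"
    and braid: "\<And>i. \<lbrakk>i \<in> {1..<n}; Suc i \<in> {1..<n}\<rbrakk> \<Longrightarrow>
      g i * g (Suc i) * g i = g (Suc i) * g i * g (Suc i)"
    and "reduced_word n is" "reduced_word n js" "word_perm is = word_perm js"
  shows "prod_list (map g is) = prod_list (map g js)"
  using assms(3-5)
proof (induction "length is" arbitrary: "is" js rule: less_induct)
  case less
  have len: "length is = length js"
    using less.prems by (simp add: reduced_word_def)
  show ?case
  proof (cases "is = []")
    case False
    then obtain is' a where is': "is = is' @ [a]" by (metis rev_exhaust)
    obtain js' b where js': "js = js' @ [b]" using False len by (metis length_0_conv rev_exhaust)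
    define w where "w = word_perm is"
    have red: "reduced_word n is'" "reduced_word n js'" and ab: "a \<in> {1..<n}" "b \<in> {1..<n}"
      using reduced_word_snocD less.prems is' js' by blast+
    have wj: "w = word_perm js" using less.prems w_def by simp
    have w: "w permutes {1..n}"
      using less.prems(1) unfolding w_def reduced_word_def by (intro word_perm_permutes) simp
    have wi: "word_perm is' = adj a \<circ> w"
      unfolding w_def is' by simp
    have wj': "word_perm js' = adj b \<circ> w"
      unfolding wj js' by simp
    have wa: "adj a \<circ> w permutes {1..n}" and wb: "adj b \<circ> w permutes {1..n}"
      using w ab by (simp_all only: permutes_compose adj_permutes)
    have da: "pinv w (Suc a) < pinv w a" and db: "pinv w (Suc b) < pinv w b"
      using reduced_word_snocD(3)[of n is' a] reduced_word_snocD(3)[of n js' b] less.prems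
      by (simp_all add: is' js' wi wj' inv_adj_comp_apply[OF w])
    have bw: "bij w" using w by (rule permutes_bij)
    have IH: "prod_list (map g is') = prod_list (map g ks)"
      if "reduced_word n ks" "word_perm ks = adj a \<circ> w" for ks
      using less.hyps[of is' ks] red that is' wi by simp
    have IH': "prod_list (map g js') = prod_list (map g ks)"
      if "reduced_word n ks" "word_perm ks = adj b \<circ> w" for ks
      using less.hyps[of js' ks] red that js' wj' len is' by simp
    consider "a = b" | "Suc a < b \<or> Suc b < a" | "b = Suc a \<or> a = Suc b" by linarith
    then show ?thesis
    proof cases
      case 1
      then show ?thesis
        using IH'[OF red(1)] wi is' js' by simp
    next
      case 2
      \<comment> \<open>\<open>ks\<close> represents \<open>w\<close> with both commuting letters
        stripped off its end. Appending \<open>b\<close> or \<open>a\<close> gives reduced words of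
        the permutations of \<open>is'\<close> and \<open>js'\<close>, so both induction hypotheses
        apply to it.\<close>
      obtain ks where ks: "reduced_word n ks" "word_perm ks = adj b \<circ> (adj a \<circ> w)"
        using reduced_word_exists[OF permutes_compose[OF wa adj_permutes[OF ab(2)]]] by auto
      have comm: "adj b \<circ> (adj a \<circ> w) = adj a \<circ> (adj b \<circ> w)"
        using 2 by (auto simp: fun_eq_iff Transposition.transpose_def)
      have 1: "reduced_word n (ks @ [b])"
        using ks ab db 2 bw
        by (intro reduced_word_snocI) (auto simp: inv_adj_comp bij_comp transpose_apply_other)
      have 3: "reduced_word n (ks @ [a])"
        using ks ab da 2 bw
        by (intro reduced_word_snocI) (auto simp: inv_adj_comp bij_comp transpose_apply_other)
      have "prod_list (map g is') = prod_list (map g ks) * g b"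
        using IH[OF 1] ks by simp
      moreover have "prod_list (map g js') = prod_list (map g ks) * g a"
        using IH'[OF 3] ks comm by simp
      moreover have "g a * g b = g b * g a"
        using far[of a b] far[of b a] 2 ab by auto
      ultimately show ?thesis
        by (simp add: is' js' mult.assoc)
    next
      case 3
      \<comment> \<open>\<open>u\<close> is \<open>w\<close> with the longest element of the
        subgroup generated by the two letters stripped off. Both letters are descents, so the
        positions of the three values involved are in reverse order and each of the three letters
        shortens.\<close>
      define u where "u = adj a \<circ> (adj b \<circ> (adj a \<circ> w))"
      have u: "u permutes {1..n}"
        unfolding u_def by (intro permutes_compose adj_permutes w ab)
      have u2: "u = adj b \<circ> (adj a \<circ> (adj b \<circ> w))"
        using 3 unfolding u_def by (auto simp: fun_eq_iff Transposition.transpose_def)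
      obtain ks where ks: "reduced_word n ks" "word_perm ks = u"
        using reduced_word_exists[OF u] by auto
      have ord: "pinv w (Suc (Suc (min a b))) < pinv w (Suc (min a b))"
        "pinv w (Suc (min a b)) < pinv w (min a b)"
        using da db 3 by (auto simp: min_def)
      have iu: "pinv u = pinv w \<circ> adj a \<circ> adj b \<circ> adj a"
        unfolding u_def using bw by (simp add: inv_adj_comp bij_comp comp_assoc)
      have iu2: "pinv u = pinv w \<circ> adj b \<circ> adj a \<circ> adj b"
        unfolding u2 using bw by (simp add: inv_adj_comp bij_comp comp_assoc)
      have iau: "pinv (adj a \<circ> u) = pinv w \<circ> adj a \<circ> adj b"
        unfolding u_def using bw by (simp add: inv_adj_comp bij_comp comp_assoc)
      have ibu: "pinv (adj b \<circ> u) = pinv w \<circ> adj b \<circ> adj a"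
        unfolding u2 using bw by (simp add: inv_adj_comp bij_comp comp_assoc)
      have ra: "reduced_word n (ks @ [a])"
        using ks ab ord 3
        by (intro reduced_word_snocI) (auto simp: iu transpose_apply_other min_def)
      have rb: "reduced_word n (ks @ [b])"
        using ks ab ord 3
        by (intro reduced_word_snocI) (auto simp: iu2 transpose_apply_other min_def)
      have rab: "reduced_word n ((ks @ [a]) @ [b])"
        by (rule reduced_word_snocI[OF ra ab(2)])
          (use ks ab ord 3 in \<open>auto simp: iau transpose_apply_other min_def\<close>)
      have rba: "reduced_word n ((ks @ [b]) @ [a])"
        by (rule reduced_word_snocI[OF rb ab(1)])
          (use ks ab ord 3 in \<open>auto simp: ibu transpose_apply_other min_def\<close>)
      have "prod_list (map g is') = prod_list (map g ks) * g a * g b"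
        using IH[OF rab, unfolded word_perm_snoc ks u_def adj_comp_adj] by (simp add: mult.assoc)
      moreover have "prod_list (map g js') = prod_list (map g ks) * g b * g a"
        using IH'[OF rba, unfolded word_perm_snoc ks u2 adj_comp_adj] by (simp add: mult.assoc)
      moreover have "g a * g b * g a = g b * g a * g b"
        using braid[of a] braid[of b] 3 ab by auto
      ultimately show ?thesis
        by (simp add: is' js' mult.assoc)
    qed
  qed (use len in simp)
qed

lemma permutes_extend_invariant:
  assumes step: "\<And>k f. k \<in> {1..<n} \<Longrightarrow> P f \<Longrightarrow> P (adj k \<circ> f)"
    and "P f" and w: "w permutes {1..n}"
  shows "P (w \<circ> f)"
proof -
  obtain "is" where "set is \<subseteq> {1..<n}" "word_perm is = w"
    using reduced_word_exists[OF w] by (auto simp: reduced_word_def)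
  moreover have "set is \<subseteq> {1..<n} \<Longrightarrow> P (word_perm is \<circ> f)" for "is"
    by (induction "is" rule: rev_induct) (use \<open>P f\<close> step in \<open>auto simp: comp_assoc\<close>)
  ultimately show ?thesis by auto
qed

section \<open>Set partitions and their Moebius function\<close>

text \<open>Through the equivalence relation of a set partition, refinement becomes an implication
  and joining two blocks becomes a closure under one pair.\<close>

definition same_block :: "nat set set \<Rightarrow> nat \<Rightarrow> nat \<Rightarrow> bool"
  where "same_block B i j \<longleftrightarrow> (\<exists>b\<in>B. i \<in> b \<and> j \<in> b)"

lemma same_block_sym: "same_block B i j \<longleftrightarrow> same_block B j i"
  by (auto simp: same_block_def)

lemma same_block_trans:
  "partition_on S B \<Longrightarrow> same_block B i j \<Longrightarrow> same_block B j k \<Longrightarrow> same_block B i k"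
  unfolding same_block_def partition_on_def disjoint_def by blast

lemma same_block_in: "partition_on S B \<Longrightarrow> same_block B i j \<Longrightarrow> i \<in> S \<and> j \<in> S"
  by (auto simp: same_block_def partition_on_def)

lemma same_block_refl: "partition_on S B \<Longrightarrow> i \<in> S \<Longrightarrow> same_block B i i"
  by (auto simp: same_block_def partition_on_def)

lemma refines_iff_same_block:
  assumes B: "partition_on S B" and D: "partition_on S D"
  shows "refines S B D \<longleftrightarrow> (\<forall>i j. same_block B i j \<longrightarrow> same_block D i j)"
proof
  assume "refines S B D"
  then show "\<forall>i j. same_block B i j \<longrightarrow> same_block D i j"
    unfolding refines_def same_block_def by blast
next
  assume *: "\<forall>i j. same_block B i j \<longrightarrow> same_block D i j"
  have "\<exists>d\<in>D. b \<subseteq> d" if b: "b \<in> B" for b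
  proof -
    have "b \<noteq> {}" using b B by (auto simp: partition_on_def)
    then obtain i where i: "i \<in> b" by blast
    then obtain d where d: "d \<in> D" "i \<in> d" using * b unfolding same_block_def by blast
    have "j \<in> d" if "j \<in> b" for j
    proof -
      obtain d' where "d' \<in> D" "i \<in> d'" "j \<in> d'"
        using * b i \<open>j \<in> b\<close> unfolding same_block_def by blast
      then show ?thesis using d D unfolding partition_on_def disjoint_def by blast
    qed
    then show ?thesis using d by blast
  qed
  then show "refines S B D" using B D by (simp add: refines_def)
qed

text \<open>The join, in the partition lattice, of \<open>B\<close> with the partition whose only
  possible nontrivial block is \<open>{j, k}\<close>: \<open>refines_merge_blocks\<close> and
  \<open>merge_blocks_refines\<close> are the two halves of its universal property.\<close>

definition merge_blocks :: "nat \<Rightarrow> nat \<Rightarrow> nat set set \<Rightarrow> nat set set"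
  where "merge_blocks j k B = insert (\<Union>{b\<in>B. j \<in> b \<or> k \<in> b}) {b\<in>B. j \<notin> b \<and> k \<notin> b}"

lemma partition_on_merge_blocks:
  assumes B: "partition_on S B" and "j \<in> S"
  shows "partition_on S (merge_blocks j k B)"
proof (rule partition_onI)
  show "\<Union>(merge_blocks j k B) = S"
    using B by (auto simp: merge_blocks_def partition_on_def)
  obtain b where "b \<in> B" "j \<in> b" using assms by (auto simp: partition_on_def)
  then show "{} \<notin> merge_blocks j k B"
    using B by (auto simp: merge_blocks_def partition_on_def)
  have dis: "b \<inter> b' = {}" if "b \<in> B" "b' \<in> B" "b \<noteq> b'" for b b'
    using that B by (auto simp: partition_on_def disjoint_def)
  show "disjnt b b'" if "b \<in> merge_blocks j k B" "b' \<in> merge_blocks j k B" "b \<noteq> b'" for b b'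
    using that dis unfolding merge_blocks_def disjnt_def by blast
qed

lemma same_block_merge_blocks:
  assumes "partition_on S B" "j \<in> S" "k \<in> S"
  shows "same_block (merge_blocks j k B) a b \<longleftrightarrow> same_block B a b \<or>
    (same_block B a j \<or> same_block B a k) \<and> (same_block B b j \<or> same_block B b k)"
proof -
  let ?U = "\<Union>{b\<in>B. j \<in> b \<or> k \<in> b}"
  have U: "x \<in> ?U \<longleftrightarrow> same_block B x j \<or> same_block B x k" for x
    by (auto simp: same_block_def)
  have trans: "same_block B x y \<Longrightarrow> same_block B y z \<Longrightarrow> same_block B x z" for x y z
    by (rule same_block_trans[OF assms(1)])
  have in_block: "y \<in> b" if b: "b \<in> B" "x \<in> b" "same_block B x y" for x y b
  proof -
    obtain b' where b': "b' \<in> B" "x \<in> b'" "y \<in> b'" using b(3) by (auto simp: same_block_def)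
    moreover have "b = b'"
      using b b' assms(1) unfolding partition_on_def disjoint_def by blast
    ultimately show ?thesis by simp
  qed
  have "(\<exists>b'\<in>{b\<in>B. j \<notin> b \<and> k \<notin> b}. a \<in> b' \<and> b \<in> b') \<longleftrightarrow> same_block B a b \<and> a \<notin> ?U"
    unfolding U using in_block by (auto simp: same_block_def)
  then have "same_block (merge_blocks j k B) a b \<longleftrightarrow>
      (a \<in> ?U \<and> b \<in> ?U) \<or> (same_block B a b \<and> a \<notin> ?U)"
    unfolding same_block_def[of "merge_blocks j k B"] unfolding merge_blocks_def bex_simps(5) by blast
  then show ?thesis
    unfolding U using trans same_block_sym[of B] by blast
qed

lemma same_block_merge_blocks_self:
  assumes "partition_on S B" "j \<in> S" "k \<in> S"
  shows "same_block (merge_blocks j k B) j k"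
  using assms same_block_refl[OF assms(1)] by (auto simp: same_block_merge_blocks[OF assms])

lemma refines_merge_blocks:
  assumes "partition_on S B" "j \<in> S" "k \<in> S"
  shows "refines S B (merge_blocks j k B)"
  using assms partition_on_merge_blocks[OF assms(1,2)]
  by (simp add: refines_iff_same_block same_block_merge_blocks)

lemma merge_blocks_refines:
  assumes "refines S B D" "same_block D j k" "j \<in> S" "k \<in> S"
  shows "refines S (merge_blocks j k B) D"
proof -
  have B: "partition_on S B" and D: "partition_on S D" using assms(1) by (auto simp: refines_def)
  then have "\<forall>i j. same_block B i j \<longrightarrow> same_block D i j"
    using assms(1) refines_iff_same_block by blast
  then show ?thesis
    using B D assms(2-4) same_block_trans[OF D] same_block_sym[of D]
    by (simp add: refines_iff_same_block partition_on_merge_blocks same_block_merge_blocks) metis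
qed

section \<open>Moebius sums in the partition lattice\<close>

lemma finite_refines: "finite {B. refines {1..n::nat} A B \<and> P B}"
  by (rule finite_subset[OF _ finitely_many_partition_on[of "{1..n}"]]) (auto simp: refines_def)

text \<open>The recursion of \<open>sp_mobius\<close> with the term for \<open>D\<close> itself
  moved to the other side.\<close>

lemma sp_mobius_sum:
  assumes "refines {1..n} A D"
  shows "(\<Sum>B | refines {1..n} A B \<and> refines {1..n} B D. sp_mobius n A B) = (if A = D then 1 else 0)"
proof -
  have D: "refines {1..n} D D" and A: "refines {1..n} A A"
    using assms by (auto simp: refines_def)
  show ?thesis
  proof (cases "A = D")
    case True
    then have "{B. refines {1..n} A B \<and> refines {1..n} B D} = {D}"
      using D by (auto dest: refines_asym)
    then show ?thesis using True D by (simp add: sp_mobius.simps)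
  next
    case False
    have "{B. refines {1..n} A B \<and> refines {1..n} B D} =
        insert D {B. refines {1..n} A B \<and> refines {1..n} B D \<and> B \<noteq> D}"
      using assms D by auto
    moreover have "sp_mobius n A D =
        - (\<Sum>C | refines {1..n} A C \<and> refines {1..n} C D \<and> C \<noteq> D. sp_mobius n A C)"
      using False assms by (subst sp_mobius.simps) simp
    ultimately show ?thesis
      using False finite_refines[of n A] by simp
  qed
qed

text \<open>The case of Weisner's theorem in which \<open>A\<close> is joined with a single pair.\<close>

lemma sp_mobius_merge_sum:
  fixes f :: "nat set set \<Rightarrow> 'a::ring_1"
  assumes A: "partition_on {1..n} A" and j: "j \<in> {1..n}" and k: "k \<in> {1..n}"
    and nsim: "\<not> same_block A j k"
  shows "(\<Sum>B | refines {1..n} A B. of_int (sp_mobius n A B) * f (merge_blocks j k B)) = 0"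
proof -
  let ?S = "{B. refines {1..n} A B}"
  let ?R = "refines {1..n}"
  let ?c = "merge_blocks j k"
  have finS: "finite ?S" using finite_refines[of n A "\<lambda>_. True"] by simp
  have part: "partition_on {1..n} B" if "B \<in> ?S" for B using that by (auto simp: refines_def)
  \<comment> \<open>The total Moebius weight of all \<open>B\<close> that merge to \<open>D\<close>.
    It is shown to vanish for every \<open>D\<close>, by induction on the size of the interval from
    \<open>A\<close> to \<open>D\<close>.\<close>
  define c where "c D = (\<Sum>B | B \<in> ?S \<and> ?c B = D. sp_mobius n A B)" for D
  have c0: "c D = 0" for D
  proof (induction "card {C. ?R A C \<and> ?R C D}" arbitrary: D rule: less_induct)
    case less
    show ?case
    proof (cases "D \<in> ?c ` ?S")
      case True
      then obtain B0 where B0: "?R A B0" "D = ?c B0" by auto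
      have pD: "partition_on {1..n} D"
        using B0 part j by (simp add: partition_on_merge_blocks)
      have AD: "?R A D"
        using B0 part[of B0] j k refines_merge_blocks[of "{1..n}" B0 j k] by (auto intro: refines_trans)
      have Dsim: "same_block D j k"
        using B0 part[of B0] j k by (simp add: same_block_merge_blocks_self)
      then have "A \<noteq> D" using nsim by auto
      \<comment> \<open>As \<open>D\<close> already joins \<open>j\<close> and \<open>k\<close>,
        merging does not leave the interval below \<open>D\<close>. The Moebius sum over that
        interval, which is 0, is therefore the sum of \<open>c C\<close> over its members
        \<open>C\<close>, and by induction only \<open>c D\<close> is left.\<close>
      have le_iff: "?R (?c B) D \<longleftrightarrow> ?R B D" if "B \<in> ?S" for B
        using that part[OF that] refines_merge_blocks[of "{1..n}" B j k] j k Dsim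
          merge_blocks_refines[of "{1..n}" B D j k] by (auto intro: refines_trans)
      have "0 = (\<Sum>B | ?R A B \<and> ?R B D. sp_mobius n A B)"
        using sp_mobius_sum[OF AD] \<open>A \<noteq> D\<close> by simp
      also have "{B. ?R A B \<and> ?R B D} = {B \<in> ?S. ?c B \<in> {C. ?R A C \<and> ?R C D}}"
        using le_iff refines_merge_blocks[of "{1..n}" _ j k] j k part
        by (auto intro: refines_trans)
      also have "(\<Sum>B\<in>\<dots>. sp_mobius n A B) =
          (\<Sum>C | ?R A C \<and> ?R C D. \<Sum>B | B \<in> {B \<in> ?S. ?c B \<in> {C. ?R A C \<and> ?R C D}} \<and> ?c B = C.
            sp_mobius n A B)"
        by (rule sum.group[symmetric]) (use finS finite_refines in auto)
      also have "\<dots> = (\<Sum>C | ?R A C \<and> ?R C D. c C)"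
        unfolding c_def by (intro sum.cong refl) auto
      also have "\<dots> = c D + (\<Sum>C\<in>{C. ?R A C \<and> ?R C D} - {D}. c C)"
        by (rule sum.remove) (use AD pD finite_refines in \<open>auto simp: refines_refl\<close>)
      also have "(\<Sum>C\<in>{C. ?R A C \<and> ?R C D} - {D}. c C) = 0"
      proof (rule sum.neutral, rule ballI)
        fix C assume C: "C \<in> {C. ?R A C \<and> ?R C D} - {D}"
        have "{B. ?R A B \<and> ?R B C} \<subset> {B. ?R A B \<and> ?R B D}"
        proof
          show "{B. ?R A B \<and> ?R B C} \<subseteq> {B. ?R A B \<and> ?R B D}"
            using C by (auto intro: refines_trans)
          have "D \<in> {B. ?R A B \<and> ?R B D}" using AD pD by (simp add: refines_refl)
          moreover have "D \<notin> {B. ?R A B \<and> ?R B C}" using C by (auto dest: refines_asym)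
          ultimately show "{B. ?R A B \<and> ?R B C} \<noteq> {B. ?R A B \<and> ?R B D}" by blast
        qed
        then show "c C = 0" by (intro less psubset_card_mono finite_refines)
      qed
      finally show ?thesis by simp
    next
      case False
      then have "{B. B \<in> ?S \<and> ?c B = D} = {}" by auto
      then show ?thesis unfolding c_def by (simp only: sum.empty)
    qed
  qed
  have "(\<Sum>B\<in>?S. of_int (sp_mobius n A B) * f (?c B)) =
      (\<Sum>D\<in>?c ` ?S. \<Sum>B | B \<in> ?S \<and> ?c B = D. of_int (sp_mobius n A B) * f (?c B))"
    by (rule sum.image_gen[OF finS])
  also have "\<dots> = (\<Sum>D\<in>?c ` ?S. of_int (c D) * f D)"
    unfolding c_def of_int_sum sum_distrib_right by (intro sum.cong refl) auto
  finally show ?thesis by (simp add: c0)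
qed

text \<open>The set partitions attached to multicompositions and to words arise as such kernels,
  with \<open>s\<close> giving the component of an index; refining one of them means that
  \<open>s\<close> is constant on blocks.\<close>

definition fibre_partition :: "nat \<Rightarrow> (nat \<Rightarrow> 'b) \<Rightarrow> nat set set"
  where "fibre_partition n s = (\<lambda>j. {k\<in>{1..n}. s k = s j}) ` {1..n}"

lemma partition_on_fibre_partition: "partition_on {1..n} (fibre_partition n s)"
  by (rule partition_onI) (auto simp: fibre_partition_def disjnt_def)

lemma same_block_fibre_partition:
  "same_block (fibre_partition n s) i j \<longleftrightarrow> i \<in> {1..n} \<and> j \<in> {1..n} \<and> s i = s j"
  by (auto simp: same_block_def fibre_partition_def)

lemma refines_fibre_partition:
  assumes "partition_on {1..n} B"
  shows "refines {1..n} B (fibre_partition n s) \<longleftrightarrow> (\<forall>i j. same_block B i j \<longrightarrow> s i = s j)"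
  unfolding refines_iff_same_block[OF assms partition_on_fibre_partition]
    same_block_fibre_partition
  using same_block_in[OF assms] by blast

section \<open>Consequences of the bt-relations\<close>

lemma prod_list_commute:
  fixes y :: "'a::monoid_mult"
  assumes "\<And>x. x \<in> set xs \<Longrightarrow> x * y = y * x"
  shows "prod_list xs * y = y * prod_list xs"
  using assms
proof (induction xs)
  case (Cons x xs)
  have "prod_list (x # xs) * y = x * (prod_list xs * y)" by (simp add: mult.assoc)
  also have "prod_list xs * y = y * prod_list xs" using Cons by simp
  also have "x * (y * prod_list xs) = (x * y) * prod_list xs" by (simp add: mult.assoc)
  also have "x * y = y * x" using Cons.prems by simp
  finally show ?case by (simp add: mult.assoc)
qed simp

text \<open>The complements of the domain and of the image have the same size, so any bijection
  between them completes \<open>h\<close>.\<close>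

lemma exists_permutation_with_values:
  assumes inj: "inj_on h {1..m}" and h: "h ` {1..m} \<subseteq> {1..n::nat}"
  shows "\<exists>w. w permutes {1..n} \<and> (\<forall>x\<in>{1..m}. w x = h x)"
proof -
  have "m \<le> n"
    using card_mono[OF _ h] card_image[OF inj] by simp
  then have sub: "{1..m} \<subseteq> {1..n}" by auto
  have "card ({1..n} - {1..m}) = card ({1..n} - h ` {1..m})"
    using card_Diff_subset[OF _ sub] card_Diff_subset[OF finite_imageI h] card_image[OF inj]
    by (metis finite_atLeastAtMost)
  then have "\<exists>k. bij_betw k ({1..n} - {1..m}) ({1..n} - h ` {1..m})"
    by (intro finite_same_card_bij) simp_all
  then obtain k where k: "bij_betw k ({1..n} - {1..m}) ({1..n} - h ` {1..m})" ..
  define w where "w x = (if x \<in> {1..m} then h x else if x \<in> {1..n} then k x else x)" for x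
  have "bij_betw w {1..m} (h ` {1..m})"
    using inj bij_betw_cong[of "{1..m}" w h "h ` {1..m}"] by (simp add: w_def inj_on_imp_bij_betw)
  moreover have "bij_betw w ({1..n} - {1..m}) ({1..n} - h ` {1..m})"
    using k bij_betw_cong[of "{1..n} - {1..m}" w k "{1..n} - h ` {1..m}"] by (simp add: w_def)
  ultimately have "bij_betw w ({1..m} \<union> ({1..n} - {1..m})) (h ` {1..m} \<union> ({1..n} - h ` {1..m}))"
    by (rule bij_betw_combine) auto
  then have "bij_betw w {1..n} {1..n}"
    using sub h by (simp add: Un_absorb1)
  then have "w permutes {1..n}"
    using sub by (intro bij_imp_permutes) (auto simp: w_def)
  then show ?thesis by (intro exI[of _ w]) (simp add: w_def)
qed

text \<open>The same list comprehension as in \<open>bt_E\<close>, so that both products have their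
  factors in the same order.\<close>

definition block_pairs :: "nat \<Rightarrow> nat set set \<Rightarrow> (nat \<times> nat) list"
  where "block_pairs n B = [(i, j). i \<leftarrow> [1..<n+1], j \<leftarrow> [i+1..<n+1], \<exists>b\<in>B. i \<in> b \<and> j \<in> b]"

lemma set_block_pairs:
  "set (block_pairs n B) = {(i, j). 1 \<le> i \<and> i < j \<and> j \<le> n \<and> same_block B i j}"
  by (auto simp: block_pairs_def same_block_def)

text \<open>Scalars appear as a central element \<open>q\<close> of the ring and its inverse, so
  that all computations below are identities of rings, without any module structure.\<close>

locale bt_relations =
  fixes n :: nat and g e :: "nat \<Rightarrow> 'a::ring_1" and q q' :: 'a
  assumes g_far: "\<lbrakk>i \<in> {1..<n}; j \<in> {1..<n}; index_dist i j > 1\<rbrakk> \<Longrightarrow> g i * g j = g j * g i"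
    and g_e: "i \<in> {1..<n} \<Longrightarrow> g i * e i = e i * g i"
    and braid: "\<lbrakk>i \<in> {1..<n}; j \<in> {1..<n}; index_dist i j = 1\<rbrakk> \<Longrightarrow> g i * g j * g i = g j * g i * g j"
    and e_g_g: "\<lbrakk>i \<in> {1..<n}; j \<in> {1..<n}; index_dist i j = 1\<rbrakk> \<Longrightarrow> e i * g j * g i = g j * g i * e j"
    and e_e_g: "\<lbrakk>i \<in> {1..<n}; j \<in> {1..<n}; index_dist i j = 1\<rbrakk> \<Longrightarrow> e i * e j * g j = e i * g j * e i"
    and e_g_e: "\<lbrakk>i \<in> {1..<n}; j \<in> {1..<n}; index_dist i j = 1\<rbrakk> \<Longrightarrow> e i * g j * e i = g j * e i * e j"
    and e_e: "\<lbrakk>i \<in> {1..<n}; j \<in> {1..<n}\<rbrakk> \<Longrightarrow> e i * e j = e j * e i"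
    and g_e_far: "\<lbrakk>i \<in> {1..<n}; j \<in> {1..<n}; index_dist i j > 1\<rbrakk> \<Longrightarrow> g i * e j = e j * g i"
    and e_idem: "i \<in> {1..<n} \<Longrightarrow> e i * e i = e i"
    and g_quad: "i \<in> {1..<n} \<Longrightarrow> g i * g i = 1 + (q - q') * e i * g i"
    and q_central: "q * x = x * q"
    and q_inverse: "q * q' = 1"
begin

lemma q'_central: "q' * x = x * q'"
proof -
  have "q' * x = q' * x * (q * q')" by (simp add: q_inverse)
  also have "\<dots> = q' * (q * x) * q'" by (simp add: mult.assoc q_central)
  also have "\<dots> = (q * q') * x * q'" by (simp add: mult.assoc q_central)
  finally show ?thesis by (simp add: q_inverse)
qed

lemma diff_central: "(q - q') * x = x * (q - q')"
  by (simp add: algebra_simps q_central q'_central)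

text \<open>The quadratic relation solved for the inverse of \<open>g i\<close>.\<close>

definition g_inv :: "nat \<Rightarrow> 'a"
  where "g_inv i = g i - (q - q') * e i"

lemma g_g_inv: "i \<in> {1..<n} \<Longrightarrow> g i * g_inv i = 1"
proof -
  assume i: "i \<in> {1..<n}"
  have "g i * ((q - q') * e i) = (q - q') * e i * g i"
    using g_e[OF i] diff_central[of "g i"] by (metis mult.assoc)
  then show ?thesis using g_quad[OF i] by (simp add: g_inv_def right_diff_distrib)
qed

lemma g_inv_g: "i \<in> {1..<n} \<Longrightarrow> g_inv i * g i = 1"
  using g_quad by (simp add: g_inv_def left_diff_distrib)

lemma commute_g_inv:
  assumes "i \<in> {1..<n}" "x * g i = g i * x"
  shows "x * g_inv i = g_inv i * x"
proof -
  have "x * g_inv i = g_inv i * (g i * x) * g_inv i"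
    using assms by (simp add: g_inv_g flip: mult.assoc)
  also have "\<dots> = g_inv i * x * (g i * g_inv i)"
    unfolding assms(2)[symmetric] by (simp add: mult.assoc)
  finally show ?thesis using assms by (simp add: g_g_inv)
qed

text \<open>\<open>E_dist d i\<close> is the idempotent \<open>E\<^sub>i\<^sub>j\<close> with \<open>j = i + d + 1\<close>.\<close>

primrec E_dist :: "nat \<Rightarrow> nat \<Rightarrow> 'a" where
  "E_dist 0 i = e i"
| "E_dist (Suc d) i = g i * E_dist d (Suc i) * g_inv i"

text \<open>Symmetric in the two indices, so that the generators can permute them regardless of
  their order.\<close>

definition E_pair :: "nat \<Rightarrow> nat \<Rightarrow> 'a"
  where "E_pair i j = (if i < j then E_dist (j - Suc i) i else E_dist (i - Suc j) j)"

lemma E_pair_sym: "i \<noteq> j \<Longrightarrow> E_pair i j = E_pair j i"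
  by (simp add: E_pair_def)

lemma commute_mult3:
  fixes x a b c :: 'a
  assumes "x * a = a * x" "x * b = b * x" "x * c = c * x"
  shows "x * (a * b * c) = a * b * c * x"
  by (metis assms mult.assoc)

section \<open>Conjugation of the idempotents \<open>E\<^sub>i\<^sub>j\<close> by the
  generators\<close>

lemma g_E_dist_far:
  assumes "k \<in> {1..<n}" "1 \<le> i" "i + d < n" "Suc k < i \<or> i + d + 1 < k"
  shows "g k * E_dist d i = E_dist d i * g k"
  using assms
proof (induction d arbitrary: i)
  case 0
  then show ?case by (auto intro: g_e_far simp: index_dist_def)
next
  case (Suc d)
  have "g k * g i = g i * g k"
    using Suc.prems by (intro g_far) (auto simp: index_dist_def)
  moreover have "g k * E_dist d (Suc i) = E_dist d (Suc i) * g k"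
    using Suc.prems by (intro Suc.IH) auto
  ultimately show ?case
    using Suc.prems commute_g_inv[of i "g k"] by (auto intro!: commute_mult3)
qed

text \<open>The braid relation multiplied on both sides by
  \<open>g_inv (Suc i) * g_inv i\<close>.\<close>

lemma g_inv_braid:
  assumes "i \<in> {1..<n}" "Suc i \<in> {1..<n}"
  shows "g i * g_inv (Suc i) * g_inv i = g_inv (Suc i) * g_inv i * g (Suc i)"
proof -
  have b: "g i * g (Suc i) * g i = g (Suc i) * g i * g (Suc i)"
    using assms by (intro braid) (auto simp: index_dist_def)
  have "g i * g_inv (Suc i) * g_inv i =
      g_inv (Suc i) * g_inv i * (g i * g (Suc i) * g i) * g_inv (Suc i) * g_inv i"
    using assms by (simp add: mult.assoc[of _ "g_inv i"] flip: mult.assoc[of "g_inv i"])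
      (simp add: g_inv_g flip: mult.assoc)
  also have "\<dots> = g_inv (Suc i) * g_inv i * g (Suc i) * g i * (g (Suc i) * g_inv (Suc i)) * g_inv i"
    unfolding b by (simp add: mult.assoc)
  also have "\<dots> = g_inv (Suc i) * g_inv i * g (Suc i)"
    using assms by (simp add: g_g_inv mult.assoc)
  finally show ?thesis .
qed

text \<open>For \<open>k = i + 1\<close> the braid relation carries \<open>g k\<close> through the
  two outermost conjugating factors, turning it into \<open>g i\<close>, which commutes with the
  idempotent further inside. For larger \<open>k\<close> the outermost factor commutes with
  \<open>g k\<close> and the induction hypothesis applies.\<close>

lemma g_E_dist_inner:
  assumes "1 \<le> i" "i + d < n" "i < k" "k < i + d"
  shows "g k * E_dist d i = E_dist d i * g k"
  using assms
proof (induction d arbitrary: i)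
  case (Suc d)
  note prems = Suc.prems
  show ?case
  proof (cases "k = Suc i")
    case True
    then obtain d' where d: "d = Suc d'" using prems by (cases d) auto
    define y where "y = E_dist d' (Suc k)"
    have k: "k \<in> {1..<n}" "i \<in> {1..<n}" "Suc i \<in> {1..<n}" using prems True by auto
    have y: "g i * y = y * g i"
      unfolding y_def using prems True d by (intro g_E_dist_far) auto
    have b: "g i * g k * g i = g k * g i * g k"
      using k True by (intro braid) (auto simp: index_dist_def)
    have E: "E_dist (Suc d) i = g i * (g k * y * g_inv k) * g_inv i"
      by (simp add: d y_def True)
    have "g k * E_dist (Suc d) i = (g k * g i * g k) * y * g_inv k * g_inv i"
      unfolding E by (simp add: mult.assoc)
    also have "\<dots> = g i * g k * (g i * y) * g_inv k * g_inv i"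
      unfolding b[symmetric] by (simp add: mult.assoc)
    also have "\<dots> = g i * g k * y * (g i * g_inv k * g_inv i)"
      unfolding y by (simp add: mult.assoc)
    also have "\<dots> = E_dist (Suc d) i * g k"
      unfolding True g_inv_braid[OF k(2,3)] E[unfolded True] by (simp add: mult.assoc)
    finally show ?thesis .
  next
    case False
    have "g k * g i = g i * g k"
      using prems False by (intro g_far) (auto simp: index_dist_def)
    moreover have "g k * E_dist d (Suc i) = E_dist d (Suc i) * g k"
      using prems False by (intro Suc.IH) auto
    ultimately show ?thesis
      using prems commute_g_inv[of i "g k"] by (auto intro!: commute_mult3)
  qed
qed simp

text \<open>By the quadratic relation it suffices that \<open>e i * g i\<close> commutes with
  \<open>e (Suc i)\<close>, although \<open>g i\<close> alone need not. The consequence is that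
  \<open>g i\<close> and its inverse conjugate \<open>e (Suc i)\<close> to the same element.\<close>

lemma g_sq_e:
  assumes "i \<in> {1..<n}" "Suc i \<in> {1..<n}"
  shows "g i * g i * e (Suc i) = e (Suc i) * (g i * g i)"
proof -
  have "e (Suc i) * e i * g i = e (Suc i) * g i * e (Suc i)"
    "e (Suc i) * g i * e (Suc i) = g i * e (Suc i) * e i"
    "e i * e (Suc i) = e (Suc i) * e i"
    using assms by (auto intro!: e_e_g e_g_e e_e simp: index_dist_def)
  then have "e i * g i * e (Suc i) = e (Suc i) * (e i * g i)"
    using g_e[OF assms(1)] by (metis mult.assoc)
  then have "(q - q') * (e i * g i * e (Suc i)) = e (Suc i) * ((q - q') * e i * g i)"
    by (metis diff_central mult.assoc)
  then show ?thesis
    unfolding g_quad[OF assms(1)] distrib_left distrib_right by (simp add: mult.assoc)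
qed

text \<open>For \<open>d = 0\<close> this is the relation \<open>e_g_g\<close>; in general the outer
  conjugating factor \<open>g i\<close> is far enough from the right end to commute with the
  generator there.\<close>

lemma g_E_dist_shrink_right:
  assumes "1 \<le> i" "i + Suc d < n"
  shows "g (i + Suc d) * E_dist (Suc d) i = E_dist d i * g (i + Suc d)"
  using assms
proof (induction d arbitrary: i)
  case 0
  have "e i * g (Suc i) * g i = g (Suc i) * g i * e (Suc i)"
    using 0 by (intro e_g_g) (auto simp: index_dist_def)
  then have "g (Suc i) * (g i * e (Suc i) * g_inv i) = e i * g (Suc i) * (g i * g_inv i)"
    by (metis mult.assoc)
  then show ?case using 0 by (simp add: g_g_inv)
next
  case (Suc d)
  let ?k = "i + Suc (Suc d)"
  have far: "g ?k * g i = g i * g ?k"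
    using Suc.prems by (intro g_far) (auto simp: index_dist_def)
  have IH: "g ?k * E_dist (Suc d) (Suc i) = E_dist d (Suc i) * g ?k"
    using Suc.IH[of "Suc i"] Suc.prems by simp
  have far': "g ?k * g_inv i = g_inv i * g ?k"
    using Suc.prems far by (intro commute_g_inv) auto
  have "g ?k * E_dist (Suc (Suc d)) i = g ?k * g i * E_dist (Suc d) (Suc i) * g_inv i"
    by (simp add: mult.assoc)
  also have "\<dots> = g i * (g ?k * E_dist (Suc d) (Suc i)) * g_inv i"
    unfolding far by (simp add: mult.assoc)
  also have "\<dots> = g i * E_dist d (Suc i) * (g ?k * g_inv i)"
    unfolding IH by (simp add: mult.assoc)
  also have "\<dots> = E_dist (Suc d) i * g ?k"
    unfolding far' by (simp add: mult.assoc)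
  finally show ?case .
qed

text \<open>For \<open>d = 0\<close> the relation \<open>e_g_g\<close> produces
  \<open>e (Suc i)\<close> conjugated by the inverse of \<open>g i\<close>, whereas
  \<open>E_dist\<close> conjugates by \<open>g i\<close> itself; \<open>g_sq_e\<close> reconciles
  the two.\<close>

lemma g_E_dist_grow_right:
  assumes "1 \<le> i" "i + Suc d < n"
  shows "g (i + Suc d) * E_dist d i = E_dist (Suc d) i * g (i + Suc d)"
  using assms
proof (induction d arbitrary: i)
  case 0
  have i: "i \<in> {1..<n}" "Suc i \<in> {1..<n}" using 0 by auto
  have "e (Suc i) * g i * g (Suc i) = g i * g (Suc i) * e i"
    using 0 by (intro e_g_g) (auto simp: index_dist_def)
  then have "g (Suc i) * e i = g_inv i * e (Suc i) * g i * g (Suc i)"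
    using g_inv_g[OF i(1)] by (metis mult.assoc mult.left_neutral)
  moreover have "g_inv i * e (Suc i) * g i = g i * e (Suc i) * g_inv i"
  proof -
    have "g_inv i * e (Suc i) * g i = g_inv i * (e (Suc i) * (g i * g i)) * g_inv i"
      using g_g_inv[OF i(1)] by (simp add: mult.assoc)
    also have "\<dots> = (g_inv i * g i) * g i * e (Suc i) * g_inv i"
      unfolding g_sq_e[OF i, symmetric] by (simp add: mult.assoc)
    finally show ?thesis by (simp add: g_inv_g[OF i(1)])
  qed
  ultimately show ?case by simp
next
  case (Suc d)
  let ?k = "i + Suc (Suc d)"
  have far: "g ?k * g i = g i * g ?k"
    using Suc.prems by (intro g_far) (auto simp: index_dist_def)
  have IH: "g ?k * E_dist d (Suc i) = E_dist (Suc d) (Suc i) * g ?k"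
    using Suc.IH[of "Suc i"] Suc.prems by simp
  have far': "g ?k * g_inv i = g_inv i * g ?k"
    using Suc.prems far by (intro commute_g_inv) auto
  have "g ?k * E_dist (Suc d) i = g ?k * g i * E_dist d (Suc i) * g_inv i"
    by (simp add: mult.assoc)
  also have "\<dots> = g i * (g ?k * E_dist d (Suc i)) * g_inv i"
    unfolding far by (simp add: mult.assoc)
  also have "\<dots> = g i * E_dist (Suc d) (Suc i) * (g ?k * g_inv i)"
    unfolding IH by (simp add: mult.assoc)
  also have "\<dots> = E_dist (Suc (Suc d)) i * g ?k"
    unfolding far' by (simp add: mult.assoc)
  finally show ?case .
qed

text \<open>\<open>E_dist\<close> is rewritten as a conjugate taken at its right end, where the
  generator commutes with \<open>g i\<close>; this reduces the distance until \<open>g_sq_e\<close>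
  applies.\<close>

lemma g_sq_E_dist:
  assumes "1 \<le> i" "Suc i + d < n"
  shows "g i * g i * E_dist d (Suc i) = E_dist d (Suc i) * (g i * g i)"
  using assms
proof (induction d)
  case 0
  then show ?case using g_sq_e by simp
next
  case (Suc d)
  let ?k = "Suc i + Suc d" and ?x = "g i * g i"
  have k: "?k \<in> {1..<n}" using Suc.prems by auto
  have "g i * g ?k = g ?k * g i"
    using Suc.prems by (intro g_far) (auto simp: index_dist_def)
  then have x: "?x * g ?k = g ?k * ?x" by (metis mult.assoc)
  have "E_dist (Suc d) (Suc i) = g ?k * E_dist d (Suc i) * g_inv ?k"
    using g_E_dist_grow_right[of "Suc i" d] Suc.prems(2) g_g_inv[OF k]
    by (metis One_nat_def Suc_le_eq mult.assoc mult.right_neutral zero_less_Suc)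
  moreover have "?x * E_dist d (Suc i) = E_dist d (Suc i) * ?x"
    using Suc by simp
  ultimately show ?case
    using x commute_g_inv[OF k x] by (metis commute_mult3)
qed

lemma g_E_dist_shrink_left:
  assumes "1 \<le> i" "i + Suc d < n"
  shows "g i * E_dist (Suc d) i = E_dist d (Suc i) * g i"
proof -
  have i: "i \<in> {1..<n}" using assms by auto
  have "g i * E_dist (Suc d) i = (g i * g i * E_dist d (Suc i)) * g_inv i"
    by (simp add: mult.assoc)
  also have "\<dots> = E_dist d (Suc i) * g i * (g i * g_inv i)"
    using g_sq_E_dist[of i d] assms by (simp add: mult.assoc)
  finally show ?thesis by (simp add: g_g_inv[OF i])
qed

lemma g_E_pair:
  assumes "k \<in> {1..<n}" "i \<in> {1..n}" "j \<in> {1..n}" "i \<noteq> j"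
  shows "g k * E_pair i j = E_pair (adj k i) (adj k j) * g k"
proof -
  have less: "g k * E_pair i j = E_pair (adj k i) (adj k j) * g k"
    if ij: "i < j" "i \<in> {1..n}" "j \<in> {1..n}" for i j
  proof -
    obtain d where d: "j = i + Suc d"
      using ij less_imp_Suc_add by force
    have Eij: "E_pair i j = E_dist d i" by (simp add: E_pair_def d)
    \<comment> \<open>The position of \<open>{k, k + 1}\<close> relative to \<open>i < j\<close>:
      outside, strictly between, extending the left end, equal to the pair, shortening at the left,
      shortening at the right, extending the right end.\<close>
    consider "Suc k < i \<or> j < k" | "i < k" "Suc k < j" | "Suc k = i" | "k = i" "j = Suc i"
      | "k = i" "Suc i < j" | "Suc k = j" "i < k" | "k = j"
      using d by linarith
    then show ?thesis
    proof cases
      case 1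
      then show ?thesis
        using g_E_dist_far[of k i d] assms ij d Eij
        by (auto simp: transpose_apply_other)
    next
      case 2
      then show ?thesis
        using g_E_dist_inner[of i d k] assms ij d Eij by (auto simp: transpose_apply_other)
    next
      case 3
      then have "adj k i = k" "adj k j = j" using d by (auto simp: transpose_apply_other)
      moreover have "E_pair k j = g k * E_dist d i * g_inv k"
        using 3 d by (simp add: E_pair_def flip: 3)
      ultimately show ?thesis
        using g_inv_g[OF assms(1)] Eij by (simp add: mult.assoc)
    next
      case 4
      then have "E_pair (adj k i) (adj k j) = e i" "E_pair i j = e i" by (auto simp: E_pair_def)
      then show ?thesis using g_e assms 4 by simp
    next
      case 5
      then obtain d' where d': "d = Suc d'" using d by (cases d) auto
      have "adj k i = Suc i" "adj k j = j" using 5 d by (auto simp: transpose_apply_other)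
      moreover have "E_pair (Suc i) j = E_dist d' (Suc i)" using d d' by (simp add: E_pair_def)
      ultimately show ?thesis
        using g_E_dist_shrink_left[of i d'] 5 Eij ij d d' by simp
    next
      case 6
      then obtain d' where d': "d = Suc d'" using d by (cases d) auto
      have "adj k i = i" "adj k j = k" using 6 by (auto simp: transpose_apply_other)
      moreover have "E_pair i k = E_dist d' i" "k = i + Suc d'"
        using d d' 6 by (auto simp: E_pair_def)
      ultimately show ?thesis
        using g_E_dist_shrink_right[of i d'] 6 Eij ij d d' by simp
    next
      case 7
      then have "adj k i = i" "adj k j = Suc j" using ij by (auto simp: transpose_apply_other)
      moreover have "E_pair i (Suc j) = E_dist (Suc d) i" using d by (simp add: E_pair_def)
      ultimately show ?thesis
        using g_E_dist_grow_right[of i d] 7 Eij ij d assms by simp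
    qed
  qed
  consider "i < j" | "j < i" using assms by linarith
  then show ?thesis
  proof cases
    case 2
    have "adj k i \<noteq> adj k j" using assms(4) by (metis transpose_involutory)
    then show ?thesis using less[OF 2] assms by (simp add: E_pair_sym)
  qed (use less assms in auto)
qed

lemma E_pair_conj:
  assumes "k \<in> {1..<n}" "i \<in> {1..n}" "j \<in> {1..n}" "i \<noteq> j"
  shows "E_pair (adj k i) (adj k j) = g k * E_pair i j * g_inv k"
  using g_E_pair[OF assms] g_g_inv[OF assms(1)] by (simp add: mult.assoc)

text \<open>Simultaneous conjugation reduces a relation between the \<open>E\<^sub>i\<^sub>j\<close> to the case where the
  indices are \<open>1, \<dots>, m\<close>.\<close>

lemma E_pair_canonical:
  assumes inv: "\<And>k f. k \<in> {1..<n} \<Longrightarrow> f ` {1..m} \<subseteq> {1..n} \<Longrightarrow> inj_on f {1..m} \<Longrightarrow> P f \<Longrightarrow> P (adj k \<circ> f)"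
    and cong: "\<And>f f'. (\<forall>x\<in>{1..m}. f x = f' x) \<Longrightarrow> P f = P f'"
    and base: "m \<le> n \<Longrightarrow> P id"
    and f: "f ` {1..m} \<subseteq> {1..n}" "inj_on f {1..m}"
  shows "P f"
proof -
  \<comment> \<open>Range and injectivity travel along with \<open>P\<close>, because each induction
    step needs them for the intermediate map.\<close>
  let ?Q = "\<lambda>f. f ` {1..m} \<subseteq> {1..n} \<and> inj_on f {1..m} \<and> P f"
  obtain w where w: "w permutes {1..n}" "\<forall>x\<in>{1..m}. w x = f x"
    using exists_permutation_with_values[OF f(2,1)] by auto
  have mn: "m \<le> n"
    using card_mono[OF _ f(1)] card_image[OF f(2)] by simp
  have "?Q (w \<circ> id)"
  proof (rule permutes_extend_invariant[of n ?Q])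
    show "?Q id" using mn base by auto
    fix k f assume k: "k \<in> {1..<n}" and Q: "?Q f"
    have "(adj k \<circ> f) ` {1..m} \<subseteq> adj k ` {1..n}" using Q by auto
    also have "\<dots> = {1..n}" using permutes_image[OF adj_permutes[OF k]] .
    finally show "?Q (adj k \<circ> f)"
      using inv[OF k] Q by (auto intro!: comp_inj_on)
  qed (rule w(1))
  then show ?thesis using cong[of w f] w(2) by simp
qed

lemma conj_mult:
  assumes "k \<in> {1..<n}"
  shows "(g k * x * g_inv k) * (g k * y * g_inv k) = g k * (x * y) * g_inv k"
proof -
  have "(g k * x * g_inv k) * (g k * y * g_inv k) = g k * x * (g_inv k * g k) * y * g_inv k"
    by (simp add: mult.assoc)
  then show ?thesis by (simp add: g_inv_g[OF assms] mult.assoc)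
qed

lemma E_pair_idem:
  assumes "i \<in> {1..n}" "j \<in> {1..n}" "i \<noteq> j"
  shows "E_pair i j * E_pair i j = E_pair i j"
proof -
  let ?f = "\<lambda>x::nat. if x = 1 then i else j"
  let ?P = "\<lambda>f. E_pair (f 1) (f 2) * E_pair (f 1) (f 2) = E_pair (f 1) (f (2::nat))"
  have "?P ?f"
  proof (rule E_pair_canonical[of 2 ?P])
    fix k f assume k: "k \<in> {1..<n}" and f: "f ` {1..2::nat} \<subseteq> {1..n}" "inj_on f {1..2}" and "?P f"
    have "f 1 \<noteq> f 2" "f 1 \<in> {1..n}" "f 2 \<in> {1..n}"
      using f by (auto simp: inj_on_eq_iff image_subset_iff)
    then show "?P (adj k \<circ> f)"
      using \<open>?P f\<close> by (simp add: E_pair_conj[OF k] conj_mult[OF k])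
  next
    show "?P id" if "2 \<le> n"
      using e_idem[of 1] that by (simp add: E_pair_def)
  qed (use assms in \<open>auto simp: inj_on_def\<close>)
  then show ?thesis by simp
qed

text \<open>The second identity expresses transitivity: joining \<open>i\<close> with
  \<open>j\<close> and \<open>j\<close> with \<open>k\<close> has joined \<open>i\<close> with
  \<open>k\<close>. It is what makes a product of such idempotents depend only on the partition they
  generate.\<close>

lemma E_pair_triangle:
  assumes "i \<in> {1..n}" "j \<in> {1..n}" "k \<in> {1..n}" "i \<noteq> j" "j \<noteq> k" "i \<noteq> k"
  shows "E_pair i j * E_pair j k = E_pair j k * E_pair i j"
    and "E_pair i j * E_pair j k * E_pair i k = E_pair i j * E_pair j k"
proof -
  let ?f = "\<lambda>x::nat. if x = 1 then i else if x = 2 then j else k"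
  let ?P = "\<lambda>f. E_pair (f 1) (f 2) * E_pair (f 2) (f 3) = E_pair (f 2) (f (3::nat)) * E_pair (f 1) (f 2)
    \<and> E_pair (f 1) (f 2) * E_pair (f 2) (f 3) * E_pair (f 1) (f 3) = E_pair (f 1) (f 2) * E_pair (f 2) (f 3)"
  have "?P ?f"
  proof (rule E_pair_canonical[of 3 ?P])
    fix k f assume k: "k \<in> {1..<n}" and f: "f ` {1..3::nat} \<subseteq> {1..n}" "inj_on f {1..3}" and "?P f"
    have "f 1 \<noteq> f 2" "f 2 \<noteq> f 3" "f 1 \<noteq> f 3" "f 1 \<in> {1..n}" "f 2 \<in> {1..n}" "f 3 \<in> {1..n}"
      using f by (auto simp: inj_on_eq_iff image_subset_iff)
    then have conj: "E_pair ((adj k \<circ> f) x) ((adj k \<circ> f) y) = g k * E_pair (f x) (f y) * g_inv k"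
      if "(x, y) \<in> {(1, 2), (2, 3), (1, 3)}" for x y
      using that by (auto simp: E_pair_conj[OF k])
    have "E_pair (f 1) (f 2) * E_pair (f 2) (f 3) = E_pair (f 2) (f 3) * E_pair (f 1) (f 2)"
      and "E_pair (f 1) (f 2) * E_pair (f 2) (f 3) * E_pair (f 1) (f 3) = E_pair (f 1) (f 2) * E_pair (f 2) (f 3)"
      using \<open>?P f\<close> by blast+
    then show "?P (adj k \<circ> f)"
      using conj[of 1 2] conj[of 2 3] conj[of 1 3] conj_mult[OF k] by simp
  next
    assume n: "3 \<le> n"
    then have r: "(1::nat) \<in> {1..<n}" "(2::nat) \<in> {1..<n}" "index_dist 2 1 = 1"
      by (auto simp: index_dist_def)
    have E: "E_pair 1 2 = e 1" "E_pair 2 3 = e 2" "E_pair 1 3 = g 1 * e 2 * g_inv 1"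
      by (simp_all add: E_pair_def numeral_2_eq_2 numeral_3_eq_3)
    have comm: "e 1 * e 2 = e 2 * e 1" using r by (intro e_e)
    \<comment> \<open>This relation absorbs the middle of the conjugate
      \<open>g 1 * e 2 * g_inv 1\<close>, after which \<open>g 1\<close> meets its inverse.\<close>
    have "e 2 * g 1 * e 2 = e 2 * e 1 * g 1" using e_e_g[of 2 1] r by simp
    moreover have "e 1 * e 2 * (g 1 * e 2 * g_inv 1) = e 1 * (e 2 * g 1 * e 2) * g_inv 1"
      by (simp add: mult.assoc)
    ultimately have "e 1 * e 2 * (g 1 * e 2 * g_inv 1) = e 1 * (e 2 * e 1 * g 1) * g_inv 1"
      by simp
    also have "\<dots> = (e 1 * e 1) * e 2 * (g 1 * g_inv 1)"
      unfolding comm[symmetric] by (simp add: mult.assoc)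
    also have "\<dots> = e 1 * e 2" using e_idem[of 1] g_g_inv[of 1] r by simp
    finally show "?P id" using comm unfolding id_apply E by blast
  qed (use assms in \<open>auto simp: inj_on_def\<close>)
  moreover have f: "?f 1 = i" "?f 2 = j" "?f 3 = k" by simp_all
  ultimately have "E_pair i j * E_pair j k = E_pair j k * E_pair i j \<and>
      E_pair i j * E_pair j k * E_pair i k = E_pair i j * E_pair j k"
    unfolding f by blast
  then show "E_pair i j * E_pair j k = E_pair j k * E_pair i j"
    "E_pair i j * E_pair j k * E_pair i k = E_pair i j * E_pair j k" by blast+
qed

lemma E_pair_disjoint:
  assumes "i \<in> {1..n}" "j \<in> {1..n}" "a \<in> {1..n}" "b \<in> {1..n}"
    and "distinct [i, j, a, b]"
  shows "E_pair i j * E_pair a b = E_pair a b * E_pair i j"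
proof -
  let ?f = "\<lambda>x::nat. if x = 1 then i else if x = 2 then j else if x = 3 then a else b"
  let ?P = "\<lambda>f. E_pair (f 1) (f 2) * E_pair (f 3) (f 4) = E_pair (f 3) (f (4::nat)) * E_pair (f 1) (f 2)"
  have "?P ?f"
  proof (rule E_pair_canonical[of 4 ?P])
    fix k f assume k: "k \<in> {1..<n}" and f: "f ` {1..4::nat} \<subseteq> {1..n}" "inj_on f {1..4}" and "?P f"
    have "f 1 \<noteq> f 2" "f 3 \<noteq> f 4" "f 1 \<in> {1..n}" "f 2 \<in> {1..n}" "f 3 \<in> {1..n}" "f 4 \<in> {1..n}"
      using f by (auto simp: inj_on_eq_iff image_subset_iff)
    then show "?P (adj k \<circ> f)"
      using \<open>?P f\<close> by (simp add: E_pair_conj[OF k] conj_mult[OF k])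
  next
    show "?P id" if "4 \<le> n"
      using e_e[of 1 3] that by (simp add: E_pair_def)
  next
    have "{1..4} = {1, 2, 3, 4::nat}" by auto
    then show "inj_on ?f {1..4}" using assms by simp
  qed (use assms in auto)
  then show ?thesis by simp
qed

lemma E_pair_commute:
  assumes "i \<in> {1..n}" "j \<in> {1..n}" "i \<noteq> j" "a \<in> {1..n}" "b \<in> {1..n}" "a \<noteq> b"
  shows "E_pair i j * E_pair a b = E_pair a b * E_pair i j"
proof -
  consider "a = i" "b = j" | "a = j" "b = i" | "a = i" "b \<noteq> j" | "a = j" "b \<noteq> i"
    | "b = i" "a \<noteq> j" | "b = j" "a \<noteq> i" | "distinct [i, j, a, b]"
    using assms by auto
  then show ?thesis
  proof cases
    case 2
    then show ?thesis using assms by (simp add: E_pair_sym)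
  next
    case 3
    then show ?thesis
      using E_pair_triangle(1)[of j i b] assms by (simp add: E_pair_sym[of j i])
  next
    case 4
    then show ?thesis using E_pair_triangle(1)[of i j b] assms by simp
  next
    case 5
    then show ?thesis
      using E_pair_triangle(1)[of j i a] assms by (simp add: E_pair_sym[of j i] E_pair_sym[of a i])
  next
    case 6
    then show ?thesis
      using E_pair_triangle(1)[of i j a] assms by (simp add: E_pair_sym[of a j])
  qed (use assms E_pair_disjoint in auto)
qed

section \<open>Products over the blocks of a set partition and the idempotents obtained from them by
  Moebius inversion\<close>

definition E_part :: "nat set set \<Rightarrow> 'a"
  where "E_part B = prod_list (map (\<lambda>(i, j). E_pair i j) (block_pairs n B))"

lemma mult_E_part_absorb:
  assumes "\<And>i j. i \<in> {1..n} \<Longrightarrow> j \<in> {1..n} \<Longrightarrow> i \<noteq> j \<Longrightarrow> same_block B i j \<Longrightarrow> y * E_pair i j = y"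
  shows "y * E_part B = y"
proof -
  have "y * prod_list (map (\<lambda>(i, j). E_pair i j) ps) = y" if "set ps \<subseteq> set (block_pairs n B)" for ps
    using that
  proof (induction ps)
    case (Cons p ps)
    then obtain i j where p: "p = (i, j)" "y * E_pair i j = y"
      using assms by (cases p) (auto simp: set_block_pairs)
    then show ?case using Cons by (simp flip: mult.assoc)
  qed simp
  then show ?thesis unfolding E_part_def by auto
qed

lemma E_part_E_pair_commute:
  assumes "i \<in> {1..n}" "j \<in> {1..n}" "i \<noteq> j"
  shows "E_part B * E_pair i j = E_pair i j * E_part B"
  unfolding E_part_def
  by (rule prod_list_commute) (auto simp: set_block_pairs intro!: E_pair_commute assms)

text \<open>The extra factor commutes leftwards to its own occurrence in the product, where
  idempotence swallows it.\<close>

lemma E_part_absorb: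
  assumes ij: "i \<in> {1..n}" "j \<in> {1..n}" "i \<noteq> j" and B: "same_block B i j"
  shows "E_part B * E_pair i j = E_part B"
proof -
  have "prod_list (map (\<lambda>(i, j). E_pair i j) ps) * E_pair i j = prod_list (map (\<lambda>(i, j). E_pair i j) ps)"
    if "set ps \<subseteq> set (block_pairs n B)" "(i, j) \<in> set ps \<or> (j, i) \<in> set ps" for ps
    using that
  proof (induction ps)
    case (Cons p ps)
    obtain a b where p: "p = (a, b)" by (cases p)
    show ?case
    proof (cases "(i, j) \<in> set ps \<or> (j, i) \<in> set ps")
      case True
      then show ?thesis using Cons p by (simp add: mult.assoc)
    next
      case False
      then have "E_pair a b = E_pair i j" using Cons.prems p E_pair_sym[OF ij(3)] by auto
      moreover have "prod_list (map (\<lambda>(i, j). E_pair i j) ps) * E_pair i j =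
          E_pair i j * prod_list (map (\<lambda>(i, j). E_pair i j) ps)"
        using Cons.prems(1)
        by (intro prod_list_commute) (auto simp: set_block_pairs intro!: E_pair_commute ij)
      ultimately show ?thesis
        using E_pair_idem[OF ij] p by (metis (mono_tags, lifting) case_prod_conv list.simps(9) mult.assoc prod_list.Cons)
    qed
  qed simp
  moreover have "(i, j) \<in> set (block_pairs n B) \<or> (j, i) \<in> set (block_pairs n B)"
    using ij B same_block_sym[of B] by (auto simp: set_block_pairs)
  ultimately show ?thesis unfolding E_part_def by blast
qed

text \<open>With \<open>y\<close> and \<open>z\<close> for the two sides, each absorbs all factors
  of the other, so \<open>y * z = y\<close> and \<open>z * y = z\<close>; since they commute they
  are equal.\<close>

lemma E_part_E_pair_merge:
  assumes B: "partition_on {1..n} B" and jk: "j \<in> {1..n}" "k \<in> {1..n}" "j \<noteq> k"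
  shows "E_part B * E_pair j k = E_part (merge_blocks j k B)"
proof -
  let ?B' = "merge_blocks j k B"
  let ?y = "E_part B * E_pair j k" and ?z = "E_part ?B'"
  \<comment> \<open>The triangle identity makes this relation transitive. It contains the pairs of
    \<open>B\<close> and the pair \<open>j\<close>, \<open>k\<close>, hence all pairs inside blocks
    of the join.\<close>
  define absorbs where "absorbs a b \<longleftrightarrow> a = b \<or> ?y * E_pair a b = ?y" for a b
  have sym: "absorbs a b \<Longrightarrow> absorbs b a" for a b
    unfolding absorbs_def using E_pair_sym by metis
  have trans: "absorbs a c"
    if "absorbs a b" "absorbs b c" "a \<in> {1..n}" "b \<in> {1..n}" "c \<in> {1..n}" for a b c
  proof (cases "a = b \<or> b = c \<or> a = c")
    case False
    then have "?y * E_pair a b = ?y" "?y * E_pair b c = ?y"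
      using that by (auto simp: absorbs_def)
    moreover have "E_pair a b * E_pair b c * E_pair a c = E_pair a b * E_pair b c"
      using False that by (intro E_pair_triangle) auto
    ultimately have "?y * E_pair a c = ?y" by (metis mult.assoc)
    then show ?thesis by (simp add: absorbs_def)
  qed (use that in \<open>auto simp: absorbs_def\<close>)
  have B_abs: "absorbs a b" if "same_block B a b" for a b
  proof (cases "a = b")
    case False
    have ab: "a \<in> {1..n}" "b \<in> {1..n}" using same_block_in[OF B that] by auto
    have "?y * E_pair a b = E_part B * E_pair a b * E_pair j k"
      using E_pair_commute[OF jk ab False] by (simp add: mult.assoc)
    then show ?thesis using E_part_absorb[OF ab False that] by (simp add: absorbs_def)
  qed (simp add: absorbs_def)
  have jk_abs: "absorbs j k"
    using E_pair_idem[OF jk] by (simp add: absorbs_def mult.assoc)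
  have "absorbs a b" if "same_block ?B' a b" for a b
  proof -
    have ab: "a \<in> {1..n}" "b \<in> {1..n}"
      using same_block_in[OF partition_on_merge_blocks[OF B jk(1)] that] by auto
    have "absorbs x j" if "same_block B x j \<or> same_block B x k" "x \<in> {1..n}" for x
      using that B_abs trans[of x k j] sym jk_abs jk by blast
    moreover have "same_block B a b \<or> (same_block B a j \<or> same_block B a k) \<and>
        (same_block B b j \<or> same_block B b k)"
      using that unfolding same_block_merge_blocks[OF B jk(1,2)] .
    ultimately show ?thesis
      using B_abs trans[OF _ _ ab(1) jk(1) ab(2)] sym[of b j] ab by blast
  qed
  then have "?y * ?z = ?y"
    by (intro mult_E_part_absorb) (auto simp: absorbs_def)
  moreover have "?z * ?y = ?z"
  proof -
    have "?z * E_part B = ?z"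
      by (rule mult_E_part_absorb) (auto intro!: E_part_absorb simp: same_block_merge_blocks[OF B jk(1,2)])
    moreover have "?z * E_pair j k = ?z"
      using same_block_merge_blocks_self[OF B jk(1,2)] jk by (intro E_part_absorb) auto
    ultimately show ?thesis by (simp flip: mult.assoc)
  qed
  moreover have "?y * ?z = ?z * ?y"
  proof -
    have "E_part ?B' * E_part B = E_part B * E_part ?B'"
      unfolding E_part_def[of ?B']
      by (rule prod_list_commute) (auto simp: set_block_pairs intro!: E_part_E_pair_commute[symmetric])
    then show ?thesis
      using E_part_E_pair_commute[OF jk, of ?B'] by (metis mult.assoc)
  qed
  ultimately show ?thesis by simp
qed

definition idem_part :: "nat set set \<Rightarrow> 'a"
  where "idem_part A = (\<Sum>B\<in>{B\<in>set_partitions n. refines {1..n} A B}.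
    of_int (sp_mobius n A B) * E_part B)"

lemma set_partitions_refines: "{B\<in>set_partitions n. refines {1..n} A B} = {B. refines {1..n} A B}"
  by (auto simp: set_partitions_def refines_def)

text \<open>If \<open>A\<close> joins \<open>i\<close> and \<open>j\<close>, so does every coarser
  \<open>B\<close>, and each summand absorbs the factor. Otherwise the factor merges the two blocks
  in every summand, and the merged Moebius sum vanishes.\<close>

lemma idem_part_E_pair:
  assumes A: "partition_on {1..n} A" and ij: "i \<in> {1..n}" "j \<in> {1..n}" "i \<noteq> j"
  shows "idem_part A * E_pair i j = (if same_block A i j then idem_part A else 0)"
proof (cases "same_block A i j")
  case True
  have "E_part B * E_pair i j = E_part B" if "refines {1..n} A B" for B
  proof (rule E_part_absorb[OF ij])
    show "same_block B i j"
      using that True unfolding refines_def same_block_def by blast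
  qed
  then show ?thesis
    using True unfolding idem_part_def set_partitions_refines sum_distrib_right
    by (simp add: mult.assoc)
next
  case False
  have "idem_part A * E_pair i j =
      (\<Sum>B | refines {1..n} A B. of_int (sp_mobius n A B) * E_part (merge_blocks i j B))"
    unfolding idem_part_def set_partitions_refines sum_distrib_right
    by (intro sum.cong refl) (auto simp: mult.assoc E_part_E_pair_merge[OF _ ij] refines_def)
  then show ?thesis using sp_mobius_merge_sum[OF A ij(1,2) False] False by simp
qed

end

section \<open>Products along reduced words and the generator of the permutation module\<close>

context bt_relations
begin

definition g_perm :: "(nat \<Rightarrow> nat) \<Rightarrow> 'a"
  where "g_perm w = prod_list (map g (SOME us. expression_of n w us \<and> length us = perm_length n w))"

text \<open>Matsumoto's theorem removes the dependence on the choice made by \<open>SOME\<close>, so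
  that any convenient reduced word may be used.\<close>

lemma g_perm_reduced_word:
  assumes "reduced_word n us"
  shows "g_perm (word_perm us) = prod_list (map g us)"
proof -
  have w: "word_perm us permutes {1..n}"
    using assms by (intro word_perm_permutes) (simp add: reduced_word_def)
  let ?js = "SOME js. expression_of n (word_perm us) js \<and> length js = perm_length n (word_perm us)"
  have js: "reduced_word n ?js \<and> word_perm ?js = word_perm us"
    unfolding expression_of_perm_length_iff[OF w]
    by (rule someI[where x = us]) (simp add: assms)
  have "prod_list (map g ?js) = prod_list (map g us)"
  proof (rule reduced_words_prod_eq[where n = n])
    show "g i * g j = g j * g i" if "i \<in> {1..<n}" "j \<in> {1..<n}" "Suc i < j" for i j
      using that by (intro g_far) (auto simp: index_dist_def)
    show "g i * g (Suc i) * g i = g (Suc i) * g i * g (Suc i)"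
      if "i \<in> {1..<n}" "Suc i \<in> {1..<n}" for i
      using that by (intro braid) (auto simp: index_dist_def)
  qed (use js assms in auto)
  then show ?thesis by (simp add: g_perm_def)
qed

lemma g_perm_id [simp]: "g_perm id = 1"
  using g_perm_reduced_word[of "[]"] by (simp add: reduced_word_def)

lemma g_perm_adj_comp:
  assumes w: "w permutes {1..n}" and i: "i \<in> {1..<n}" and asc: "pinv w i < pinv w (Suc i)"
  shows "g_perm (adj i \<circ> w) = g_perm w * g i"
proof -
  obtain us where us: "reduced_word n us" "word_perm us = w"
    using reduced_word_exists[OF w] by auto
  then have "reduced_word n (us @ [i])"
    using i asc by (intro reduced_word_snocI) auto
  from g_perm_reduced_word[OF this, unfolded word_perm_snoc] g_perm_reduced_word[OF us(1)] us(2)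
  show ?thesis by simp
qed

lemma g_perm_comp_adj:
  assumes w: "w permutes {1..n}" and k: "k \<in> {1..<n}" and asc: "w k < w (Suc k)"
  shows "g_perm (w \<circ> adj k) = g k * g_perm w"
proof -
  obtain us where us: "reduced_word n us" "word_perm us = w"
    using reduced_word_exists[OF w] by auto
  then have "reduced_word n (k # us)"
    using k asc by (intro reduced_word_ConsI) auto
  from g_perm_reduced_word[OF this, unfolded word_perm_Cons] g_perm_reduced_word[OF us(1)] us(2)
  show ?thesis by simp
qed

lemma g_perm_E_pair:
  assumes w: "w permutes {1..n}" and "i \<in> {1..n}" "j \<in> {1..n}" "i \<noteq> j"
  shows "g_perm w * E_pair i j = E_pair (pinv w i) (pinv w j) * g_perm w"
proof -
  obtain us where us: "reduced_word n us" "word_perm us = w"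
    using reduced_word_exists[OF w] by auto
  have "prod_list (map g us) * E_pair i j =
      E_pair (pinv (word_perm us) i) (pinv (word_perm us) j) * prod_list (map g us)"
    if "set us \<subseteq> {1..<n}" for us
    using that assms(2-4)
  proof (induction us arbitrary: i j rule: rev_induct)
    case (snoc k us)
    have k: "k \<in> {1..<n}" and s: "set us \<subseteq> {1..<n}" using snoc.prems by auto
    have bij: "bij (word_perm us)" by (rule permutes_bij[OF word_perm_permutes[OF s]])
    have ne: "adj k i \<noteq> adj k j" using snoc.prems(4) by (metis transpose_involutory)
    have rng: "adj k i \<in> {1..n}" "adj k j \<in> {1..n}"
      using permutes_in_image[OF adj_permutes[OF k]] snoc.prems by auto
    have "prod_list (map g (us @ [k])) * E_pair i j = prod_list (map g us) * (g k * E_pair i j)"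
      by (simp add: mult.assoc)
    also have "\<dots> = prod_list (map g us) * E_pair (adj k i) (adj k j) * g k"
      using g_E_pair[OF k snoc.prems(2-4)] by (simp add: mult.assoc)
    also have "\<dots> = E_pair (pinv (word_perm us) (adj k i)) (pinv (word_perm us) (adj k j)) *
        prod_list (map g (us @ [k]))"
      using snoc.IH[OF s rng ne] by (simp add: mult.assoc)
    finally show ?case
      unfolding word_perm_snoc inv_adj_comp(1)[OF bij] by simp
  qed simp
  then show ?thesis
    using us g_perm_reduced_word[OF us(1)] by (simp add: reduced_word_def)
qed

definition idem_type :: "nat list \<Rightarrow> 'a"
  where "idem_type \<alpha> = (\<Sum>A\<in>{A\<in>set_partitions n. sp_type A = \<alpha>}. idem_part A)"

text \<open>The stabilizer of \<open>c\<close> is a row stabilizer when \<open>c j\<close> is the pair of the row and the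
  component of \<open>j\<close> in the initial tableau.\<close>

definition stab :: "(nat \<Rightarrow> 'b) \<Rightarrow> (nat \<Rightarrow> nat) set"
  where "stab c = {w. w permutes {1..n} \<and> (\<forall>j\<in>{1..n}. c (w j) = c j)}"

definition stab_sum :: "(nat \<Rightarrow> 'b) \<Rightarrow> 'a"
  where "stab_sum c = (\<Sum>w\<in>stab c. q ^ perm_length n w * g_perm w)"

text \<open>The generator \<open>X\<close>, the product of the idempotent of a multicomposition and
  its row sum: \<open>snd \<circ> c\<close> gives the component of an index, \<open>c\<close> its
  row and component.\<close>

definition stab_gen :: "(nat \<Rightarrow> nat \<times> nat) \<Rightarrow> 'a"
  where "stab_gen c = idem_part (fibre_partition n (snd \<circ> c)) * stab_sum c"

lemma finite_stab [simp]: "finite (stab c)"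
  by (rule finite_subset[OF _ finite_permutations[of "{1..n}"]]) (auto simp: stab_def)

lemma stab_pinv:
  assumes "w \<in> stab c"
  shows "c (pinv w j) = c j"
proof (cases "j \<in> {1..n}")
  case True
  have w: "w permutes {1..n}" using assms by (simp add: stab_def)
  then have "pinv w j \<in> {1..n}" using True permutes_in_image[OF permutes_inv[OF w]] by auto
  then have "c (w (pinv w j)) = c (pinv w j)" using assms by (simp add: stab_def)
  then show ?thesis using permutes_inverses[OF w] by simp
next
  case False
  have w: "w permutes {1..n}" using assms by (simp add: stab_def)
  show ?thesis using permutes_not_in[OF permutes_inv[OF w] False] by simp
qed

lemma q_power_central: "q ^ k * x = x * q ^ k"
proof (induction k)
  case (Suc k)
  have "q ^ Suc k * x = q * (q ^ k * x)" by (simp add: mult.assoc)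
  also have "\<dots> = q * (x * q ^ k)" using Suc by simp
  also have "\<dots> = x * q ^ Suc k" using q_central[of x] by (metis mult.assoc power_Suc)
  finally show ?case .
qed simp

lemma idem_part_g_perm_E_pair:
  fixes c :: "nat \<Rightarrow> nat \<times> nat"
  assumes w: "w permutes {1..n}" and ij: "i \<in> {1..n}" "j \<in> {1..n}" "i \<noteq> j"
  defines "A \<equiv> fibre_partition n (snd \<circ> c)"
  shows "idem_part A * g_perm w * E_pair i j =
    (if snd (c (pinv w i)) = snd (c (pinv w j)) then idem_part A * g_perm w else 0)"
proof -
  have p: "pinv w i \<in> {1..n}" "pinv w j \<in> {1..n}" "pinv w i \<noteq> pinv w j"
    using ij permutes_in_image[OF permutes_inv[OF w]] permutes_inverses(1)[OF w] by auto metis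
  have "idem_part A * g_perm w * E_pair i j = idem_part A * E_pair (pinv w i) (pinv w j) * g_perm w"
    using g_perm_E_pair[OF w ij] by (simp add: mult.assoc)
  then show ?thesis
    using idem_part_E_pair[OF partition_on_fibre_partition[of n "snd \<circ> c"] p] p
    by (simp add: A_def same_block_fibre_partition)
qed

text \<open>Moving \<open>E\<^sub>i\<^sub>j\<close> to the left through \<open>g\<^sub>w\<close>
  replaces \<open>i\<close> and \<open>j\<close> by their preimages under \<open>w\<close>. For
  \<open>w\<close> in the stabilizer these have the same components as \<open>i\<close> and
  \<open>j\<close>, so all summands behave alike.\<close>

lemma stab_gen_E_pair:
  assumes ij: "i \<in> {1..n}" "j \<in> {1..n}" "i \<noteq> j"
  shows "stab_gen c * E_pair i j = (if snd (c i) = snd (c j) then stab_gen c else 0)"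
proof -
  let ?A = "fibre_partition n (snd \<circ> c)"
  have summand: "idem_part ?A * (q ^ perm_length n w * g_perm w) * E_pair i j =
      (if snd (c i) = snd (c j) then idem_part ?A * (q ^ perm_length n w * g_perm w) else 0)"
    if w: "w \<in> stab c" for w
  proof -
    have wp: "w permutes {1..n}" using w by (simp add: stab_def)
    have "idem_part ?A * (q ^ perm_length n w * g_perm w) * E_pair i j =
        q ^ perm_length n w * (idem_part ?A * g_perm w * E_pair i j)"
      by (metis mult.assoc q_power_central)
    also have "\<dots> = (if snd (c i) = snd (c j) then q ^ perm_length n w * (idem_part ?A * g_perm w) else 0)"
      using idem_part_g_perm_E_pair[OF wp ij, of c] stab_pinv[OF w] by simp
    finally show ?thesis by (metis mult.assoc q_power_central)
  qed
  have "stab_gen c * E_pair i j =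
      (\<Sum>w\<in>stab c. idem_part ?A * (q ^ perm_length n w * g_perm w) * E_pair i j)"
    unfolding stab_gen_def stab_sum_def sum_distrib_left sum_distrib_right ..
  also have "\<dots> = (\<Sum>w\<in>stab c.
      (if snd (c i) = snd (c j) then idem_part ?A * (q ^ perm_length n w * g_perm w) else 0))"
    by (intro sum.cong refl summand)
  also have "\<dots> = (if snd (c i) = snd (c j) then stab_gen c else 0)"
    unfolding stab_gen_def stab_sum_def sum_distrib_left by simp
  finally show ?thesis .
qed

text \<open>The stabilizer is a union of pairs \<open>w\<close>, \<open>adj k \<circ> w\<close>,
  each contributing a multiple of \<open>g\<^sub>w (1 + q g\<^sub>k)\<close>. As in a Hecke algebra,
  \<open>(1 + q g\<^sub>k) g\<^sub>k = q (1 + q g\<^sub>k)\<close> once \<open>e\<^sub>k\<close>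
  acts as 1.\<close>

lemma stab_gen_g:
  assumes k: "k \<in> {1..<n}" and ck: "c k = c (Suc k)"
  shows "stab_gen c * g k = q * stab_gen c"
proof -
  define A where "A = fibre_partition n (snd \<circ> c)"
  \<comment> \<open>One representative from each pair, the shorter one.\<close>
  define S where "S = {w\<in>stab c. pinv w k < pinv w (Suc k)}"
  have S: "w permutes {1..n}" "pinv w k < pinv w (Suc k)" if "w \<in> S" for w
    using that by (auto simp: S_def stab_def)
  have adj_stab: "adj k \<circ> w \<in> stab c" if "w \<in> stab c" for w
  proof -
    have "w permutes {1..n}" using that by (simp add: stab_def)
    then have "adj k \<circ> w permutes {1..n}" by (intro permutes_compose adj_permutes k)
    moreover have "c (adj k x) = c x" for x using ck by (simp add: Transposition.transpose_def)
    ultimately show ?thesis using that by (simp add: stab_def)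
  qed
  have desc: "w \<in> (\<lambda>w. adj k \<circ> w) ` S" if w: "w \<in> stab c" "w \<notin> S" for w
  proof (rule image_eqI)
    have wp: "w permutes {1..n}" using w by (simp add: stab_def)
    show "w = adj k \<circ> (adj k \<circ> w)" by simp
    have "pinv w (Suc k) < pinv w k" using asc_or_desc[OF wp, of k] w by (auto simp: S_def)
    then show "adj k \<circ> w \<in> S"
      using adj_stab[OF w(1)] by (simp add: S_def inv_adj_comp_apply[OF wp])
  qed
  have split: "stab c = S \<union> (\<lambda>w. adj k \<circ> w) ` S"
  proof
    show "stab c \<subseteq> S \<union> (\<lambda>w. adj k \<circ> w) ` S" using desc by blast
    show "S \<union> (\<lambda>w. adj k \<circ> w) ` S \<subseteq> stab c" using adj_stab by (auto simp: S_def)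
  qed
  have disj: "S \<inter> (\<lambda>w. adj k \<circ> w) ` S = {}"
  proof -
    have "adj k \<circ> w \<notin> S" if "w \<in> S" for w
      using S[OF that] by (simp add: S_def inv_adj_comp_apply[OF S(1)[OF that]])
    then show ?thesis by blast
  qed
  have finS: "finite S" using finite_stab[of c] by (simp add: S_def)
  have inj: "inj_on (\<lambda>w. adj k \<circ> w) S"
    by (rule inj_onI) (metis adj_comp_adj(1))
  let ?h = "\<lambda>w. q ^ inversions n w * (g_perm w + q * g_perm w * g k)"
  have sum: "stab_sum c = (\<Sum>w\<in>S. ?h w)"
  proof -
    have "stab_sum c = (\<Sum>w\<in>S. q ^ perm_length n w * g_perm w) +
        (\<Sum>w\<in>S. q ^ perm_length n (adj k \<circ> w) * g_perm (adj k \<circ> w))"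
      unfolding stab_sum_def split
      by (subst sum.union_disjoint[OF finS finite_imageI[OF finS] disj])
        (simp add: sum.reindex[OF inj])
    also have "\<dots> = (\<Sum>w\<in>S. ?h w)"
      unfolding sum.distrib[symmetric]
    proof (rule sum.cong[OF refl])
      fix w assume w: "w \<in> S"
      have p: "adj k \<circ> w permutes {1..n}" by (intro permutes_compose adj_permutes k S(1)[OF w])
      show "q ^ perm_length n w * g_perm w + q ^ perm_length n (adj k \<circ> w) * g_perm (adj k \<circ> w) = ?h w"
        unfolding perm_length_eq_inversions[OF S(1)[OF w]] perm_length_eq_inversions[OF p]
          inversions_adj_comp[OF S(1)[OF w] k S(2)[OF w]] g_perm_adj_comp[OF S(1)[OF w] k S(2)[OF w]]
        by (simp add: distrib_left power_Suc2 mult.assoc del: power_Suc)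
    qed
    finally show ?thesis .
  qed
  have step: "idem_part A * ?h w * g k = q * (idem_part A * ?h w)" if w: "w \<in> S" for w
  proof -
    let ?y = "idem_part A * g_perm w"
    have wc: "w \<in> stab c" using w by (simp add: S_def)
    \<comment> \<open>Here the idempotent on the left enters: \<open>w\<close> preserves
      \<open>c\<close>, and \<open>k\<close>, \<open>k + 1\<close> lie in one component, so
      \<open>e k\<close> acts as 1 and the quadratic relation becomes the one of a Hecke
      algebra.\<close>
    have ye: "?y * e k = ?y"
    proof -
      have "E_pair k (Suc k) = e k" by (simp add: E_pair_def)
      moreover have "snd (c (pinv w k)) = snd (c (pinv w (Suc k)))"
        using ck by (simp add: stab_pinv[OF wc])
      ultimately show ?thesis
        using idem_part_g_perm_E_pair[OF S(1)[OF w], of k "Suc k" c] k by (simp add: A_def)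
    qed
    have ygg: "?y * g k * g k = ?y + (q - q') * (?y * g k)"
    proof -
      have "?y * g k * g k = ?y * (1 + (q - q') * e k * g k)"
        unfolding mult.assoc[of ?y] g_quad[OF k] ..
      also have "\<dots> = ?y + ?y * (q - q') * e k * g k" by (simp add: distrib_left mult.assoc)
      also have "\<dots> = ?y + (q - q') * (?y * e k) * g k"
        unfolding diff_central[of ?y, symmetric] by (simp add: mult.assoc)
      finally show ?thesis unfolding ye by (simp add: mult.assoc)
    qed
    have qq: "q * (q - q') = q * q - 1" by (simp add: right_diff_distrib q_inverse)
    have "(?y + q * (?y * g k)) * g k = ?y * g k + q * (?y * g k * g k)"
      by (simp add: distrib_right mult.assoc)
    also have "\<dots> = q * ?y + (1 + q * (q - q')) * (?y * g k)"
      unfolding ygg by (simp only: distrib_left distrib_right mult_1_left mult.assoc ac_simps)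
    also have "\<dots> = q * (?y + q * (?y * g k))"
      unfolding qq by (simp add: distrib_left mult.assoc)
    finally have main: "(?y + q * (?y * g k)) * g k = q * (?y + q * (?y * g k))" .
    have h: "idem_part A * ?h w = q ^ inversions n w * (?y + q * (?y * g k))"
    proof -
      have "idem_part A * ?h w = q ^ inversions n w * (idem_part A * (g_perm w + q * g_perm w * g k))"
        by (metis mult.assoc q_power_central)
      also have "idem_part A * (g_perm w + q * g_perm w * g k) = ?y + (idem_part A * q) * g_perm w * g k"
        by (simp add: distrib_left mult.assoc)
      finally show ?thesis unfolding q_central[of "idem_part A", symmetric] by (simp add: mult.assoc)
    qed
    have "idem_part A * ?h w * g k = q ^ inversions n w * (q * (?y + q * (?y * g k)))"
      unfolding h main[symmetric] by (simp add: mult.assoc)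
    also have "\<dots> = q * (q ^ inversions n w * (?y + q * (?y * g k)))"
      by (metis mult.assoc q_central)
    finally show ?thesis unfolding h .
  qed
  show ?thesis
    unfolding stab_gen_def A_def[symmetric] sum sum_distrib_left sum_distrib_right
    by (rule sum.cong[OF refl]) (use step in \<open>simp only: mult.assoc\<close>)
qed

text \<open>For the permutation of a row standard tableau this is the basis element
  \<open>x\<^sub>t\<close>; the first multiplication formulas below hold for every
  permutation.\<close>

definition stab_basis :: "(nat \<Rightarrow> nat \<times> nat) \<Rightarrow> (nat \<Rightarrow> nat) \<Rightarrow> 'a"
  where "stab_basis c w = stab_gen c * g_perm w"

lemma stab_basis_E_pair:
  assumes w: "w permutes {1..n}" and ij: "i \<in> {1..n}" "j \<in> {1..n}" "i \<noteq> j"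
  shows "stab_basis c w * E_pair i j =
    (if snd (c (pinv w i)) = snd (c (pinv w j)) then stab_basis c w else 0)"
proof -
  have p: "pinv w i \<in> {1..n}" "pinv w j \<in> {1..n}" "pinv w i \<noteq> pinv w j"
    using ij permutes_in_image[OF permutes_inv[OF w]] permutes_inverses(1)[OF w] by auto metis
  have "stab_basis c w * E_pair i j = stab_gen c * E_pair (pinv w i) (pinv w j) * g_perm w"
    using g_perm_E_pair[OF w ij] by (simp add: stab_basis_def mult.assoc)
  then show ?thesis by (simp add: stab_gen_E_pair[OF p] stab_basis_def)
qed

lemma stab_basis_e:
  assumes "w permutes {1..n}" "i \<in> {1..<n}"
  shows "stab_basis c w * e i =
    (if snd (c (pinv w i)) = snd (c (pinv w (Suc i))) then stab_basis c w else 0)"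
  using stab_basis_E_pair[OF assms(1), of i "Suc i" c] assms(2) by (simp add: E_pair_def)

lemma stab_basis_g_asc:
  assumes "w permutes {1..n}" "i \<in> {1..<n}" "pinv w i < pinv w (Suc i)"
  shows "stab_basis c w * g i = stab_basis c (adj i \<circ> w)"
  using g_perm_adj_comp[OF assms] by (simp add: stab_basis_def mult.assoc)

text \<open>At a descent, \<open>w\<close> arises from the shorter permutation
  \<open>adj i \<circ> w\<close> by appending \<open>i\<close>, so \<open>g i\<close> meets itself
  and the quadratic relation applies.\<close>

lemma stab_basis_g_desc:
  assumes w: "w permutes {1..n}" and i: "i \<in> {1..<n}" and desc: "pinv w (Suc i) < pinv w i"
  shows "stab_basis c w * g i = stab_basis c (adj i \<circ> w) +
    (if snd (c (pinv w i)) = snd (c (pinv w (Suc i))) then (q - q') * stab_basis c w else 0)"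
proof -
  let ?v = "adj i \<circ> w"
  have v: "?v permutes {1..n}" by (intro permutes_compose adj_permutes i w)
  have pv: "pinv ?v i = pinv w (Suc i)" "pinv ?v (Suc i) = pinv w i"
    by (rule inv_adj_comp_apply[OF w])+
  have vw: "stab_basis c ?v * g i = stab_basis c w"
    using stab_basis_g_asc[OF v i, of c] desc by (simp add: pv)
  have "stab_basis c w * g i = stab_basis c ?v * (g i * g i)"
    unfolding vw[symmetric] by (simp add: mult.assoc)
  also have "\<dots> = stab_basis c ?v + stab_basis c ?v * (q - q') * e i * g i"
    unfolding g_quad[OF i] by (simp add: distrib_left mult.assoc)
  also have "stab_basis c ?v * (q - q') * e i * g i = (q - q') * (stab_basis c ?v * e i) * g i"
    unfolding diff_central[symmetric] by (simp add: mult.assoc)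
  also have "\<dots> = (if snd (c (pinv w i)) = snd (c (pinv w (Suc i)))
      then (q - q') * stab_basis c w else 0)"
    unfolding stab_basis_e[OF v i] pv using vw by (auto simp: mult.assoc)
  finally show ?thesis .
qed

text \<open>Here \<open>adj i \<circ> w = w \<circ> adj k\<close>, and both sides are longer than
  \<open>w\<close>. Hence \<open>g i\<close> can be moved through \<open>g_perm w\<close> to become
  \<open>g k\<close>, which the generator turns into \<open>q\<close>.\<close>

lemma stab_basis_g_same:
  assumes w: "w permutes {1..n}" and k: "k \<in> {1..<n}" and i: "i \<in> {1..<n}"
    and wk: "w k = i" "w (Suc k) = Suc i" and ck: "c k = c (Suc k)"
  shows "stab_basis c w * g i = q * stab_basis c w"
proof -
  have pk: "pinv w i = k" "pinv w (Suc i) = Suc k"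
    using wk permutes_inverses(2)[OF w] by metis+
  have "adj i \<circ> w = w \<circ> adj k"
  proof
    fix x
    have "w x = i \<longleftrightarrow> x = k" "w x = Suc i \<longleftrightarrow> x = Suc k"
      using pk wk permutes_inverses(2)[OF w] by metis+
    then show "(adj i \<circ> w) x = (w \<circ> adj k) x"
      using wk by (simp add: Transposition.transpose_def)
  qed
  then have "g_perm w * g i = g k * g_perm w"
    using g_perm_adj_comp[OF w i] g_perm_comp_adj[OF w k] pk wk by simp
  then have "stab_basis c w * g i = stab_gen c * g k * g_perm w"
    by (simp add: stab_basis_def mult.assoc)
  then show ?thesis
    unfolding stab_gen_g[OF k ck] by (simp add: stab_basis_def mult.assoc)
qed

text \<open>If \<open>s\<close> is constant on the blocks of \<open>B\<close>, every factor fixes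
  \<open>y\<close>. If not, some pair inside a block kills \<open>y\<close>, and the product
  contains that factor.\<close>

lemma mult_E_part_of_pairs:
  assumes D: "\<And>i j. i \<in> {1..n} \<Longrightarrow> j \<in> {1..n} \<Longrightarrow> i \<noteq> j \<Longrightarrow>
      y * E_pair i j = (if s i = s j then y else 0)"
    and B: "partition_on {1..n} B"
  shows "y * E_part B = (if refines {1..n} B (fibre_partition n s) then y else 0)"
proof (cases "refines {1..n} B (fibre_partition n s)")
  case True
  then show ?thesis
    using mult_E_part_absorb[of B y] D unfolding refines_fibre_partition[OF B] by simp
next
  case False
  then obtain i j where ij: "same_block B i j" "s i \<noteq> s j"
    unfolding refines_fibre_partition[OF B] by auto
  have r: "i \<in> {1..n}" "j \<in> {1..n}" "i \<noteq> j"
    using ij same_block_in[OF B] by auto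
  have "y * E_part B = y * E_pair i j * E_part B"
    using E_part_absorb[OF r ij(1)] E_part_E_pair_commute[OF r, of B] by (simp add: mult.assoc)
  then show ?thesis using D[OF r] ij(2) False by simp
qed

end

text \<open>What remains is the Moebius sum over the interval from \<open>A\<close> to
  \<open>D\<close>, which is empty unless \<open>A\<close> refines \<open>D\<close>.\<close>

lemma sum_sp_mobius_fibre:
  assumes D: "partition_on {1..n} D"
  shows "(\<Sum>B\<in>{B\<in>set_partitions n. refines {1..n} A B}.
    if refines {1..n} B D then sp_mobius n A B else 0) = (if A = D then 1 else 0)"
proof -
  have fin: "finite {B\<in>set_partitions n. refines {1..n} A B}"
    using finitely_many_partition_on[of "{1..n}"] by (simp add: set_partitions_def)
  have "(\<Sum>B\<in>{B\<in>set_partitions n. refines {1..n} A B}. if refines {1..n} B D then sp_mobius n A B else 0) =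
      (\<Sum>B | refines {1..n} A B \<and> refines {1..n} B D. sp_mobius n A B)"
    by (rule sum.mono_neutral_cong_right[OF fin]) (auto simp: set_partitions_def refines_def)
  also have "\<dots> = (if A = D then 1 else 0)"
  proof (cases "refines {1..n} A D")
    case False
    then have "{B. refines {1..n} A B \<and> refines {1..n} B D} = {}" by (auto intro: refines_trans)
    then show ?thesis using False D by (auto simp: refines_refl simp del: Collect_empty_eq)
  qed (rule sp_mobius_sum)
  finally show ?thesis .
qed

context bt_relations
begin

text \<open>By Moebius inversion exactly one of the idempotents \<open>idem_part A\<close> fixes
  \<open>y\<close>, the one whose partition is the kernel of \<open>s\<close>, and all others kill
  it.\<close>

lemma mult_idem_type_of_pairs:
  assumes pairs: "\<And>i j. i \<in> {1..n} \<Longrightarrow> j \<in> {1..n} \<Longrightarrow> i \<noteq> j \<Longrightarrow>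
      y * E_pair i j = (if s i = s j then y else 0)"
  shows "y * idem_type \<alpha> = (if sp_type (fibre_partition n s) = \<alpha> then y else 0)"
proof -
  let ?D = "fibre_partition n s"
  have D: "partition_on {1..n} ?D" by (rule partition_on_fibre_partition)
  have idem: "y * idem_part A = (if A = ?D then y else 0)" for A
  proof -
    have "y * idem_part A = (\<Sum>B\<in>{B\<in>set_partitions n. refines {1..n} A B}.
        of_int (sp_mobius n A B) * (y * E_part B))"
      unfolding idem_part_def sum_distrib_left
      by (intro sum.cong refl) (metis mult.assoc mult_of_int_commute)
    also have "\<dots> = (\<Sum>B\<in>{B\<in>set_partitions n. refines {1..n} A B}.
        of_int (if refines {1..n} B ?D then sp_mobius n A B else 0) * y)"
    proof (rule sum.cong[OF refl])
      fix B assume "B \<in> {B\<in>set_partitions n. refines {1..n} A B}"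
      then have "partition_on {1..n} B" by (simp add: set_partitions_def)
      then show "of_int (sp_mobius n A B) * (y * E_part B) =
          of_int (if refines {1..n} B ?D then sp_mobius n A B else 0) * y"
        using mult_E_part_of_pairs[of y s B] pairs by simp
    qed
    also have "\<dots> = of_int (if A = ?D then 1 else 0) * y"
      unfolding sum_distrib_right[symmetric] of_int_sum[symmetric] sum_sp_mobius_fibre[OF D] ..
    finally show ?thesis by simp
  qed
  have fin: "finite {A \<in> set_partitions n. sp_type A = \<alpha>}"
    using finitely_many_partition_on[of "{1..n}"] by (simp add: set_partitions_def)
  have "y * idem_type \<alpha> = (\<Sum>A\<in>{A\<in>set_partitions n. sp_type A = \<alpha>}. if ?D = A then y else 0)"
    unfolding idem_type_def sum_distrib_left by (intro sum.cong refl) (auto simp: idem)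
  also have "\<dots> = (if sp_type ?D = \<alpha> then y else 0)"
    unfolding sum.delta'[OF fin] using D by (simp add: set_partitions_def)
  finally show ?thesis .
qed

lemma stab_basis_idem_type:
  assumes "w permutes {1..n}"
  shows "stab_basis c w * idem_type \<alpha> =
    (if sp_type (fibre_partition n (snd \<circ> c \<circ> pinv w)) = \<alpha> then stab_basis c w else 0)"
  by (rule mult_idem_type_of_pairs) (simp add: stab_basis_E_pair[OF assms])

end

section \<open>A type class ring covering all rings on a type\<close>

text \<open>The product of all rings with elements in a given type is an instance of the class of unital
  rings, and every ring on the type is a projection of it. In this way the identities derived for
  rings given by a type class hold in rings with explicit carriers.\<close>

typedef 'a ring_family = "Pi\<^sub>E {R :: ('a set) ring. ring R} carrier"
  morphisms component Abs_ring_family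
proof
  show "(\<lambda>R\<in>{R. ring R}. \<zero>\<^bsub>R\<^esub>) \<in> Pi\<^sub>E {R :: ('a set) ring. ring R} carrier"
    using ring.ring_simprules(2) by auto
qed

lemma component_closed [simp]: "ring R \<Longrightarrow> component x R \<in> carrier R"
  using component[of x] by auto

lemma ring_family_eqI:
  assumes "\<And>R. ring R \<Longrightarrow> component x R = component y R"
  shows "x = y"
proof -
  have "component x = component y"
    by (rule PiE_ext[OF component component]) (simp add: assms)
  then show ?thesis by (simp add: component_inject)
qed

definition family :: "(('a set) ring \<Rightarrow> 'a set) \<Rightarrow> 'a ring_family"
  where "family f = Abs_ring_family (\<lambda>R\<in>{R. ring R}. f R)"

lemma component_family:
  assumes "\<And>R. ring R \<Longrightarrow> f R \<in> carrier R" "ring R"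
  shows "component (family f) R = f R"
  unfolding family_def using assms by (subst Abs_ring_family_inverse) auto

text \<open>Class \<open>ring_1\<close> demands that 0 and 1 differ, which needs one nontrivial ring
  among the factors. On a type of sets there always is one: symmetric difference with
  intersection.\<close>

definition set_ring :: "('a set) ring"
  where "set_ring = \<lparr>carrier = UNIV, monoid.mult = (\<inter>), one = UNIV, zero = {}, add = (\<lambda>A B. (A - B) \<union> (B - A))\<rparr>"

lemma ring_set_ring: "ring set_ring"
proof (rule ringI)
  show "abelian_group (set_ring :: ('a set) ring)"
    by (rule abelian_groupI) (auto simp: set_ring_def)
  show "monoid (set_ring :: ('a set) ring)"
    by (rule monoidI) (auto simp: set_ring_def)
qed (auto simp: set_ring_def)

instantiation ring_family :: (type) ring_1
begin

definition "0 = family (\<lambda>R. \<zero>\<^bsub>R\<^esub>)"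
definition "1 = family (\<lambda>R. \<one>\<^bsub>R\<^esub>)"
definition "x + y = family (\<lambda>R. component x R \<oplus>\<^bsub>R\<^esub> component y R)"
definition "x * y = family (\<lambda>R. component x R \<otimes>\<^bsub>R\<^esub> component y R)"
definition "- x = family (\<lambda>R. \<ominus>\<^bsub>R\<^esub> component x R)"
definition "x - y = family (\<lambda>R. component x R \<ominus>\<^bsub>R\<^esub> component y R)"

lemma component_simps:
  assumes "ring R"
  shows "component 0 R = \<zero>\<^bsub>R\<^esub>" "component 1 R = \<one>\<^bsub>R\<^esub>"
    "component (x + y) R = component x R \<oplus>\<^bsub>R\<^esub> component y R"
    "component (x * y) R = component x R \<otimes>\<^bsub>R\<^esub> component y R"
    "component (- x) R = \<ominus>\<^bsub>R\<^esub> component x R"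
    "component (x - y) R = component x R \<ominus>\<^bsub>R\<^esub> component y R"
  unfolding zero_ring_family_def one_ring_family_def plus_ring_family_def times_ring_family_def
    uminus_ring_family_def minus_ring_family_def
  by (subst component_family; simp add: assms ring.ring_simprules)+

instance
proof
  fix a b c :: "'a ring_family"
  show "a + b + c = a + (b + c)" "a + b = b + a" "0 + a = a" "- a + a = 0" "a - b = a + - b"
    "a * b * c = a * (b * c)" "1 * a = a" "a * 1 = a"
    "(a + b) * c = a * c + b * c" "a * (b + c) = a * b + a * c"
    by (rule ring_family_eqI; simp add: component_simps ring.ring_simprules monoid.r_one ring.is_monoid a_minus_def)+
  have "component 0 set_ring \<noteq> component (1 :: 'a ring_family) set_ring"
    unfolding component_simps[OF ring_set_ring] by (simp add: set_ring_def)
  then show "0 \<noteq> (1 :: 'a ring_family)" by metis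
qed

end

section \<open>The bt-algebra as a component\<close>

lemma free_algebra_simps [simp]:
  "monoid.mult (free_algebra n) = (*)" "one (free_algebra n) = 1"
  "zero (free_algebra n) = 0" "add (free_algebra n) = (+)"
  by (simp_all add: free_algebra_def)

lemma ring_free_algebra: "ring (free_algebra n :: 's::comm_ring_1 bt_free ring)"
proof (rule ringI)
  let ?L = "GenG ` {1..<n} \<union> GenE ` {1..<n}"
  have add: "x + y \<in> carrier (free_algebra n)"
    if "x \<in> carrier (free_algebra n)" "y \<in> carrier (free_algebra n)" for x y :: "'s bt_free"
    using that Poly_Mapping.keys_add[of x y] by (auto simp: free_algebra_def)
  have mult: "x * y \<in> carrier (free_algebra n)"
    if xy: "x \<in> carrier (free_algebra n)" "y \<in> carrier (free_algebra n)" for x y :: "'s bt_free"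
  proof -
    have "set (letters w) \<subseteq> ?L" if w: "w \<in> Poly_Mapping.keys (x * y)" for w
    proof -
      obtain a b where "w = a + b" "a \<in> Poly_Mapping.keys x" "b \<in> Poly_Mapping.keys y"
        using w keys_mult[of x y] by blast
      then show ?thesis using xy by (simp add: free_algebra_def plus_fword_def)
    qed
    then show ?thesis by (simp add: free_algebra_def)
  qed
  have one: "1 \<in> carrier (free_algebra n :: 's bt_free ring)"
    by (auto simp: free_algebra_def zero_fword_def simp flip: single_one)
  have uminus: "- x \<in> carrier (free_algebra n)" if "x \<in> carrier (free_algebra n)" for x :: "'s bt_free"
    using that by (simp add: free_algebra_def)
  show "abelian_group (free_algebra n :: 's bt_free ring)"
  proof (rule abelian_groupI)
    show "\<exists>y\<in>carrier (free_algebra n). y \<oplus>\<^bsub>free_algebra n\<^esub> x = \<zero>\<^bsub>free_algebra n\<^esub>"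
      if "x \<in> carrier (free_algebra n)" for x :: "'s bt_free"
      using uminus[OF that] by (intro bexI[of _ "- x"]) simp_all
    show "\<zero>\<^bsub>free_algebra n\<^esub> \<in> carrier (free_algebra n :: 's bt_free ring)"
      by (simp add: free_algebra_def)
  qed (simp_all add: add add.assoc add.commute add.left_commute)
  show "monoid (free_algebra n :: 's bt_free ring)"
    by (rule monoidI) (simp_all add: mult one mult.assoc)
qed (simp_all add: distrib_left distrib_right)

lemma free_algebra_closed [simp]:
  assumes "x \<in> carrier (free_algebra n)" "y \<in> carrier (free_algebra n)"
  shows "x + y \<in> carrier (free_algebra n)" "x * y \<in> carrier (free_algebra n)"
    "x - y \<in> carrier (free_algebra n)"
proof -
  interpret ring "free_algebra n :: 'a bt_free ring" by (rule ring_free_algebra)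
  show "x + y \<in> carrier (free_algebra n)" "x * y \<in> carrier (free_algebra n)"
    using a_closed[OF assms] m_closed[OF assms] by simp_all
  show "x - y \<in> carrier (free_algebra n)"
    using assms Poly_Mapping.keys_diff[of x y] by (auto simp: free_algebra_def)
qed

lemma one_in_free_algebra [simp]: "1 \<in> carrier (free_algebra n)"
  using ring.ring_simprules(6)[OF ring_free_algebra] by simp

lemma free_gens_in_free_algebra [simp]:
  "free_const c \<in> carrier (free_algebra n)"
  "i \<in> {1..<n} \<Longrightarrow> free_g i \<in> carrier (free_algebra n)"
  "i \<in> {1..<n} \<Longrightarrow> free_e i \<in> carrier (free_algebra n)"
  by (auto simp: free_algebra_def free_const_def free_g_def free_e_def zero_fword_def)

lemma bt_relators_subset: "bt_relators n q \<subseteq> carrier (free_algebra n)"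
proof
  fix x assume "x \<in> bt_relators n q"
  then show "x \<in> carrier (free_algebra n)"
    by cases (simp_all del: atLeastLessThan_iff)
qed

lemma ideal_bt_ideal: "ideal (bt_ideal n q) (free_algebra n)"
  unfolding bt_ideal_def by (rule ring.genideal_ideal[OF ring_free_algebra bt_relators_subset])

abbreviation bt_quot :: "nat \<Rightarrow> 's::comm_ring_1 \<Rightarrow> ('s bt_free set) ring"
  where "bt_quot n q \<equiv> free_algebra n Quot bt_ideal n q"

lemma ring_bt_quot [simp]: "ring (bt_quot n q)"
  by (rule ideal.quotient_is_ring[OF ideal_bt_ideal])

lemma bt_algebra_simps [simp]:
  "carrier (bt_algebra n q) = carrier (bt_quot n q)"
  "monoid.mult (bt_algebra n q) = monoid.mult (bt_quot n q)"
  "one (bt_algebra n q) = one (bt_quot n q)"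
  "zero (bt_algebra n q) = zero (bt_quot n q)"
  "add (bt_algebra n q) = add (bt_quot n q)"
  "c \<odot>\<^bsub>bt_algebra n q\<^esub> a = bt_class n q (free_const c) \<otimes>\<^bsub>bt_quot n q\<^esub> a"
  by (simp_all add: bt_algebra_def Let_def)

text \<open>The operations are those of the quotient, but in another record, and the sums and
  inverses in the definitions of the idempotents are formed in this record.\<close>

lemma ring_bt_algebra: "ring (bt_algebra n q)"
proof -
  interpret Q: ring "bt_quot n q" by (rule ring_bt_quot)
  show ?thesis
  proof (rule ringI)
    show "abelian_group (bt_algebra n q)"
    proof (rule abelian_groupI)
      show "\<exists>y\<in>carrier (bt_algebra n q). y \<oplus>\<^bsub>bt_algebra n q\<^esub> x = \<zero>\<^bsub>bt_algebra n q\<^esub>"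
        if "x \<in> carrier (bt_algebra n q)" for x
        using that by (intro bexI[of _ "\<ominus>\<^bsub>bt_quot n q\<^esub> x"]) (simp_all add: Q.l_neg)
    qed (simp_all add: Q.a_assoc Q.a_comm Q.a_lcomm)
    show "Group.monoid (bt_algebra n q)"
      by (rule monoidI) (simp_all add: Q.m_assoc)
  qed (simp_all add: Q.l_distr Q.r_distr)
qed

lemma bt_class_mem_iff:
  "x \<in> bt_class n q p \<longleftrightarrow> x - p \<in> bt_ideal n q"
  unfolding bt_class_def a_r_coset_def r_coset_def by (auto simp: algebra_simps) (metis diff_add_cancel)

lemma bt_ideal_closed:
  "x \<in> bt_ideal n q \<Longrightarrow> y \<in> bt_ideal n q \<Longrightarrow> x + y \<in> bt_ideal n q"
  "x \<in> bt_ideal n q \<Longrightarrow> - x \<in> bt_ideal n q"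
  "x \<in> bt_ideal n q \<Longrightarrow> x \<in> carrier (free_algebra n)"
proof -
  interpret ideal "bt_ideal n q" "free_algebra n" by (rule ideal_bt_ideal)
  show "x \<in> bt_ideal n q \<Longrightarrow> y \<in> bt_ideal n q \<Longrightarrow> x + y \<in> bt_ideal n q"
    using additive_subgroup.a_closed[OF ideal.axioms(1)[OF ideal_bt_ideal], of x n q y] by simp
  show x: "x \<in> bt_ideal n q \<Longrightarrow> x \<in> carrier (free_algebra n)" using Icarr .
  assume xI: "x \<in> bt_ideal n q"
  have "- x \<in> carrier (free_algebra n)"
    using x[OF xI] by (simp add: free_algebra_def)
  then have "\<ominus>\<^bsub>free_algebra n\<^esub> x = - x"
    using x[OF xI] by (intro minus_equality) simp_all
  then show "- x \<in> bt_ideal n q"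
    using additive_subgroup.a_inv_closed[OF ideal.axioms(1)[OF ideal_bt_ideal] xI] by simp
qed

lemma bt_class_eq:
  assumes "p - p' \<in> bt_ideal n q"
  shows "bt_class n q p = bt_class n q p'"
proof -
  have "x - p \<in> bt_ideal n q \<longleftrightarrow> x - p' \<in> bt_ideal n q" for x
    using bt_ideal_closed(1)[OF _ assms, of "x - p"]
      bt_ideal_closed(1)[OF _ bt_ideal_closed(2)[OF assms], of "x - p'"] by auto
  then show ?thesis by (auto simp: bt_class_mem_iff)
qed

lemma bt_class_relator:
  assumes "p - p' \<in> bt_relators n q"
  shows "bt_class n q p = bt_class n q p'"
  using assms ring.genideal_self[OF ring_free_algebra bt_relators_subset, of n q]
  by (intro bt_class_eq) (auto simp: bt_ideal_def)

lemma bt_class_hom: "bt_class n q \<in> ring_hom (free_algebra n) (bt_quot n q)"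
  using ideal.rcos_ring_hom[OF ideal_bt_ideal[of n q]] by (simp add: bt_class_def[abs_def])

lemma bt_class_closed [simp]:
  "p \<in> carrier (free_algebra n) \<Longrightarrow> bt_class n q p \<in> carrier (bt_quot n q)"
  using ring_hom_closed[OF bt_class_hom] .

lemma bt_class_arith:
  assumes "p \<in> carrier (free_algebra n)" "p' \<in> carrier (free_algebra n)"
  shows "bt_class n q (p + p') = bt_class n q p \<oplus>\<^bsub>bt_quot n q\<^esub> bt_class n q p'"
    "bt_class n q (p * p') = bt_class n q p \<otimes>\<^bsub>bt_quot n q\<^esub> bt_class n q p'"
  using ring_hom_add[OF bt_class_hom[of n q] assms] ring_hom_mult[OF bt_class_hom[of n q] assms]
  by simp_all

lemma bt_class_one [simp]: "bt_class n q 1 = \<one>\<^bsub>bt_quot n q\<^esub>"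
  using ring_hom_one[OF bt_class_hom[of n q]] by simp

lemma bt_class_zero: "bt_class n q 0 = \<zero>\<^bsub>bt_quot n q\<^esub>"
  using ring_hom_zero[OF bt_class_hom[of n q] ring_free_algebra ring_bt_quot] by simp

lemma bt_quot_carrier: "carrier (bt_quot n q) = bt_class n q ` carrier (free_algebra n)"
  by (auto simp: FactRing_def A_RCOSETS_def' bt_class_def)

lemma bt_class_surj:
  assumes "a \<in> carrier (bt_quot n q)"
  obtains p where "p \<in> carrier (free_algebra n)" "a = bt_class n q p"
  using assms bt_quot_carrier by blast

lemma free_const_mult: "free_const c * free_const d = free_const (c * d)"
  "free_const c + free_const d = free_const (c + d)" "free_const 1 = 1"
  "free_const c - free_const d = free_const (c - d)"
  by (simp_all add: free_const_def mult_single single_add single_diff)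

lemma lookup_scale [simp]: "Poly_Mapping.lookup (scale c p) k = c * Poly_Mapping.lookup p k"
  by (simp add: Poly_Mapping.map.rep_eq when_def)

lemma scale_eq_free_const: "scale c p = free_const c * p"
  by (simp add: free_const_def mult_map_scale_conv_mult)

lemma free_const_commute: "free_const c * p = p * free_const c"
proof -
  have "Poly_Mapping.single 0 c * p = p * Poly_Mapping.single 0 c" for p :: "'a bt_free"
  proof (induction p rule: Poly_Mapping.update_induct)
    case (update f a b)
    have "Poly_Mapping.update a b f = f + Poly_Mapping.single a b"
      using update by (intro poly_mapping_eqI) (auto simp: lookup_update lookup_add lookup_single in_keys_iff when_def)
    then show ?case
      using update by (simp add: distrib_left distrib_right mult_single mult.commute)
  qed simp
  then show ?thesis by (simp add: free_const_def)
qed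

lemma bt_class_diff:
  assumes p: "p \<in> carrier (free_algebra n)" and p': "p' \<in> carrier (free_algebra n)"
  shows "bt_class n q (p - p') = bt_class n q p \<ominus>\<^bsub>bt_quot n q\<^esub> bt_class n q p'"
proof -
  interpret ring "bt_quot n q" by (rule ring_bt_quot)
  have "bt_class n q p = bt_class n q (p - p') \<oplus>\<^bsub>bt_quot n q\<^esub> bt_class n q p'"
    using bt_class_arith(1)[of "p - p'" n p' q] p p' by simp
  then show ?thesis
    using p p' by (simp add: a_minus_def a_assoc r_neg)
qed

lemma bt_scalar_central:
  assumes "a \<in> carrier (bt_quot n q)"
  shows "bt_class n q (free_const c) \<otimes>\<^bsub>bt_quot n q\<^esub> a = a \<otimes>\<^bsub>bt_quot n q\<^esub> bt_class n q (free_const c)"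
proof -
  obtain p where p: "p \<in> carrier (free_algebra n)" "a = bt_class n q p"
    using bt_class_surj[OF assms] .
  have "bt_class n q (free_const c * p) = bt_class n q (p * free_const c)"
    by (simp only: free_const_commute)
  then show ?thesis using p by (simp add: bt_class_arith(2))
qed

lemma unit_inv_eq: "q * q' = 1 \<Longrightarrow> unit_inv q = q'"
  unfolding unit_inv_def
proof (rule the_equality)
  fix x assume "q * q' = 1" "q * x = 1"
  then show "x = q'" by (metis mult.assoc mult.commute mult.right_neutral)
qed

text \<open>Laurent polynomials and fields enter only through an explicit inverse of
  \<open>q\<close>.\<close>

locale bt_unit =
  fixes n :: nat and q q' :: "'s::comm_ring_1"
  assumes unit: "q * q' = 1"
begin

abbreviation Q where "Q \<equiv> bt_quot n q"

sublocale Q: ring Q by (rule ring_bt_quot)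

text \<open>The relations hold trivially in the remaining components for \<open>g = 1\<close> and \<open>e = 0\<close>.\<close>

definition at_quot :: "'s bt_free set \<Rightarrow> ('s bt_free set ring \<Rightarrow> 's bt_free set) \<Rightarrow> 's bt_free ring_family"
  where "at_quot a d = family (\<lambda>R. if R = Q then a else d R)"

definition fam_g :: "nat \<Rightarrow> 's bt_free ring_family"
  where "fam_g i = (if i \<in> {1..<n} then at_quot (bt_g n q i) one else 1)"

definition fam_e :: "nat \<Rightarrow> 's bt_free ring_family"
  where "fam_e i = (if i \<in> {1..<n} then at_quot (bt_e n q i) zero else 0)"

definition fam_scalar :: "'s \<Rightarrow> 's bt_free ring_family"
  where "fam_scalar c = at_quot (bt_class n q (free_const c)) one"

lemma component_at_quot:
  assumes "a \<in> carrier Q" "\<And>R. ring R \<Longrightarrow> d R \<in> carrier R" "ring R"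
  shows "component (at_quot a d) R = (if R = Q then a else d R)"
  unfolding at_quot_def by (rule component_family) (use assms in auto)

lemma bt_gens_closed [simp]:
  "i \<in> {1..<n} \<Longrightarrow> bt_g n q i \<in> carrier Q" "i \<in> {1..<n} \<Longrightarrow> bt_e n q i \<in> carrier Q"
  by (simp_all add: bt_g_def bt_e_def del: atLeastLessThan_iff One_nat_def)

lemma component_fam:
  assumes "ring R"
  shows "i \<in> {1..<n} \<Longrightarrow> component (fam_g i) R = (if R = Q then bt_g n q i else \<one>\<^bsub>R\<^esub>)"
    "i \<in> {1..<n} \<Longrightarrow> component (fam_e i) R = (if R = Q then bt_e n q i else \<zero>\<^bsub>R\<^esub>)"
    "component (fam_scalar c) R = (if R = Q then bt_class n q (free_const c) else \<one>\<^bsub>R\<^esub>)"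
  unfolding fam_g_def fam_e_def fam_scalar_def
  by (simp_all add: component_at_quot assms ring.ring_simprules del: atLeastLessThan_iff One_nat_def)

lemma fam_eqI:
  assumes "component x Q = component y Q"
    and "\<And>R. ring R \<Longrightarrow> R \<noteq> Q \<Longrightarrow> component x R = component y R"
  shows "x = y"
  using assms by (intro ring_family_eqI) metis

text \<open>In the component \<open>Q\<close> each relation is the image of a relator; in every
  other component it becomes a trivial identity between 0 and 1.\<close>

sublocale fam: bt_relations n fam_g fam_e "fam_scalar q" "fam_scalar q'"
proof
  note [simp del] = atLeastLessThan_iff One_nat_def
  note comp = component_simps component_fam ring.ring_simprules monoid.r_one ring.is_monoid
  note cls = bt_g_def bt_e_def bt_class_arith(2)[symmetric]
  fix i j
  assume i: "i \<in> {1..<n}"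
  show "fam_g i * fam_e i = fam_e i * fam_g i"
    by (rule fam_eqI) (simp_all add: comp i cls bt_class_relator[OF bt_relators.ge[OF i]])
  show "fam_e i * fam_e i = fam_e i"
    by (rule fam_eqI) (simp_all add: comp i cls bt_class_relator[OF bt_relators.e_idem[OF i]])
  have "bt_g n q i \<otimes>\<^bsub>Q\<^esub> bt_g n q i =
      \<one>\<^bsub>Q\<^esub> \<oplus>\<^bsub>Q\<^esub> bt_class n q (free_const (q - q')) \<otimes>\<^bsub>Q\<^esub> bt_e n q i \<otimes>\<^bsub>Q\<^esub> bt_g n q i"
    using bt_class_relator[OF bt_relators.quad[OF i], of q] i
    by (simp add: bt_g_def bt_e_def bt_class_arith unit_inv_eq[OF unit])
  then show "fam_g i * fam_g i = 1 + (fam_scalar q - fam_scalar q') * fam_e i * fam_g i"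
    by (intro fam_eqI)
      (simp_all add: comp i free_const_mult(4)[symmetric] bt_class_diff a_minus_def)
  assume j: "j \<in> {1..<n}"
  show "fam_e i * fam_e j = fam_e j * fam_e i"
    by (rule fam_eqI) (simp_all add: comp i j cls bt_class_relator[OF bt_relators.ee[OF i j]])
  show "fam_g i * fam_g j = fam_g j * fam_g i" if "index_dist i j > 1"
    by (rule fam_eqI) (simp_all add: comp i j cls bt_class_relator[OF bt_relators.gg_far[OF i j that]])
  show "fam_g i * fam_e j = fam_e j * fam_g i" if "index_dist i j > 1"
    by (rule fam_eqI) (simp_all add: comp i j cls bt_class_relator[OF bt_relators.ge_far[OF i j that]])
  assume d: "index_dist i j = 1"
  show "fam_g i * fam_g j * fam_g i = fam_g j * fam_g i * fam_g j"
    by (rule fam_eqI) (simp_all add: comp i j cls bt_class_relator[OF bt_relators.braid[OF i j d]] del: Q.m_assoc)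
  show "fam_e i * fam_g j * fam_g i = fam_g j * fam_g i * fam_e j"
    by (rule fam_eqI) (simp_all add: comp i j cls bt_class_relator[OF bt_relators.egg[OF i j d]])
  show "fam_e i * fam_e j * fam_g j = fam_e i * fam_g j * fam_e i"
    by (rule fam_eqI) (simp_all add: comp i j cls bt_class_relator[OF bt_relators.eeg[OF i j d]])
  show "fam_e i * fam_g j * fam_e i = fam_g j * fam_e i * fam_e j"
    by (rule fam_eqI) (simp_all add: comp i j cls bt_class_relator[OF bt_relators.ege[OF i j d]])
next
  note comp = component_simps component_fam ring.ring_simprules monoid.r_one ring.is_monoid
  show "fam_scalar q * x = x * fam_scalar q" for x
    by (rule fam_eqI) (simp_all add: comp bt_scalar_central)
  show "fam_scalar q * fam_scalar q' = 1"
    by (rule fam_eqI) (simp_all add: comp unit bt_class_arith(2)[symmetric] free_const_mult)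
qed

abbreviation B where "B \<equiv> bt_algebra n q"

text \<open>A ring homomorphism to the quotient. It carries every identity derived for
  \<open>fam\<close> to the bt-algebra.\<close>

definition proj :: "'s bt_free ring_family \<Rightarrow> 's bt_free set"
  where "proj x = component x Q"

lemma proj_closed [simp]: "proj x \<in> carrier Q"
  by (simp add: proj_def)

lemma proj_simps:
  "proj 0 = \<zero>\<^bsub>Q\<^esub>" "proj 1 = \<one>\<^bsub>Q\<^esub>" "proj (x + y) = proj x \<oplus>\<^bsub>Q\<^esub> proj y"
  "proj (x * y) = proj x \<otimes>\<^bsub>Q\<^esub> proj y" "proj (- x) = \<ominus>\<^bsub>Q\<^esub> proj x"
  "proj (x - y) = proj x \<ominus>\<^bsub>Q\<^esub> proj y"
  by (simp_all add: proj_def component_simps)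

lemma proj_fam:
  "i \<in> {1..<n} \<Longrightarrow> proj (fam_g i) = bt_g n q i" "i \<in> {1..<n} \<Longrightarrow> proj (fam_e i) = bt_e n q i"
  "proj (fam_scalar c) = bt_class n q (free_const c)"
  by (simp_all add: proj_def component_fam del: atLeastLessThan_iff One_nat_def)

lemma proj_prod_list:
  "proj (prod_list (map f xs)) = bt_prod n q (map (\<lambda>x. proj (f x)) xs)"
  by (induction xs) (simp_all add: bt_prod_def proj_simps)

lemma proj_sum: "finite S \<Longrightarrow> proj (sum f S) = (\<Oplus>\<^bsub>B\<^esub>x\<in>S. proj (f x))"
proof (induction S rule: finite_induct)
  case empty
  interpret BR: ring B by (rule ring_bt_algebra)
  show ?case by (simp add: proj_simps)
next
  case (insert x S)
  interpret BR: ring B by (rule ring_bt_algebra)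
  show ?case using insert by (simp add: proj_simps BR.finsum_insert)
qed

lemma proj_of_nat: "proj (of_nat k) = bt_class n q (free_const (of_nat k))"
proof (induction k)
  case 0
  then show ?case by (simp add: proj_simps free_const_def bt_class_zero)
next
  case (Suc k)
  then show ?case by (simp add: proj_simps bt_class_arith(1) free_const_mult flip: free_const_mult(2))
qed

lemma proj_of_int: "proj (of_int k) = bt_class n q (free_const (of_int k))"
proof (cases k)
  case (nonneg m)
  then show ?thesis by (simp add: proj_of_nat)
next
  case (neg m)
  have "bt_class n q (free_const (of_int k)) = bt_class n q (free_const 0 - free_const (of_nat (Suc m)))"
    unfolding free_const_mult by (simp add: neg)
  also have "\<dots> = proj (0 - of_nat (Suc m))"
    by (simp only: bt_class_diff free_gens_in_free_algebra proj_simps proj_of_nat)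
      (simp add: free_const_def bt_class_zero)
  finally show ?thesis by (simp add: neg)
qed

lemma proj_power_scalar: "proj (fam_scalar c ^ k) = bt_class n q (free_const (c ^ k))"
proof (induction k)
  case 0
  then show ?case by (simp add: proj_simps free_const_mult)
next
  case (Suc k)
  then show ?case by (simp add: proj_simps proj_fam bt_class_arith(2) flip: free_const_mult(1))
qed

lemma proj_g_inv:
  assumes "i \<in> {1..<n}"
  shows "proj (fam.g_inv i) = inv\<^bsub>B\<^esub> bt_g n q i"
proof -
  interpret BR: ring B by (rule ring_bt_algebra)
  show ?thesis
  proof (rule BR.inv_unique')
    show "bt_g n q i \<otimes>\<^bsub>B\<^esub> proj (fam.g_inv i) = \<one>\<^bsub>B\<^esub>" "proj (fam.g_inv i) \<otimes>\<^bsub>B\<^esub> bt_g n q i = \<one>\<^bsub>B\<^esub>"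
      using arg_cong[OF fam.g_g_inv[OF assms], of proj] arg_cong[OF fam.g_inv_g[OF assms], of proj] assms
      by (simp_all add: proj_simps proj_fam del: atLeastLessThan_iff One_nat_def)
  qed (use assms in \<open>simp_all del: atLeastLessThan_iff One_nat_def\<close>)
qed

lemma proj_E_dist:
  assumes "1 \<le> i" "i + d < n"
  shows "proj (fam.E_dist d i) = bt_Eij n q i (Suc (i + d))"
  using assms
proof (induction d arbitrary: i)
  case 0
  then show ?case by (simp add: bt_Eij.simps proj_fam)
next
  case (Suc d)
  have "i \<in> {1..<n}" using Suc.prems by auto
  moreover have "proj (fam.E_dist d (Suc i)) = bt_Eij n q (Suc i) (Suc (i + Suc d))"
    using Suc.IH[of "Suc i"] Suc.prems by simp
  ultimately show ?case
    by (subst bt_Eij.simps) (simp add: proj_simps proj_fam proj_g_inv flip: Suc_eq_plus1 del: atLeastLessThan_iff One_nat_def)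
qed

lemma proj_E_pair:
  assumes "1 \<le> i" "i < j" "j \<le> n"
  shows "proj (fam.E_pair i j) = bt_Eij n q i j"
  using proj_E_dist[of i "j - Suc i"] assms by (simp add: fam.E_pair_def)

lemma bt_E_eq: "bt_E n q A = bt_prod n q (map (\<lambda>(i, j). bt_Eij n q i j) (block_pairs n A))"
  unfolding bt_E_def block_pairs_def
  by (simp add: map_concat comp_def if_distrib[of "map _"] cong: if_cong)

lemma proj_E_part: "proj (fam.E_part A) = bt_E n q A"
proof -
  have "map (\<lambda>x. proj (case x of (i, j) \<Rightarrow> fam.E_pair i j)) (block_pairs n A) =
      map (\<lambda>(i, j). bt_Eij n q i j) (block_pairs n A)"
    by (rule map_cong[OF refl]) (auto simp: set_block_pairs proj_E_pair)
  then show ?thesis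
    unfolding fam.E_part_def bt_E_eq proj_prod_list by (simp only:)
qed

lemma finite_set_partitions [simp]: "finite {A \<in> set_partitions n. P A}"
  using finitely_many_partition_on[of "{1..n}"] by (simp add: set_partitions_def)

lemma proj_idem_part: "proj (fam.idem_part A) = bt_idem n q A"
  unfolding fam.idem_part_def bt_idem_def
  by (simp add: proj_sum proj_simps proj_of_int proj_E_part)

lemma proj_idem_type: "proj (fam.idem_type \<alpha>) = bt_central_idem n q \<alpha>"
  unfolding fam.idem_type_def bt_central_idem_def by (simp add: proj_sum proj_idem_part)

lemma proj_g_perm:
  assumes "w permutes {1..n}"
  shows "proj (fam.g_perm w) = bt_gw n q w"
proof -
  let ?us = "SOME us. expression_of n w us \<and> length us = perm_length n w"
  have "\<exists>us. reduced_word n us \<and> word_perm us = w" by (rule reduced_word_exists[OF assms])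
  from someI_ex[OF this] have "set ?us \<subseteq> {1..<n}"
    unfolding expression_of_perm_length_iff[OF assms] by (auto simp: reduced_word_def)
  then have "map (\<lambda>i. proj (fam_g i)) ?us = map (bt_g n q) ?us"
    by (intro map_cong[OF refl]) (auto simp: proj_fam)
  then show ?thesis unfolding fam.g_perm_def bt_gw_def proj_prod_list by (simp only:)
qed

lemma proj_stab_sum:
  assumes "fam.stab c = row_stabilizer n \<nu>"
  shows "proj (fam.stab_sum c) = row_sum n q \<nu>"
proof -
  interpret BR: ring B by (rule ring_bt_algebra)
  have "proj (fam.stab_sum c) = (\<Oplus>\<^bsub>B\<^esub>w\<in>fam.stab c.
      q ^ perm_length n w \<odot>\<^bsub>B\<^esub> proj (fam.g_perm w))"
    unfolding fam.stab_sum_def by (simp add: proj_sum proj_simps proj_power_scalar)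
  also have "\<dots> = (\<Oplus>\<^bsub>B\<^esub>w\<in>fam.stab c. q ^ perm_length n w \<odot>\<^bsub>B\<^esub> bt_gw n q w)"
    by (rule BR.finsum_cong') (auto simp: fam.stab_def proj_g_perm simp flip: proj_g_perm)
  finally show ?thesis unfolding row_sum_def assms .
qed

end

section \<open>Tensor space\<close>

lemma scale_simps [simp]:
  "scale c (0 :: 'k \<Rightarrow>\<^sub>0 's::comm_ring_1) = 0" "scale 0 u = 0" "scale 1 u = u"
  "scale c (scale d u) = scale (c * d) u"
  "scale c (Poly_Mapping.single k d) = Poly_Mapping.single k (c * d)"
  by (auto intro!: poly_mapping_eqI simp: mult.assoc lookup_single when_def)

lemma scale_distrib:
  "scale c (u + v) = scale c u + scale c v" "scale (c + d) u = scale c u + scale d u"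
  "scale c (u - v) = scale c u - scale c v" "scale (c - d) u = scale c u - scale d u"
  by (auto intro!: poly_mapping_eqI simp: lookup_add lookup_minus algebra_simps)

lemma scale_sum: "scale c (sum f S) = (\<Sum>x\<in>S. scale c (f x))"
  by (induction S rule: infinite_finite_induct) (simp_all add: scale_distrib)

lemma lin_ext_superset:
  assumes "finite S" "Poly_Mapping.keys u \<subseteq> S"
  shows "lin_ext f u = (\<Sum>k\<in>S. scale (Poly_Mapping.lookup u k) (f k))"
  unfolding lin_ext_def
  by (rule sum.mono_neutral_left) (use assms in \<open>auto simp: in_keys_iff\<close>)

definition linear_op :: "(('k \<Rightarrow>\<^sub>0 's::comm_ring_1) \<Rightarrow> ('l \<Rightarrow>\<^sub>0 's)) \<Rightarrow> bool"
  where "linear_op f \<longleftrightarrow> (\<forall>u v. f (u + v) = f u + f v) \<and> (\<forall>c u. f (scale c u) = scale c (f u))"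

lemma linear_opD:
  assumes "linear_op f"
  shows "f (u + v) = f u + f v" "f (scale c u) = scale c (f u)" "f 0 = 0" "f (u - v) = f u - f v"
    "f (sum g S) = (\<Sum>x\<in>S. f (g x))"
proof -
  show add: "f (u + v) = f u + f v" and "f (scale c u) = scale c (f u)" for u v
    using assms by (auto simp: linear_op_def)
  show zero: "f 0 = 0" using add[of 0 0] by simp
  show "f (u - v) = f u - f v" using add[of "u - v" v] by simp
  show "f (sum g S) = (\<Sum>x\<in>S. f (g x))"
    by (induction S rule: infinite_finite_induct) (simp_all add: zero add)
qed

lemma linear_op_lin_ext [simp]: "linear_op (lin_ext f)"
  unfolding linear_op_def
proof (intro conjI allI)
  fix u v :: "'a \<Rightarrow>\<^sub>0 'b" and c
  let ?S = "Poly_Mapping.keys u \<union> Poly_Mapping.keys v"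
  show "lin_ext f (u + v) = lin_ext f u + lin_ext f v"
    using Poly_Mapping.keys_add[of u v]
    by (simp add: lin_ext_superset[of ?S] lookup_add scale_distrib sum.distrib)
  show "lin_ext f (scale c u) = scale c (lin_ext f u)"
  proof -
    have "Poly_Mapping.keys (scale c u) \<subseteq> Poly_Mapping.keys u" by (auto simp: in_keys_iff)
    then show ?thesis
      by (simp add: lin_ext_superset[of "Poly_Mapping.keys u"] scale_sum)
  qed
qed

lemma lin_ext_single [simp]: "lin_ext f (Poly_Mapping.single k c) = scale c (f k)"
  by (cases "c = 0") (simp_all add: lin_ext_def)

lemma poly_mapping_sum_singles:
  "u = (\<Sum>k\<in>Poly_Mapping.keys u. scale (Poly_Mapping.lookup u k) (Poly_Mapping.single k 1))"
  by (rule poly_mapping_eqI)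
    (auto simp: lookup_sum lookup_single when_def in_keys_iff sum.delta)

lemma linear_op_eqI:
  assumes "linear_op f" "linear_op g"
    and "\<And>k. k \<in> Poly_Mapping.keys u \<Longrightarrow> f (Poly_Mapping.single k 1) = g (Poly_Mapping.single k 1)"
  shows "f u = g u"
proof -
  have "f u = (\<Sum>k\<in>Poly_Mapping.keys u. scale (Poly_Mapping.lookup u k) (f (Poly_Mapping.single k 1)))"
    by (subst poly_mapping_sum_singles) (simp only: linear_opD[OF assms(1)])
  also have "\<dots> = (\<Sum>k\<in>Poly_Mapping.keys u. scale (Poly_Mapping.lookup u k) (g (Poly_Mapping.single k 1)))"
    using assms(3) by simp
  also have "\<dots> = g u"
    by (subst (3) poly_mapping_sum_singles) (simp only: linear_opD[OF assms(2)])
  finally show ?thesis .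
qed

lemma linear_op_comp: "linear_op f \<Longrightarrow> linear_op g \<Longrightarrow> linear_op (\<lambda>u. f (g u))"
  by (simp add: linear_op_def)

lemma linear_op_id [simp]: "linear_op (\<lambda>u. u)"
  by (simp add: linear_op_def)

lemma linear_op_zero [simp]: "linear_op (\<lambda>u. 0)"
  by (simp add: linear_op_def)

lemma linear_op_act_gen [simp]: "linear_op (act_gen q x)"
  by (cases x) (simp_all add: act_at_def[abs_def])

lemma linear_op_fold_act_gen [simp]: "linear_op (fold (act_gen q) xs)"
proof (induction xs)
  case Nil
  then show ?case by (simp add: linear_op_def)
next
  case (Cons x xs)
  then show ?case using linear_op_comp[OF Cons linear_op_act_gen] by (simp add: comp_def)
qed

lemma linear_op_act_free_left: "linear_op (\<lambda>v. act_free q v p)"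
  unfolding act_free_def lin_ext_def linear_op_def
  by (simp add: linear_opD[OF linear_op_fold_act_gen] scale_distrib sum.distrib scale_sum mult.commute)

lemma linear_op_act_free_right: "linear_op (act_free q v)"
  using linear_op_lin_ext by (simp add: act_free_def[abs_def])

lemma act_free_single: "act_free q v (Poly_Mapping.single w c) = scale c (fold (act_gen q) (letters w) v)"
  by (simp add: act_free_def)

lemma linear_op_mult: "linear_op (\<lambda>p. p * p')" for p' :: "'s::comm_ring_1 bt_free"
  by (simp add: linear_op_def distrib_right scale_eq_free_const mult.assoc)

lemma linear_op_mult_left: "linear_op (\<lambda>p'. p * p')" for p :: "'s::comm_ring_1 bt_free"
  unfolding linear_op_def scale_eq_free_const
  by (auto simp: distrib_left) (metis free_const_commute mult.assoc)

text \<open>Linearity in \<open>p\<close> and then in \<open>p'\<close> reduces the claim to words,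
  whose concatenation composes the folds.\<close>

lemma act_free_mult: "act_free q v (p * p') = act_free q (act_free q v p) p'"
proof (rule linear_op_eqI[of "\<lambda>p. act_free q v (p * p')" "\<lambda>p. act_free q (act_free q v p) p'"])
  show "linear_op (\<lambda>p. act_free q v (p * p'))"
    by (rule linear_op_comp[OF linear_op_act_free_right linear_op_mult])
  show "linear_op (\<lambda>p. act_free q (act_free q v p) p')"
    by (rule linear_op_comp[OF linear_op_act_free_left linear_op_act_free_right])
  fix w
  show "act_free q v (Poly_Mapping.single w 1 * p') = act_free q (act_free q v (Poly_Mapping.single w 1)) p'"
  proof (rule linear_op_eqI[of "\<lambda>p'. act_free q v (Poly_Mapping.single w 1 * p')"])
    show "linear_op (\<lambda>p'. act_free q v (Poly_Mapping.single w 1 * p'))"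
      by (rule linear_op_comp[OF linear_op_act_free_right linear_op_mult_left])
    show "linear_op (act_free q (act_free q v (Poly_Mapping.single w 1)))"
      by (rule linear_op_act_free_right)
  qed (simp add: mult_single act_free_single plus_fword_def)
qed

lemma act_free_one: "act_free q v 1 = v"
  by (simp add: act_free_single zero_fword_def flip: single_one)

lemma act_free_gens:
  "act_free q v (free_g i) = act_gen q (GenG i) v"
  "act_free q v (free_e i) = act_gen q (GenE i) v"
  "act_free q v (free_const c) = scale c v"
  by (simp_all add: free_g_def free_e_def free_const_def act_free_single zero_fword_def del: act_gen.simps)

section \<open>The operators of the generators on pure tensors of basis vectors\<close>

abbreviation word_tensor :: "basis_index list \<Rightarrow> 's::comm_ring_1 tensor"
  where "word_tensor w \<equiv> Poly_Mapping.single w 1"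

definition swap_at :: "nat \<Rightarrow> 'b list \<Rightarrow> 'b list"
  where "swap_at k w = w[k - 1 := w ! k, k := w ! (k - 1)]"

text \<open>The operator \<open>G\<close> sends \<open>a \<otimes> b\<close> to \<open>stay_coeff a b\<close> times itself plus \<open>swap_coeff a b\<close> times
  \<open>b \<otimes> a\<close>.\<close>

definition stay_coeff :: "'s::comm_ring_1 \<Rightarrow> basis_index \<Rightarrow> basis_index \<Rightarrow> 's"
  where "stay_coeff q a b = (if snd a \<noteq> snd b \<or> fst a < fst b then 0
    else if fst a = fst b then q else q - unit_inv q)"

definition swap_coeff :: "basis_index \<Rightarrow> basis_index \<Rightarrow> 's::comm_ring_1"
  where "swap_coeff a b = (if a = b then 0 else 1)"

lemma coeff_diff_component:
  assumes "snd a \<noteq> snd b"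
  shows "stay_coeff q a b = 0" "swap_coeff a b = 1"
  using assms by (auto simp: stay_coeff_def swap_coeff_def)

lemma act_G_word:
  assumes "1 \<le> k" "k < length w"
  shows "act_gen q (GenG k) (word_tensor w) =
    scale (stay_coeff q (w ! (k - 1)) (w ! k)) (word_tensor w) +
    scale (swap_coeff (w ! (k - 1)) (w ! k)) (word_tensor (swap_at k w))"
proof -
  obtain i s where a: "w ! (k - 1) = (i, s)" by (cases "w ! (k - 1)")
  obtain j t where b: "w ! k = (j, t)" by (cases "w ! k")
  have same: "w[k - 1 := (i, s), k := (j, t)] = w"
    by (metis a b list_update_id)
  show ?thesis
    using same
    by (auto simp: act_at_def stay_coeff_def swap_coeff_def swap_at_def a b
        linear_opD(1)[OF linear_op_lin_ext] simp del: One_nat_def)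
qed

lemma act_E_word:
  assumes "1 \<le> k" "k < length w"
  shows "act_gen q (GenE k) (word_tensor w) =
    (if snd (w ! (k - 1)) = snd (w ! k) then word_tensor w else 0)"
proof -
  obtain i s where a: "w ! (k - 1) = (i, s)" by (cases "w ! (k - 1)")
  obtain j t where b: "w ! k = (j, t)" by (cases "w ! k")
  have same: "w[k - 1 := (i, s), k := (j, t)] = w"
    by (metis a b list_update_id)
  show ?thesis
    using same by (auto simp add: act_at_def a b linear_opD(3)[OF linear_op_lin_ext] simp del: One_nat_def)
qed

lemma act_adjacent_word:
  "act_gen q (GenG (Suc (length xs))) (word_tensor (xs @ a # b # ys)) =
    scale (stay_coeff q a b) (word_tensor (xs @ a # b # ys)) +
    scale (swap_coeff a b) (word_tensor (xs @ b # a # ys))"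
  "act_gen q (GenE (Suc (length xs))) (word_tensor (xs @ a # b # ys)) =
    (if snd a = snd b then word_tensor (xs @ a # b # ys) else 0)"
  by (simp_all add: act_G_word act_E_word swap_at_def nth_append list_update_append del: act_gen.simps)

context bt_unit
begin

lemma unit_left: "q * (q' * x) = x"
  using unit by (metis mult.assoc mult_1)

abbreviation Gop where "Gop k \<equiv> act_gen q (GenG k)"
abbreviation Eop where "Eop k \<equiv> act_gen q (GenE k)"

text \<open>Only three consecutive letters matter. If all three have the same component, the braid
  relation is the one of a Hecke algebra acting on tensors, checked over the possible orders of the
  lower indices. Letters of different components are merely exchanged.\<close>

lemma adjacent_relations:
  assumes k: "k \<ge> 1" "Suc k < length w"
  defines "l \<equiv> Suc k"
  shows "Gop k (Gop l (Gop k (word_tensor w))) = Gop l (Gop k (Gop l (word_tensor w)))"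
    "Gop k (Gop l (Eop k (word_tensor w))) = Eop l (Gop k (Gop l (word_tensor w)))"
    "Gop l (Gop k (Eop l (word_tensor w))) = Eop k (Gop l (Gop k (word_tensor w)))"
    "Gop l (Eop l (Eop k (word_tensor w))) = Eop k (Gop l (Eop k (word_tensor w)))"
    "Gop k (Eop k (Eop l (word_tensor w))) = Eop l (Gop k (Eop l (word_tensor w)))"
    "Eop k (Gop l (Eop k (word_tensor w))) = Eop l (Eop k (Gop l (word_tensor w)))"
    "Eop l (Gop k (Eop l (word_tensor w))) = Eop k (Eop l (Gop k (word_tensor w)))"
proof -
  define xs where "xs = take (k - 1) w"
  define ys where "ys = drop (k + 2) w"
  obtain a b c where w: "w = xs @ a # b # c # ys"
  proof
    have "w = take (k - 1) w @ drop (k - 1) w" by simp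
    also have "drop (k - 1) w = w ! (k - 1) # w ! k # w ! (k + 1) # drop (k + 2) w"
      using k by (cases k) (simp_all add: Cons_nth_drop_Suc)
    finally show "w = xs @ w ! (k - 1) # w ! k # w ! (k + 1) # ys" by (simp add: xs_def ys_def)
  qed
  have len: "length xs = k - 1" using k by (simp add: xs_def)
  have K: "k = Suc (length xs)" using len k by simp
  have L: "l = Suc (length (xs @ [d]))" for d using K by (simp add: l_def)
  have gk: "Gop k (word_tensor (xs @ d # e # f # ys)) =
      scale (stay_coeff q d e) (word_tensor (xs @ d # e # f # ys)) +
      scale (swap_coeff d e) (word_tensor (xs @ e # d # f # ys))"
    and ek: "Eop k (word_tensor (xs @ d # e # f # ys)) =
      (if snd d = snd e then word_tensor (xs @ d # e # f # ys) else 0)"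
    and gl: "Gop l (word_tensor (xs @ d # e # f # ys)) =
      scale (stay_coeff q e f) (word_tensor (xs @ d # e # f # ys)) +
      scale (swap_coeff e f) (word_tensor (xs @ d # f # e # ys))"
    and el: "Eop l (word_tensor (xs @ d # e # f # ys)) =
      (if snd e = snd f then word_tensor (xs @ d # e # f # ys) else 0)" for d e f
    using act_adjacent_word[of q xs d e "f # ys"] act_adjacent_word[of q "xs @ [d]" e f ys]
    unfolding K[symmetric] L[symmetric] by (simp_all del: act_gen.simps)
  note lin = linear_opD(1-3)[OF linear_op_act_gen]
  let ?T = "\<lambda>d e f. word_tensor (xs @ d # e # f # ys) :: 's tensor"
  show "Gop k (Gop l (Gop k (word_tensor w))) = Gop l (Gop k (Gop l (word_tensor w)))"
  proof (rule poly_mapping_eqI)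
    fix x
    \<comment> \<open>Comparing the coefficients of one word at a time turns an equation of tensors
      into one in the commutative ground ring, where \<open>algebra_simps\<close> can decide
      it.\<close>
    define t where "t d e f = Poly_Mapping.lookup (?T d e f) x" for d e f
    show "Poly_Mapping.lookup (Gop k (Gop l (Gop k (word_tensor w)))) x =
        Poly_Mapping.lookup (Gop l (Gop k (Gop l (word_tensor w)))) x"
    proof (cases "snd a = snd b \<and> snd b = snd c")
      case True
      obtain i j m s where "a = (i, s)" "b = (j, s)" "c = (m, s)"
        using True by (metis prod.collapse)
      then show ?thesis
        unfolding w gk gl lin lookup_add lookup_scale t_def[symmetric]
        by (cases i j rule: linorder_cases; cases j m rule: linorder_cases;
            cases i m rule: linorder_cases)
          (simp_all add: stay_coeff_def swap_coeff_def unit_inv_eq[OF unit] algebra_simps unit unit_left)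
    next
      case False
      then show ?thesis
        unfolding w gk gl lin lookup_add lookup_scale t_def[symmetric]
        by (cases "snd a = snd b"; cases "snd b = snd c"; cases "snd a = snd c")
          (simp_all add: coeff_diff_component)
    qed
  qed
  show "Gop k (Gop l (Eop k (word_tensor w))) = Eop l (Gop k (Gop l (word_tensor w)))"
    "Gop l (Gop k (Eop l (word_tensor w))) = Eop k (Gop l (Gop k (word_tensor w)))"
    "Gop l (Eop l (Eop k (word_tensor w))) = Eop k (Gop l (Eop k (word_tensor w)))"
    "Gop k (Eop k (Eop l (word_tensor w))) = Eop l (Gop k (Eop l (word_tensor w)))"
    "Eop k (Gop l (Eop k (word_tensor w))) = Eop l (Eop k (Gop l (word_tensor w)))"
    "Eop l (Gop k (Eop l (word_tensor w))) = Eop k (Eop l (Gop k (word_tensor w)))"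
    unfolding w
    by (cases "snd a = snd b"; cases "snd b = snd c"; cases "snd a = snd c";
        simp only: gk ek gl el lin coeff_diff_component scale_simps(1-3) if_True if_False
          refl simp_thms add_0_left add_0_right)+
qed

end

lemma length_swap_at [simp]: "length (swap_at k w) = length w"
  by (simp add: swap_at_def)

lemma nth_swap_at:
  assumes "1 \<le> k" "k < length w" "j < length w"
  shows "swap_at k w ! j = (if j = k then w ! (k - 1) else if j = k - 1 then w ! k else w ! j)"
  using assms by (auto simp: swap_at_def nth_list_update)

lemma swap_at_commute:
  assumes "1 \<le> k" "Suc k < l" "l < length w"
  shows "swap_at k (swap_at l w) = swap_at l (swap_at k w)"
  by (rule nth_equalityI) (use assms in \<open>auto simp: nth_swap_at\<close>)

lemma swap_at_swap_at:
  assumes "1 \<le> k" "k < length w"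
  shows "swap_at k (swap_at k w) = w"
  by (rule nth_equalityI) (use assms in \<open>auto simp: nth_swap_at\<close>)

lemma mset_swap_at [simp]:
  assumes "1 \<le> k" "k < length w"
  shows "mset (swap_at k w) = mset w"
  using assms by (simp add: swap_at_def mset_swap)

context bt_unit
begin

lemma far_relations:
  assumes kl: "1 \<le> k" "Suc k < l" "l < length w"
  shows "Gop k (Gop l (word_tensor w)) = Gop l (Gop k (word_tensor w))"
    "Gop k (Eop l (word_tensor w)) = Eop l (Gop k (word_tensor w))"
    "Gop l (Eop k (word_tensor w)) = Eop k (Gop l (word_tensor w))"
proof -
  have k: "k < length w" "1 \<le> l" "l - 1 < length w" using kl by auto
  have ne: "l \<noteq> k" "l - 1 \<noteq> k" "l \<noteq> k - 1" "l - 1 \<noteq> k - 1" using kl by auto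
  have gk: "Gop k (word_tensor v) = scale (stay_coeff q (v ! (k - 1)) (v ! k)) (word_tensor v) +
      scale (swap_coeff (v ! (k - 1)) (v ! k)) (word_tensor (swap_at k v))"
    and gl: "Gop l (word_tensor v) = scale (stay_coeff q (v ! (l - 1)) (v ! l)) (word_tensor v) +
      scale (swap_coeff (v ! (l - 1)) (v ! l)) (word_tensor (swap_at l v))"
    and ek: "Eop k (word_tensor v) = (if snd (v ! (k - 1)) = snd (v ! k) then word_tensor v else 0)"
    and el: "Eop l (word_tensor v) = (if snd (v ! (l - 1)) = snd (v ! l) then word_tensor v else 0)"
    if "length v = length w" for v
    using that kl by (auto simp: act_G_word act_E_word simp del: act_gen.simps)
  have nth: "swap_at l w ! (k - 1) = w ! (k - 1)" "swap_at l w ! k = w ! k"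
    "swap_at k w ! (l - 1) = w ! (l - 1)" "swap_at k w ! l = w ! l"
    using kl k ne by (auto simp: nth_swap_at)
  note lin = linear_opD(1-3)[OF linear_op_act_gen]
  note ops = gk[OF refl] gl[OF refl] ek[OF refl] el[OF refl]
    gk[OF length_swap_at] gl[OF length_swap_at] ek[OF length_swap_at] el[OF length_swap_at]
  show "Gop k (Gop l (word_tensor w)) = Gop l (Gop k (word_tensor w))"
  proof (rule poly_mapping_eqI)
    fix x
    show "Poly_Mapping.lookup (Gop k (Gop l (word_tensor w))) x =
        Poly_Mapping.lookup (Gop l (Gop k (word_tensor w))) x"
      unfolding ops lin nth lookup_add lookup_scale swap_at_commute[OF kl]
      by (simp only: algebra_simps)
  qed
  show "Gop k (Eop l (word_tensor w)) = Eop l (Gop k (word_tensor w))"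
    unfolding ops lin nth by (simp only: ops lin split: if_split) simp
  show "Gop l (Eop k (word_tensor w)) = Eop k (Gop l (word_tensor w))"
    unfolding ops lin nth by (simp only: ops lin split: if_split) simp
qed

lemma same_index_relations:
  assumes k: "1 \<le> k" "k < length w"
  shows "Eop k (Gop k (word_tensor w)) = Gop k (Eop k (word_tensor w))"
    "Eop k (Eop k (word_tensor w)) = Eop k (word_tensor w)"
    "Gop k (Gop k (word_tensor w)) = word_tensor w + scale (q - q') (Gop k (Eop k (word_tensor w)))"
proof -
  define a b where "a = w ! (k - 1)" and "b = w ! k"
  define v where "v = swap_at k w"
  have g: "Gop k (word_tensor w) = scale (stay_coeff q a b) (word_tensor w) +
      scale (swap_coeff a b) (word_tensor v)"
    and e: "Eop k (word_tensor w) = (if snd a = snd b then word_tensor w else 0)"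
    and g': "Gop k (word_tensor v) = scale (stay_coeff q b a) (word_tensor v) +
      scale (swap_coeff b a) (word_tensor w)"
    and e': "Eop k (word_tensor v) = (if snd b = snd a then word_tensor v else 0)"
  proof -
    have "swap_at k w ! (k - 1) = w ! k" "swap_at k w ! k = w ! (k - 1)"
      using k by (auto simp: nth_swap_at)
    then show "Gop k (word_tensor w) = scale (stay_coeff q a b) (word_tensor w) +
        scale (swap_coeff a b) (word_tensor v)"
      "Eop k (word_tensor w) = (if snd a = snd b then word_tensor w else 0)"
      "Gop k (word_tensor v) = scale (stay_coeff q b a) (word_tensor v) +
        scale (swap_coeff b a) (word_tensor w)"
      "Eop k (word_tensor v) = (if snd b = snd a then word_tensor v else 0)"
      unfolding a_def b_def v_def
      using act_G_word[OF k, of q] act_E_word[OF k, of q] act_G_word[of k "swap_at k w" q]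
        act_E_word[of k "swap_at k w" q] k swap_at_swap_at[OF k]
      by (simp_all only: length_swap_at)
  qed
  have same: "word_tensor v = (word_tensor w :: 's tensor)" if "a = b"
    using that k unfolding a_def b_def v_def swap_at_def by (metis list_update_id)
  note lin = linear_opD(1-3)[OF linear_op_act_gen]
  show "Eop k (Gop k (word_tensor w)) = Gop k (Eop k (word_tensor w))"
    unfolding g e lin by (simp add: e e' g lin del: act_gen.simps scale_simps(5))
  show "Eop k (Eop k (word_tensor w)) = Eop k (word_tensor w)"
    by (simp add: e lin del: act_gen.simps)
  show "Gop k (Gop k (word_tensor w)) = word_tensor w + scale (q - q') (Gop k (Eop k (word_tensor w)))"
  proof (cases "snd a = snd b")
    case False
    then have "snd b \<noteq> snd a" by simp
    then show ?thesis
      using False unfolding g lin g' e by (simp add: coeff_diff_component lin del: act_gen.simps)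
  next
    case True
    then obtain i j s where ab: "a = (i, s)" "b = (j, s)" by (metis prod.collapse)
    have if_True': "(if snd a = snd b then word_tensor w else 0) = (word_tensor w :: 's tensor)"
      using True by simp
    show ?thesis
    proof (rule poly_mapping_eqI)
      fix x
      show "Poly_Mapping.lookup (Gop k (Gop k (word_tensor w))) x =
          Poly_Mapping.lookup (word_tensor w + scale (q - q') (Gop k (Eop k (word_tensor w)))) x"
        unfolding e if_True' g lin g' lookup_add lookup_scale
        using same
        by (cases i j rule: linorder_cases)
          (simp_all add: stay_coeff_def swap_coeff_def unit_inv_eq[OF unit] ab algebra_simps unit unit_left)
    qed
  qed
qed

lemma act_relator_word:
  assumes r: "r \<in> bt_relators n q" and w: "length w = n"
  shows "act_free q (word_tensor w) r = 0"
proof -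
  note act = linear_opD(1,4)[OF linear_op_act_free_right] act_free_mult act_free_gens act_free_one
  note lin = linear_opD(2)[OF linear_op_act_gen]
  \<comment> \<open>A condition on the distance of two indices covers both orders, and several
    relators are not symmetric in them, so each order is a separate goal.\<close>
  have dist1: "P i j" if "index_dist i j = 1" "i \<in> {1..<n}" "j \<in> {1..<n}"
    "\<And>k. 1 \<le> k \<Longrightarrow> Suc k < length w \<Longrightarrow> P k (Suc k)"
    "\<And>k. 1 \<le> k \<Longrightarrow> Suc k < length w \<Longrightarrow> P (Suc k) k" for i j P
  proof -
    have "j = Suc i \<or> i = Suc j" using that(1) by (auto simp: index_dist_def)
    then show ?thesis using that w by auto
  qed
  have far: "P i j" if "index_dist i j > 1" "i \<in> {1..<n}" "j \<in> {1..<n}"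
    "\<And>k l. 1 \<le> k \<Longrightarrow> Suc k < l \<Longrightarrow> l < length w \<Longrightarrow> P k l"
    "\<And>k l. 1 \<le> k \<Longrightarrow> Suc k < l \<Longrightarrow> l < length w \<Longrightarrow> P l k" for i j P
  proof -
    have "Suc i < j \<or> Suc j < i" using that(1) by (auto simp: index_dist_def)
    then show ?thesis using that w by auto
  qed
  from r show ?thesis
  proof cases
    case (gg_far i j)
    from gg_far(4,2,3) show ?thesis
      unfolding gg_far(1) act by (rule far) (metis far_relations(1) diff_self)+
  next
    case (ge i)
    then show ?thesis
      unfolding ge(1) act using same_index_relations(1)[of i w] w by simp
  next
    case (braid i j)
    from braid(4,2,3) show ?thesis
      unfolding braid(1) act by (rule dist1) (simp_all only: adjacent_relations diff_self)
  next
    case (egg i j)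
    from egg(4,2,3) show ?thesis
      unfolding egg(1) act by (rule dist1) (simp_all only: adjacent_relations diff_self)
  next
    case (eeg i j)
    from eeg(4,2,3) show ?thesis
      unfolding eeg(1) act by (rule dist1) (simp_all only: adjacent_relations(4,5) diff_self)
  next
    case (ege i j)
    from ege(4,2,3) show ?thesis
      unfolding ege(1) act by (rule dist1) (simp_all only: adjacent_relations(6,7) diff_self)
  next
    case (ee i j)
    then show ?thesis
      unfolding ee(1) act using w
      by (simp add: act_E_word linear_opD(3)[OF linear_op_act_gen] del: act_gen.simps)
  next
    case (ge_far i j)
    from ge_far(4,2,3) show ?thesis
      unfolding ge_far(1) act by (rule far) (simp_all only: far_relations diff_self)
  next
    case (e_idem i)
    then show ?thesis
      unfolding e_idem(1) act using same_index_relations(2)[of i w] w by simp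
  next
    case (quad i)
    then show ?thesis
      unfolding quad(1) act lin using same_index_relations(3)[of i w] w
      by (simp add: unit_inv_eq[OF unit] del: act_gen.simps)
  qed
qed

text \<open>All submodules of tensor space considered here are spans of sets of words, hence
  described by a predicate on words.\<close>

definition supported :: "(basis_index list \<Rightarrow> bool) \<Rightarrow> 's tensor set"
  where "supported P = {v. \<forall>w\<in>Poly_Mapping.keys v. P w}"

text \<open>Invariance under exchanges of neighbouring places suffices for invariance of the span:
  \<open>G\<close> combines a word with its exchanged version, and \<open>E\<close> keeps or kills
  it.\<close>

definition stable :: "(basis_index list \<Rightarrow> bool) \<Rightarrow> bool"
  where "stable P \<longleftrightarrow> (\<forall>w. P w \<longrightarrow> length w = n \<and> (\<forall>k\<in>{1..<n}. P (swap_at k w)))"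

lemma supported_closed:
  "0 \<in> supported P"
  "u \<in> supported P \<Longrightarrow> v \<in> supported P \<Longrightarrow> u + v \<in> supported P"
  "u \<in> supported P \<Longrightarrow> v \<in> supported P \<Longrightarrow> u - v \<in> supported P"
  "u \<in> supported P \<Longrightarrow> scale c u \<in> supported P"
  "P w \<Longrightarrow> Poly_Mapping.single w c \<in> supported P"
proof -
  show "0 \<in> supported P" "P w \<Longrightarrow> Poly_Mapping.single w c \<in> supported P"
    by (auto simp: supported_def)
  show "u \<in> supported P \<Longrightarrow> v \<in> supported P \<Longrightarrow> u + v \<in> supported P"
    using Poly_Mapping.keys_add[of u v] by (auto simp: supported_def)
  show "u \<in> supported P \<Longrightarrow> v \<in> supported P \<Longrightarrow> u - v \<in> supported P"
    using Poly_Mapping.keys_diff[of u v] by (auto simp: supported_def)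
  have "Poly_Mapping.keys (scale c u) \<subseteq> Poly_Mapping.keys u" by (auto simp: in_keys_iff)
  then show "u \<in> supported P \<Longrightarrow> scale c u \<in> supported P" by (auto simp: supported_def)
qed

lemma supported_sum: "(\<And>x. x \<in> S \<Longrightarrow> f x \<in> supported P) \<Longrightarrow> sum f S \<in> supported P"
  by (induction S rule: infinite_finite_induct) (auto simp: supported_closed)

lemma linear_op_supported:
  assumes "linear_op f" "\<And>w. P w \<Longrightarrow> f (word_tensor w) \<in> supported P'" "v \<in> supported P"
  shows "f v \<in> supported P'"
proof -
  have "f v = (\<Sum>w\<in>Poly_Mapping.keys v. scale (Poly_Mapping.lookup v w) (f (word_tensor w)))"
    by (subst poly_mapping_sum_singles) (simp only: linear_opD[OF assms(1)])
  then show ?thesis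
    using assms by (auto intro!: supported_sum supported_closed simp: supported_def[of P])
qed

lemma act_gen_supported:
  assumes P: "stable P" and v: "v \<in> supported P" and k: "k \<in> {1..<n}"
  shows "Gop k v \<in> supported P" "Eop k v \<in> supported P"
proof -
  have w: "length w = n" "P (swap_at k w)" if "P w" for w
    using P that k by (auto simp: stable_def)
  show "Gop k v \<in> supported P"
    by (rule linear_op_supported[OF linear_op_act_gen _ v])
      (use w k in \<open>auto simp: act_G_word simp del: act_gen.simps scale_simps intro!: supported_closed\<close>)
  show "Eop k v \<in> supported P"
    by (rule linear_op_supported[OF linear_op_act_gen _ v])
      (use w k in \<open>auto simp: act_E_word simp del: act_gen.simps intro!: supported_closed\<close>)
qed

lemma act_free_supported:
  assumes P: "stable P" and v: "v \<in> supported P" and p: "p \<in> carrier (free_algebra n)"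
  shows "act_free q v p \<in> supported P"
proof -
  have "fold (act_gen q) xs v \<in> supported P" if "set xs \<subseteq> GenG ` {1..<n} \<union> GenE ` {1..<n}" for xs
    using that v
  proof (induction xs arbitrary: v)
    case (Cons x xs)
    then have "act_gen q x v \<in> supported P"
      using act_gen_supported[OF P] by (auto simp del: act_gen.simps atLeastLessThan_iff)
    then show ?case using Cons by simp
  qed simp
  then show ?thesis
    using p unfolding act_free_def lin_ext_def free_algebra_def
    by (auto intro!: supported_sum supported_closed)
qed

lemma linear_op_zero_on_supported:
  assumes "linear_op f" "\<And>w. P w \<Longrightarrow> f (word_tensor w) = 0" "v \<in> supported P"
  shows "f v = 0"
  by (rule linear_op_eqI[of f "\<lambda>_. 0"]) (use assms in \<open>auto simp: supported_def\<close>)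

lemma stable_length: "stable (\<lambda>w. length w = n)"
  by (simp add: stable_def)

text \<open>The elements annihilating all words of length \<open>n\<close> form a two-sided ideal,
  because the span of these words is invariant, and this ideal contains the relators.\<close>

lemma act_bt_ideal:
  assumes p: "p \<in> bt_ideal n q" and v: "v \<in> supported (\<lambda>w. length w = n)"
  shows "act_free q v p = 0"
proof -
  let ?V = "supported (\<lambda>w. length w = n)"
  define K where "K = {p \<in> carrier (free_algebra n). \<forall>v\<in>?V. act_free q v p = 0}"
  have closed: "act_free q v p \<in> ?V" if "v \<in> ?V" "p \<in> carrier (free_algebra n)" for v p
    by (rule act_free_supported[OF stable_length that])
  interpret F: ring "free_algebra n :: 's bt_free ring" by (rule ring_free_algebra)
  have neg: "\<ominus>\<^bsub>free_algebra n\<^esub> p = - p" if "p \<in> carrier (free_algebra n)" for p :: "'s bt_free"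
    using that by (intro F.minus_equality) (auto simp: free_algebra_def)
  note lin = linear_opD[OF linear_op_act_free_right]
  have "ideal K (free_algebra n)"
  proof (rule idealI)
    show "ring (free_algebra n :: 's bt_free ring)" by (rule ring_free_algebra)
    show "subgroup K (add_monoid (free_algebra n))"
    proof
      fix p assume "p \<in> K"
      moreover have "act_free q v (- p) = - act_free q v p" for v
        using lin(4)[of q v 0 p] lin(3)[of q v] by simp
      ultimately have "- p \<in> K"
        using free_algebra_closed(3)[of 0 n p] F.zero_closed by (simp add: K_def)
      then show "inv\<^bsub>add_monoid (free_algebra n)\<^esub> p \<in> K"
        using neg[of p] \<open>p \<in> K\<close> by (simp add: K_def a_inv_def)
    qed (use F.zero_closed in \<open>auto simp: K_def lin\<close>)
  qed (auto simp: K_def act_free_mult closed linear_opD(3)[OF linear_op_act_free_left])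
  moreover have "bt_relators n q \<subseteq> K"
    using bt_relators_subset
    by (auto simp: K_def intro!: linear_op_zero_on_supported[OF linear_op_act_free_left act_relator_word])
  ultimately have "bt_ideal n q \<subseteq> K"
    unfolding bt_ideal_def by (rule ring.genideal_minimal[OF ring_free_algebra])
  then show ?thesis using p v by (auto simp: K_def)
qed

section \<open>The action of the quotient algebra on tensors\<close>

abbreviation class_act :: "'s tensor \<Rightarrow> 's bt_free set \<Rightarrow> 's tensor"  (infixl "\<star>" 70)
  where "v \<star> a \<equiv> the_elem (act_free q v ` a)"

lemma ract_class:
  assumes v: "v \<in> supported (\<lambda>w. length w = n)"
  shows "v \<star> bt_class n q p = act_free q v p"
proof -
  have "act_free q v x = act_free q v p" if "x \<in> bt_class n q p" for x
    using act_bt_ideal[OF _ v, of "x - p"] that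
    by (simp add: bt_class_mem_iff linear_opD(4)[OF linear_op_act_free_right])
  moreover have "0 \<in> bt_ideal n q"
    using additive_subgroup.zero_closed[OF ideal.axioms(1)[OF ideal_bt_ideal], of n q] by simp
  then have "p \<in> bt_class n q p"
    unfolding bt_class_mem_iff by simp
  ultimately have "act_free q v ` bt_class n q p = {act_free q v p}"
    by (metis (no_types, lifting) image_constant image_cong)
  then show ?thesis by simp
qed

lemma ract_one: "v \<in> supported (\<lambda>w. length w = n) \<Longrightarrow> v \<star> \<one>\<^bsub>Q\<^esub> = v"
  using ract_class[of v 1] by (simp add: act_free_one)

lemma ract_zero: "v \<in> supported (\<lambda>w. length w = n) \<Longrightarrow> v \<star> \<zero>\<^bsub>Q\<^esub> = 0"
  unfolding bt_class_zero[symmetric] using ract_class[of v 0]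
  by (simp add: linear_opD(3)[OF linear_op_act_free_right])

lemma ract_smult:
  assumes v: "v \<in> supported (\<lambda>w. length w = n)" and a: "a \<in> carrier Q"
  shows "v \<star> (bt_class n q (free_const c) \<otimes>\<^bsub>Q\<^esub> a) = scale c (v \<star> a)"
proof -
  obtain p where p: "p \<in> carrier (free_algebra n)" "a = bt_class n q p"
    using bt_class_surj[OF a] .
  have "act_free q (scale c v) p = scale c (act_free q v p)"
    by (rule linear_opD(2)[OF linear_op_act_free_left])
  then show ?thesis
    using p by (simp add: ract_class[OF v] act_free_mult act_free_gens flip: bt_class_arith)
qed

lemma ract_simps:
  assumes v: "v \<in> supported (\<lambda>w. length w = n)" and a: "a \<in> carrier Q" and b: "b \<in> carrier Q"
  shows "v \<star> (a \<oplus>\<^bsub>Q\<^esub> b) = v \<star> a + v \<star> b" "v \<star> (a \<otimes>\<^bsub>Q\<^esub> b) = (v \<star> a) \<star> b"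
proof -
  obtain p where p: "p \<in> carrier (free_algebra n)" "a = bt_class n q p"
    using bt_class_surj[OF a] .
  obtain p' where p': "p' \<in> carrier (free_algebra n)" "b = bt_class n q p'"
    using bt_class_surj[OF b] .
  have vp: "act_free q v p \<in> supported (\<lambda>w. length w = n)"
    by (rule act_free_supported[OF stable_length v p(1)])
  show "v \<star> (a \<oplus>\<^bsub>Q\<^esub> b) = v \<star> a + v \<star> b" "v \<star> (a \<otimes>\<^bsub>Q\<^esub> b) = (v \<star> a) \<star> b"
    using p p' by (simp_all add: ract_class[OF v] ract_class[OF vp] act_free_mult
        linear_opD[OF linear_op_act_free_right] flip: bt_class_arith)
qed

lemma ract_left:
  assumes u: "u \<in> supported (\<lambda>w. length w = n)" and v: "v \<in> supported (\<lambda>w. length w = n)"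
    and a: "a \<in> carrier Q"
  shows "(u + v) \<star> a = u \<star> a + v \<star> a" "scale c v \<star> a = scale c (v \<star> a)"
proof -
  obtain p where p: "p \<in> carrier (free_algebra n)" "a = bt_class n q p"
    using bt_class_surj[OF a] .
  show "(u + v) \<star> a = u \<star> a + v \<star> a" "scale c v \<star> a = scale c (v \<star> a)"
    unfolding p ract_class[OF u] ract_class[OF v] ract_class[OF supported_closed(2)[OF u v]]
      ract_class[OF supported_closed(4)[OF v]]
    by (rule linear_opD[OF linear_op_act_free_left])+
qed

lemma ract_gens:
  assumes v: "v \<in> supported (\<lambda>w. length w = n)"
  shows "v \<star> bt_g n q i = Gop i v" "v \<star> bt_e n q i = Eop i v"
  unfolding bt_g_def bt_e_def ract_class[OF v] act_free_gens by (rule refl)+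

lemma ract_supported:
  assumes P: "stable P" and v: "v \<in> supported P" and a: "a \<in> carrier Q"
  shows "v \<star> a \<in> supported P"
proof -
  obtain p where p: "p \<in> carrier (free_algebra n)" "a = bt_class n q p"
    using bt_class_surj[OF a] .
  have "v \<in> supported (\<lambda>w. length w = n)" using P v by (auto simp: supported_def stable_def)
  then show ?thesis
    using act_free_supported[OF P v p(1)] by (simp add: p(2) ract_class)
qed

end

section \<open>Tableaux and words\<close>

text \<open>A discrete intermediate value statement. Applied to partial sums it locates the
  component and the row that contain a given entry.\<close>

lemma exists_step:
  fixes f :: "nat \<Rightarrow> nat"
  assumes "f 0 < j" "j \<le> f m"
  shows "\<exists>i\<in>{1..m}. f (i - 1) < j \<and> j \<le> f i"
  using assms(2)
proof (induction m)
  case 0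
  then show ?case using assms(1) by simp
next
  case (Suc m)
  show ?case
  proof (cases "j \<le> f m")
    case True
    then show ?thesis using Suc by force
  next
    case False
    then show ?thesis using Suc.prems by (intro bexI[of _ "Suc m"]) auto
  qed
qed

lemma sum_list_take_Suc:
  "i < length xs \<Longrightarrow> sum_list (take (Suc i) xs) = sum_list (take i xs) + (xs ! i :: nat)"
  by (simp add: take_Suc_conv_app_nth)

lemma sum_list_take_mono:
  "i \<le> k \<Longrightarrow> sum_list (take i xs) \<le> sum_list (take k (xs :: nat list))"
proof (induction k rule: dec_induct)
  case (step k)
  then show ?case
    by (cases "k < length xs") (simp_all add: sum_list_take_Suc)
qed simp

lemma sum_list_take_le: "sum_list (take i xs) \<le> sum_list (xs :: nat list)"
  using sum_list_take_mono[of i "max i (length xs)" xs] by simp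

section \<open>The initial tableau\<close>

abbreviation comp_offset :: "nat list list \<Rightarrow> nat \<Rightarrow> nat"
  where "comp_offset \<nu> p \<equiv> sum_list (take p (map sum_list \<nu>))"

lemma initial_tableau_node:
  assumes "(x, y, p) \<in> diagram \<nu>"
  shows "initial_tableau \<nu> (x, y, p) =
    comp_offset \<nu> (p - 1) + (sum_list (take (x - 1) (\<nu> ! (p - 1))) + y)"
  using assms by (simp add: initial_tableau_def take_map)

text \<open>The rows and the components of the initial tableau occupy consecutive intervals,
  delimited by partial sums.\<close>

lemma node_bounds:
  assumes "(x, y, p) \<in> diagram \<nu>"
  shows "comp_offset \<nu> (p - 1) + sum_list (take (x - 1) (\<nu> ! (p - 1))) < initial_tableau \<nu> (x, y, p)"
    "initial_tableau \<nu> (x, y, p) \<le> comp_offset \<nu> (p - 1) + sum_list (take x (\<nu> ! (p - 1)))"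
    "initial_tableau \<nu> (x, y, p) \<le> comp_offset \<nu> p"
proof -
  have p: "p - 1 < length \<nu>" "Suc (p - 1) = p"
    and x: "x - 1 < length (\<nu> ! (p - 1))" "Suc (x - 1) = x"
    and y: "1 \<le> y" "y \<le> \<nu> ! (p - 1) ! (x - 1)"
    using assms by (auto simp: diagram_def)
  show "comp_offset \<nu> (p - 1) + sum_list (take (x - 1) (\<nu> ! (p - 1))) < initial_tableau \<nu> (x, y, p)"
    unfolding initial_tableau_node[OF assms] using y by simp
  show le: "initial_tableau \<nu> (x, y, p) \<le> comp_offset \<nu> (p - 1) + sum_list (take x (\<nu> ! (p - 1)))"
    unfolding initial_tableau_node[OF assms] using sum_list_take_Suc[OF x(1)] x(2) y by simp
  have "comp_offset \<nu> p = comp_offset \<nu> (p - 1) + sum_list (\<nu> ! (p - 1))"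
    using sum_list_take_Suc[of "p - 1" "map sum_list \<nu>"] p by simp
  then show "initial_tableau \<nu> (x, y, p) \<le> comp_offset \<nu> p"
    using le sum_list_take_le[of x "\<nu> ! (p - 1)"] by simp
qed

lemma initial_tableau_less:
  assumes u: "(x, y, p) \<in> diagram \<nu>" and v: "(x', y', p') \<in> diagram \<nu>"
    and less: "p < p' \<or> p = p' \<and> (x < x' \<or> x = x' \<and> y < y')"
  shows "initial_tableau \<nu> (x, y, p) < initial_tableau \<nu> (x', y', p')"
proof -
  consider "p < p'" | "p = p'" "x < x'" | "p = p'" "x = x'" "y < y'" using less by auto
  then show ?thesis
  proof cases
    case 1
    have "initial_tableau \<nu> (x, y, p) \<le> comp_offset \<nu> p" by (rule node_bounds[OF u])
    also have "\<dots> \<le> comp_offset \<nu> (p' - 1)" using 1 by (intro sum_list_take_mono) auto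
    also have "\<dots> < initial_tableau \<nu> (x', y', p')" using node_bounds(1)[OF v] by simp
    finally show ?thesis .
  next
    case 2
    have "sum_list (take x (\<nu> ! (p - 1))) \<le> sum_list (take (x' - 1) (\<nu> ! (p - 1)))"
      using 2 by (intro sum_list_take_mono) auto
    then show ?thesis using node_bounds(2)[OF u] node_bounds(1)[OF v] 2 by simp
  next
    case 3
    then show ?thesis unfolding initial_tableau_node[OF u] initial_tableau_node[OF v] by simp
  qed
qed

lemma initial_tableau_in_tableaux:
  assumes sz: "sum_list (map sum_list \<nu>) = n"
  shows "initial_tableau \<nu> \<in> tableaux n \<nu>"
proof -
  have "inj_on (initial_tableau \<nu>) (diagram \<nu>)"
  proof (rule inj_onI)
    fix u v assume u: "u \<in> diagram \<nu>" and v: "v \<in> diagram \<nu>"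
      and eq: "initial_tableau \<nu> u = initial_tableau \<nu> v"
    obtain x y p where u': "u = (x, y, p)" by (cases u)
    obtain x' y' p' where v': "v = (x', y', p')" by (cases v)
    have "\<not> (p < p' \<or> p = p' \<and> (x < x' \<or> x = x' \<and> y < y'))"
      "\<not> (p' < p \<or> p' = p \<and> (x' < x \<or> x' = x \<and> y' < y))"
      using initial_tableau_less[OF u[unfolded u'] v[unfolded v']]
        initial_tableau_less[OF v[unfolded v'] u[unfolded u']] eq u' v' by auto
    then show "u = v" using u' v' by auto
  qed
  moreover have "initial_tableau \<nu> ` diagram \<nu> = {1..n}"
  proof
    show "initial_tableau \<nu> ` diagram \<nu> \<subseteq> {1..n}"
    proof clarify
      fix x y p assume u: "(x, y, p) \<in> diagram \<nu>"
      have "comp_offset \<nu> p \<le> n" using sum_list_take_le[of p "map sum_list \<nu>"] sz by simp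
      then show "initial_tableau \<nu> (x, y, p) \<in> {1..n}"
        using node_bounds(1,3)[OF u] by simp
    qed
    show "{1..n} \<subseteq> initial_tableau \<nu> ` diagram \<nu>"
    proof
      fix j assume j: "j \<in> {1..n}"
      have "comp_offset \<nu> (length \<nu>) = n" using sz by simp
      \<comment> \<open>The component is found from the partial sums of the component sizes, the row
        from those of the row lengths inside it, and the column \<open>y\<close> is the
        remainder.\<close>
      then obtain p where p: "p \<in> {1..length \<nu>}" "comp_offset \<nu> (p - 1) < j" "j \<le> comp_offset \<nu> p"
        using exists_step[of "comp_offset \<nu>" j "length \<nu>"] j by auto
      define \<mu> where "\<mu> = \<nu> ! (p - 1)"
      have "comp_offset \<nu> p = comp_offset \<nu> (p - 1) + sum_list \<mu>"
        using sum_list_take_Suc[of "p - 1" "map sum_list \<nu>"] p(1) by (cases p) (simp_all add: \<mu>_def)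
      then have "j - comp_offset \<nu> (p - 1) \<le> sum_list (take (length \<mu>) \<mu>)" using p by simp
      then obtain x where x: "x \<in> {1..length \<mu>}"
        "sum_list (take (x - 1) \<mu>) < j - comp_offset \<nu> (p - 1)"
        "j - comp_offset \<nu> (p - 1) \<le> sum_list (take x \<mu>)"
        using exists_step[of "\<lambda>x. sum_list (take x \<mu>)" "j - comp_offset \<nu> (p - 1)" "length \<mu>"] p
        by (auto simp del: One_nat_def)
      define y where "y = j - comp_offset \<nu> (p - 1) - sum_list (take (x - 1) \<mu>)"
      have "sum_list (take x \<mu>) = sum_list (take (x - 1) \<mu>) + \<mu> ! (x - 1)"
        using sum_list_take_Suc[of "x - 1" \<mu>] x(1) by (cases x) simp_all
      then have "1 \<le> y" "y \<le> \<mu> ! (x - 1)" using x unfolding y_def by linarith+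
      then have u: "(x, y, p) \<in> diagram \<nu>"
        using p(1) x(1) by (auto simp: diagram_def \<mu>_def)
      have "j = comp_offset \<nu> (p - 1) + (sum_list (take (x - 1) \<mu>) + y)"
        unfolding y_def using x(2) p(2) by linarith
      then have "j = initial_tableau \<nu> (x, y, p)"
        by (simp add: initial_tableau_node[OF u] \<mu>_def)
      then show "j \<in> initial_tableau \<nu> ` diagram \<nu>" using u by blast
    qed
  qed
  ultimately show ?thesis
    by (simp add: tableaux_def bij_betw_def initial_tableau_def)
qed

lemma position_eqI:
  assumes t: "t \<in> tableaux n \<nu>" and u: "(x, y, p) \<in> diagram \<nu>"
  shows "position \<nu> t (t (x, y, p)) = (x, p)"
proof -
  have inj: "inj_on t (diagram \<nu>)" using t by (simp add: tableaux_def bij_betw_def)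
  show ?thesis
    unfolding position_def
  proof (rule the_equality)
    show "case (x, p) of (x', p') \<Rightarrow> \<exists>y'. (x', y', p') \<in> diagram \<nu> \<and> t (x', y', p') = t (x, y, p)"
      using u by auto
    fix a assume "case a of (x', p') \<Rightarrow> \<exists>y'. (x', y', p') \<in> diagram \<nu> \<and> t (x', y', p') = t (x, y, p)"
    then show "a = (x, p)" using inj_onD[OF inj _ _ u] by (cases a) fastforce
  qed
qed

lemma position_iff:
  assumes t: "t \<in> tableaux n \<nu>" and j: "j \<in> {1..n}"
  shows "position \<nu> t j = (x, p) \<longleftrightarrow> (\<exists>y. (x, y, p) \<in> diagram \<nu> \<and> t (x, y, p) = j)"
proof -
  have "j \<in> t ` diagram \<nu>" using t j by (simp add: tableaux_def bij_betw_def)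
  then obtain x' y' p' where u: "(x', y', p') \<in> diagram \<nu>" "j = t (x', y', p')" by auto
  show ?thesis
  proof
    assume "position \<nu> t j = (x, p)"
    then show "\<exists>y. (x, y, p) \<in> diagram \<nu> \<and> t (x, y, p) = j"
      using position_eqI[OF t u(1)] u by auto
  next
    assume "\<exists>y. (x, y, p) \<in> diagram \<nu> \<and> t (x, y, p) = j"
    then show "position \<nu> t j = (x, p)" using position_eqI[OF t] by blast
  qed
qed

abbreviation initial_pos :: "nat list list \<Rightarrow> nat \<Rightarrow> basis_index"
  where "initial_pos \<nu> \<equiv> position \<nu> (initial_tableau \<nu>)"

text \<open>Entries grow along the lexicographic order by component, row and column. In consequence
  the indices with a given position form an interval, and within a component larger indices do not
  lie in earlier rows.\<close>

lemma initial_pos_mono: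
  assumes sz: "sum_list (map sum_list \<nu>) = n" and j: "j \<in> {1..n}" "k \<in> {1..n}" "j \<le> k"
  shows "snd (initial_pos \<nu> j) < snd (initial_pos \<nu> k) \<or>
    snd (initial_pos \<nu> j) = snd (initial_pos \<nu> k) \<and> fst (initial_pos \<nu> j) \<le> fst (initial_pos \<nu> k)"
proof -
  note t = initial_tableau_in_tableaux[OF sz]
  obtain x p where xp: "initial_pos \<nu> j = (x, p)" by (cases "initial_pos \<nu> j")
  obtain x' p' where xp': "initial_pos \<nu> k = (x', p')" by (cases "initial_pos \<nu> k")
  obtain y where u: "(x, y, p) \<in> diagram \<nu>" "initial_tableau \<nu> (x, y, p) = j"
    using position_iff[OF t j(1)] xp by auto
  obtain y' where v: "(x', y', p') \<in> diagram \<nu>" "initial_tableau \<nu> (x', y', p') = k"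
    using position_iff[OF t j(2)] xp' by auto
  have "\<not> (p' < p \<or> p' = p \<and> x' < x)"
    using initial_tableau_less[OF v(1) u(1)] u v j(3) by auto
  then show ?thesis using xp xp' by auto
qed

lemma initial_row_eq:
  assumes sz: "sum_list (map sum_list \<nu>) = n"
  shows "initial_row \<nu> x p = {j\<in>{1..n}. initial_pos \<nu> j = (x, p)}"
proof -
  note t = initial_tableau_in_tableaux[OF sz]
  have "initial_tableau \<nu> u \<in> {1..n}" if "u \<in> diagram \<nu>" for u
    using t that by (auto simp: tableaux_def bij_betw_def simp del: atLeastAtMost_iff)
  then show ?thesis
    using position_iff[OF t, of _ x p] unfolding initial_row_def by fast
qed

lemma initial_component_eq:
  assumes sz: "sum_list (map sum_list \<nu>) = n"
  shows "initial_component \<nu> p = {j\<in>{1..n}. snd (initial_pos \<nu> j) = p}"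
proof -
  have "initial_component \<nu> p = (\<Union>x. initial_row \<nu> x p)"
    by (auto simp: initial_component_def initial_row_def)
  then show ?thesis unfolding initial_row_eq[OF sz] by (auto simp: prod_eq_iff)
qed

lemma initial_pos_component:
  assumes sz: "sum_list (map sum_list \<nu>) = n" and j: "j \<in> {1..n}"
  shows "snd (initial_pos \<nu> j) \<in> {1..length \<nu>}"
proof -
  obtain x p where xp: "initial_pos \<nu> j = (x, p)" by (cases "initial_pos \<nu> j")
  then show ?thesis
    using position_iff[OF initial_tableau_in_tableaux[OF sz] j, of x p] by (auto simp: diagram_def)
qed

lemma comp_partition_eq:
  assumes sz: "sum_list (map sum_list \<nu>) = n"
  shows "comp_partition \<nu> = fibre_partition n (snd \<circ> initial_pos \<nu>)"
proof
  show "comp_partition \<nu> \<subseteq> fibre_partition n (snd \<circ> initial_pos \<nu>)"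
  proof
    fix b assume "b \<in> comp_partition \<nu>"
    then obtain p where b: "b = {j\<in>{1..n}. snd (initial_pos \<nu> j) = p}" "b \<noteq> {}"
      unfolding comp_partition_def initial_component_eq[OF sz] by blast
    then obtain j where "j \<in> {1..n}" "snd (initial_pos \<nu> j) = p" by blast
    then show "b \<in> fibre_partition n (snd \<circ> initial_pos \<nu>)"
      using b unfolding fibre_partition_def by (intro image_eqI[of _ _ j]) auto
  qed
  show "fibre_partition n (snd \<circ> initial_pos \<nu>) \<subseteq> comp_partition \<nu>"
  proof
    fix b assume "b \<in> fibre_partition n (snd \<circ> initial_pos \<nu>)"
    then obtain j where j: "j \<in> {1..n}" "b = {k\<in>{1..n}. snd (initial_pos \<nu> k) = snd (initial_pos \<nu> j)}"
      by (auto simp: fibre_partition_def)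
    then show "b \<in> comp_partition \<nu>"
      using initial_pos_component[OF sz j(1)]
      unfolding comp_partition_def initial_component_eq[OF sz] by blast
  qed
qed

text \<open>Preserving positions pointwise maps each row into itself; since rows are finite and
  \<open>w\<close> is injective, it maps them onto themselves.\<close>

lemma row_stabilizer_eq:
  assumes sz: "sum_list (map sum_list \<nu>) = n"
  shows "row_stabilizer n \<nu> = {w. w permutes {1..n} \<and> (\<forall>j\<in>{1..n}. initial_pos \<nu> (w j) = initial_pos \<nu> j)}"
proof -
  let ?c = "initial_pos \<nu>"
  have "(\<forall>x p. w ` initial_row \<nu> x p = initial_row \<nu> x p) \<longleftrightarrow> (\<forall>j\<in>{1..n}. ?c (w j) = ?c j)"
    if w: "w permutes {1..n}" for w
  proof
    assume *: "\<forall>x p. w ` initial_row \<nu> x p = initial_row \<nu> x p"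
    show "\<forall>j\<in>{1..n}. ?c (w j) = ?c j"
    proof
      fix j assume j: "j \<in> {1..n}"
      obtain x p where xp: "?c j = (x, p)" by (cases "?c j")
      then have "j \<in> initial_row \<nu> x p" using j unfolding initial_row_eq[OF sz] by blast
      then have "w j \<in> initial_row \<nu> x p" using * by blast
      then show "?c (w j) = ?c j" using xp unfolding initial_row_eq[OF sz] by simp
    qed
  next
    assume *: "\<forall>j\<in>{1..n}. ?c (w j) = ?c j"
    show "\<forall>x p. w ` initial_row \<nu> x p = initial_row \<nu> x p"
    proof (intro allI)
      fix x p
      have "w ` initial_row \<nu> x p \<subseteq> initial_row \<nu> x p"
        unfolding initial_row_eq[OF sz] using * permutes_in_image[OF w] by auto
      moreover have "finite (initial_row \<nu> x p)" unfolding initial_row_eq[OF sz] by simp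
      moreover have "inj_on w (initial_row \<nu> x p)" using permutes_inj_on[OF w] .
      ultimately show "w ` initial_row \<nu> x p = initial_row \<nu> x p"
        by (simp add: card_image card_subset_eq)
    qed
  qed
  then show ?thesis unfolding row_stabilizer_def by blast
qed

section \<open>Permutations attached to tableaux and to words\<close>

lemma tableau_perm:
  assumes sz: "sum_list (map sum_list \<nu>) = n" and t: "t \<in> tableaux n \<nu>"
  shows "tableau_perm n \<nu> t permutes {1..n}"
    and "u \<in> diagram \<nu> \<Longrightarrow> t u = tableau_perm n \<nu> t (initial_tableau \<nu> u)"
proof -
  let ?t0 = "initial_tableau \<nu>"
  have t0: "bij_betw ?t0 (diagram \<nu>) {1..n}"
    using initial_tableau_in_tableaux[OF sz] by (simp add: tableaux_def)
  have tb: "bij_betw t (diagram \<nu>) {1..n}" using t by (simp add: tableaux_def)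
  let ?P = "\<lambda>w. w permutes {1..n} \<and> (\<forall>u\<in>diagram \<nu>. t u = w (?t0 u))"
  define w where "w j = (if j \<in> {1..n} then t (the_inv_into (diagram \<nu>) ?t0 j) else j)" for j
  have "bij_betw (\<lambda>j. t (the_inv_into (diagram \<nu>) ?t0 j)) {1..n} {1..n}"
    using bij_betw_trans[OF bij_betw_the_inv_into[OF t0] tb] by (simp add: comp_def)
  then have "bij_betw w {1..n} {1..n}"
    by (rule bij_betw_cong[THEN iffD1, rotated]) (simp add: w_def)
  then have "w permutes {1..n}" by (rule bij_imp_permutes) (simp only: w_def if_False)
  moreover have "t u = w (?t0 u)" if "u \<in> diagram \<nu>" for u
  proof -
    have "?t0 u \<in> {1..n}" using t0 that by (auto simp: bij_betw_def simp del: atLeastAtMost_iff)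
    moreover have "the_inv_into (diagram \<nu>) ?t0 (?t0 u) = u"
      using t0 that by (intro the_inv_into_f_f) (auto simp: bij_betw_def)
    ultimately show ?thesis by (simp add: w_def)
  qed
  ultimately have w: "?P w" by blast
  have "v = w" if "?P v" for v
  proof
    fix j
    show "v j = w j"
    proof (cases "j \<in> {1..n}")
      case True
      then have "j \<in> ?t0 ` diagram \<nu>" using t0 by (simp add: bij_betw_def)
      then obtain u where "u \<in> diagram \<nu>" "j = ?t0 u" by blast
      then show ?thesis using that w by metis
    next
      case False
      then show ?thesis using that w by (metis permutes_not_in)
    qed
  qed
  with w have "?P (tableau_perm n \<nu> t)"
    unfolding tableau_perm_def by (rule theI)
  then show "tableau_perm n \<nu> t permutes {1..n}"
    "u \<in> diagram \<nu> \<Longrightarrow> t u = tableau_perm n \<nu> t (initial_tableau \<nu> u)" by blast+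
qed

text \<open>The standardization of the word \<open>b\<close>, a rearrangement of \<open>c\<close>:
  equal letters are numbered from left to right. It selects the coset representative that increases
  along the fibres of \<open>c\<close>.\<close>

definition standardizes :: "nat \<Rightarrow> (nat \<Rightarrow> 'b) \<Rightarrow> 'b list \<Rightarrow> (nat \<Rightarrow> nat) \<Rightarrow> bool"
  where "standardizes n c b d \<longleftrightarrow> length b = n \<and> d permutes {1..n} \<and> (\<forall>j\<in>{1..n}. b ! (d j - 1) = c j) \<and>
    (\<forall>j\<in>{1..n}. \<forall>k\<in>{1..n}. j < k \<and> c j = c k \<longrightarrow> d j < d k)"

text \<open>Let \<open>k\<close> be the first index where \<open>e' k > e k\<close>. The place
  \<open>e k\<close> is hit under \<open>e'\<close> by some \<open>m\<close> with the same letter.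
  Agreement below \<open>k\<close> excludes \<open>m < k\<close>, and \<open>m > k\<close>
  contradicts the increase of \<open>e'\<close> along equal letters.\<close>

lemma standardizes_unique:
  assumes d: "standardizes n c b d" and d': "standardizes n c b d'"
  shows "d = d'"
proof
  fix j
  show "d j = d' j"
  proof (induction j rule: less_induct)
    case (less k)
    have perm: "d permutes {1..n}" "d' permutes {1..n}"
      using d d' by (auto simp: standardizes_def)
    have key: "e' k \<le> e k"
      if e: "standardizes n c b e" and e': "standardizes n c b e'" and k: "k \<in> {1..n}"
        and below: "\<And>y. y < k \<Longrightarrow> e y = e' y" for e e'
    proof (rule ccontr)
      assume less: "\<not> e' k \<le> e k"
      have pe: "e permutes {1..n}" "e' permutes {1..n}" using e e' by (auto simp: standardizes_def)
      define m where "m = pinv e' (e k)"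
      have m: "e' m = e k" "m \<in> {1..n}"
        using permutes_inverses(1)[OF pe(2)] permutes_in_image[OF permutes_inv[OF pe(2)]]
          permutes_in_image[OF pe(1)] k unfolding m_def by auto
      have "c m = c k" using e e' m k unfolding standardizes_def by metis
      have "m \<noteq> k" using m less by auto
      moreover have "\<not> m < k"
      proof
        assume "m < k"
        then have "e m = e k" using below m by metis
        then show False using \<open>m < k\<close> permutes_inj[OF pe(1)] by (metis injD less_irrefl)
      qed
      ultimately have "k < m" by simp
      then have "e' k < e' m" using e' m k \<open>c m = c k\<close> unfolding standardizes_def by metis
      then show False using less m by simp
    qed
    show ?case
    proof (cases "k \<in> {1..n}")
      case True
      show ?thesis
        using key[OF d d' True less] key[OF d' d True less[symmetric]] by simp
    next
      case False
      then show ?thesis using permutes_not_in[OF perm(1)] permutes_not_in[OF perm(2)] by simp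
    qed
  qed
qed

abbreviation tableau_word :: "nat \<Rightarrow> nat list list \<Rightarrow> (nat \<times> nat \<times> nat \<Rightarrow> nat) \<Rightarrow> basis_index list"
  where "tableau_word n \<nu> t \<equiv> map (position \<nu> t) [1..<n+1]"

lemma RStd_standardizes:
  assumes sz: "sum_list (map sum_list \<nu>) = n" and t: "t \<in> RStd n \<nu>"
  shows "standardizes n (initial_pos \<nu>) (tableau_word n \<nu> t) (tableau_perm n \<nu> t)"
proof -
  note t0 = initial_tableau_in_tableaux[OF sz]
  let ?d = "tableau_perm n \<nu> t" and ?c = "initial_pos \<nu>"
  have tt: "t \<in> tableaux n \<nu>" using t by (simp add: RStd_def)
  note d = tableau_perm[OF sz tt]
  have letter: "tableau_word n \<nu> t ! (j - 1) = position \<nu> t j" if "j \<in> {1..n}" for j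
    using that by (auto simp: nth_append nth_upt simp del: upt_Suc)
  have 1: "position \<nu> t (?d j) = ?c j" if j: "j \<in> {1..n}" for j
  proof -
    obtain x p where xp: "?c j = (x, p)" by (cases "?c j")
    obtain y where u: "(x, y, p) \<in> diagram \<nu>" "initial_tableau \<nu> (x, y, p) = j"
      using position_iff[OF t0 j] xp by auto
    then show ?thesis using d(2)[OF u(1)] position_eqI[OF tt u(1)] xp by simp
  qed
  have 2: "?d j < ?d k" if j: "j \<in> {1..n}" "k \<in> {1..n}" "j < k" "?c j = ?c k" for j k
  proof -
    obtain x p where xp: "?c j = (x, p)" by (cases "?c j")
    obtain y where u: "(x, y, p) \<in> diagram \<nu>" "initial_tableau \<nu> (x, y, p) = j"
      using position_iff[OF t0 j(1)] xp by auto
    obtain y' where v: "(x, y', p) \<in> diagram \<nu>" "initial_tableau \<nu> (x, y', p) = k"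
      using position_iff[OF t0 j(2)] xp j(4) by auto
    have "y < y'" using j(3) u v unfolding initial_tableau_node[OF u(1)] initial_tableau_node[OF v(1)]
      by simp
    then have "t (x, y, p) < t (x, y', p)" using t u v unfolding RStd_def by blast
    then show ?thesis using d(2)[OF u(1)] d(2)[OF v(1)] u v by simp
  qed
  have "tableau_word n \<nu> t ! (?d j - 1) = ?c j" if j: "j \<in> {1..n}" for j
    using letter[of "?d j"] 1[OF j] permutes_in_image[OF d(1)] j by simp
  then show ?thesis
    using d(1) 2 unfolding standardizes_def by (auto simp del: upt_Suc)
qed

text \<open>The prescribed multiplicity of a letter, which is the length of the row named by it.
  Extending by 0 beyond the stored rows respects the identification of compositions up to trailing
  zeros.\<close>

definition weight :: "nat list list \<Rightarrow> basis_index \<Rightarrow> nat"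
  where "weight \<nu> = (\<lambda>(x, p). if p \<in> {1..length \<nu>} \<and> x \<in> {1..length (\<nu> ! (p - 1))}
    then \<nu> ! (p - 1) ! (x - 1) else 0)"

definition has_weight :: "nat \<Rightarrow> nat list list \<Rightarrow> basis_index list \<Rightarrow> bool"
  where "has_weight n \<nu> b \<longleftrightarrow> length b = n \<and> count (mset b) = weight \<nu>"

lemma diagram_iff: "(x, y, p) \<in> diagram \<nu> \<longleftrightarrow> y \<in> {1..weight \<nu> (x, p)}"
  by (auto simp: diagram_def weight_def)

lemma count_mset_eq_card:
  assumes "length b = n"
  shows "count (mset b) a = card {j\<in>{1..n}. b ! (j - 1) = a}"
proof -
  have "count (mset b) a = card {i. i < n \<and> b ! i = a}"
    using assms by (simp add: count_mset length_filter_conv_card eq_commute count_list_eq_length_filter)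
  also have "\<dots> = card {j\<in>{1..n}. b ! (j - 1) = a}"
    by (rule bij_betw_same_card[of Suc], rule bij_betw_byWitness[where f' = "\<lambda>j. j - 1"]) auto
  finally show ?thesis .
qed

lemma tableau_word_has_weight:
  assumes t: "t \<in> tableaux n \<nu>"
  shows "has_weight n \<nu> (tableau_word n \<nu> t)"
proof -
  have "count (mset (tableau_word n \<nu> t)) (x, p) = weight \<nu> (x, p)" for x p
  proof -
    have "count (mset (tableau_word n \<nu> t)) (x, p) =
        card {j\<in>{1..n}. tableau_word n \<nu> t ! (j - 1) = (x, p)}"
      by (rule count_mset_eq_card) simp
    also have "{j\<in>{1..n}. tableau_word n \<nu> t ! (j - 1) = (x, p)} = {j\<in>{1..n}. position \<nu> t j = (x, p)}"
      by (auto simp: nth_append simp del: upt_Suc)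
    also have "\<dots> = (\<lambda>y. t (x, y, p)) ` {1..weight \<nu> (x, p)}"
    proof -
      have "t (x, y, p) \<in> {1..n}" if "y \<in> {1..weight \<nu> (x, p)}" for y
        using t that unfolding diagram_iff[symmetric]
        by (auto simp: tableaux_def bij_betw_def simp del: atLeastAtMost_iff)
      then show ?thesis
        using position_iff[OF t, of _ x p, unfolded diagram_iff]
        unfolding set_eq_iff image_iff mem_Collect_eq Bex_def by metis
    qed
    also have "card \<dots> = weight \<nu> (x, p)"
    proof -
      have "inj_on t (diagram \<nu>)" using t by (simp add: tableaux_def bij_betw_def)
      then have "inj_on (\<lambda>y. t (x, y, p)) {1..weight \<nu> (x, p)}"
        unfolding inj_on_def using diagram_iff by blast
      then show ?thesis by (simp add: card_image)
    qed
    finally show ?thesis .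
  qed
  then show ?thesis by (auto simp: has_weight_def simp del: upt_Suc)
qed

text \<open>Row \<open>x\<close> of component \<open>p\<close> is filled, in increasing order, with
  the places at which \<open>b\<close> has the letter \<open>(x, p)\<close>.\<close>

lemma exists_tableau_of_word:
  assumes b: "has_weight n \<nu> b"
  shows "\<exists>t\<in>RStd n \<nu>. tableau_word n \<nu> t = b"
proof -
  define J where "J a = {j\<in>{1..n}. b ! (j - 1) = a}" for a
  define t where "t = (\<lambda>(x, y, p)\<in>diagram \<nu>. sorted_list_of_set (J (x, p)) ! (y - 1))"
  have fin: "finite (J a)" for a by (simp add: J_def)
  have len: "length (sorted_list_of_set (J a)) = weight \<nu> a" for a
    using count_mset_eq_card[of b n a] b by (simp add: has_weight_def J_def)
  have tu: "t (x, y, p) = sorted_list_of_set (J (x, p)) ! (y - 1)" if "(x, y, p) \<in> diagram \<nu>" for x y p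
    using that by (simp add: t_def)
  have mem: "t (x, y, p) \<in> J (x, p)" if u: "(x, y, p) \<in> diagram \<nu>" for x y p
  proof -
    have "y - 1 < length (sorted_list_of_set (J (x, p)))"
      using u len by (auto simp: diagram_iff)
    from nth_mem[OF this] show ?thesis using tu[OF u] fin by simp
  qed
  have less: "t (x, y, p) < t (x, y', p)"
    if u: "(x, y, p) \<in> diagram \<nu>" and v: "(x, y', p) \<in> diagram \<nu>" and "y < y'" for x y y' p
    unfolding tu[OF u] tu[OF v]
    by (rule sorted_wrt_nth_less[OF strict_sorted_list_of_set])
      (use u v that len in \<open>auto simp: diagram_iff\<close>)
  have "inj_on t (diagram \<nu>)"
  proof (rule inj_onI)
    fix u v assume u: "u \<in> diagram \<nu>" and v: "v \<in> diagram \<nu>" and eq: "t u = t v"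
    obtain x y p where u': "u = (x, y, p)" by (cases u)
    obtain x' y' p' where v': "v = (x', y', p')" by (cases v)
    have "(x, p) = (x', p')"
      using mem[of x y p] mem[of x' y' p'] u v eq unfolding u' v' J_def by simp
    moreover have "y = y'"
      using less[of x y p y'] less[of x y' p y] u v eq calculation unfolding u' v'
      by (metis less_irrefl linorder_neqE_nat prod.inject)
    ultimately show "u = v" by (simp add: u' v')
  qed
  moreover have "t ` diagram \<nu> = {1..n}"
  proof
    show "t ` diagram \<nu> \<subseteq> {1..n}" using mem by (auto simp: J_def)
    show "{1..n} \<subseteq> t ` diagram \<nu>"
    proof
      fix j assume j: "j \<in> {1..n}"
      obtain x p where xp: "b ! (j - 1) = (x, p)" by (cases "b ! (j - 1)")
      then have "j \<in> set (sorted_list_of_set (J (x, p)))" using j fin by (simp add: J_def)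
      then obtain i where i: "i < weight \<nu> (x, p)" "sorted_list_of_set (J (x, p)) ! i = j"
        using len by (metis in_set_conv_nth)
      then have "(x, Suc i, p) \<in> diagram \<nu>" by (simp add: diagram_iff)
      moreover have "t (x, Suc i, p) = j" using tu[OF calculation] i by simp
      ultimately show "j \<in> t ` diagram \<nu>" by force
    qed
  qed
  ultimately have tt: "t \<in> tableaux n \<nu>"
    by (simp add: tableaux_def bij_betw_def t_def)
  then have "t \<in> RStd n \<nu>" using less by (simp add: RStd_def)
  moreover have "tableau_word n \<nu> t = b"
  proof (rule nth_equalityI)
    show "length (tableau_word n \<nu> t) = length b" using b by (simp add: has_weight_def)
    fix i assume "i < length (tableau_word n \<nu> t)"
    then have j: "Suc i \<in> {1..n}" by (simp del: upt_Suc)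
    have nth: "tableau_word n \<nu> t ! i = position \<nu> t (Suc i)"
      using j by (auto simp: nth_append simp del: upt_Suc)
    obtain x p where xp: "position \<nu> t (Suc i) = (x, p)" by (cases "position \<nu> t (Suc i)")
    then obtain y where "(x, y, p) \<in> diagram \<nu>" "t (x, y, p) = Suc i"
      using position_iff[OF tt j] by auto
    then have "b ! i = (x, p)" using mem[of x y p] by (simp add: J_def)
    then show "tableau_word n \<nu> t ! i = b ! i" using nth xp by simp
  qed
  ultimately show ?thesis by blast
qed

lemma has_weight_standardizes:
  assumes "sum_list (map sum_list \<nu>) = n" "has_weight n \<nu> b"
  shows "\<exists>d. standardizes n (initial_pos \<nu>) b d"
  using exists_tableau_of_word[OF assms(2)] RStd_standardizes[OF assms(1)] by blast

section \<open>The idempotents on tensor space\<close>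

context bt_unit
begin

abbreviation words :: "'s tensor set"
  where "words \<equiv> supported (\<lambda>w. length w = n)"

text \<open>Words with prescribed components at all places. Their spans are common eigenspaces of
  the idempotents \<open>E\<^sub>i\<^sub>j\<close>, and each \<open>g\<^sub>i\<close> maps one such
  span into another.\<close>

definition comps_of :: "(nat \<Rightarrow> nat) \<Rightarrow> basis_index list \<Rightarrow> bool"
  where "comps_of s w \<longleftrightarrow> length w = n \<and> (\<forall>j\<in>{1..n}. snd (w ! (j - 1)) = s j)"

lemma supported_mono: "(\<And>w. P w \<Longrightarrow> P' w) \<Longrightarrow> supported P \<subseteq> supported P'"
  by (auto simp: supported_def)

lemma supported_comps_of_words: "v \<in> supported (comps_of s) \<Longrightarrow> v \<in> words"
  using supported_mono[of "comps_of s" "\<lambda>w. length w = n"] by (auto simp: comps_of_def)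

lemma comps_of_swap_at:
  assumes "comps_of s w" "i \<in> {1..<n}"
  shows "comps_of (s \<circ> adj i) (swap_at i w)"
proof -
  have "snd (swap_at i w ! (j - 1)) = s (adj i j)" if j: "j \<in> {1..n}" for j
  proof -
    have w: "length w = n" "\<And>j. j \<in> {1..n} \<Longrightarrow> snd (w ! (j - 1)) = s j"
      using assms by (auto simp: comps_of_def)
    have nth: "swap_at i w ! (j - 1) = (if j - 1 = i then w ! (i - 1) else if j - 1 = i - 1 then w ! i else w ! (j - 1))"
      using assms(2) j w(1) by (intro nth_swap_at) auto
    consider "j = i" | "j = Suc i" | "j \<noteq> i" "j \<noteq> Suc i" by blast
    then show ?thesis
    proof cases
      case 1
      then show ?thesis using nth assms(2) w(2)[of "Suc i"] by auto
    next
      case 2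
      then show ?thesis using nth assms(2) w(2)[of i] by auto
    next
      case 3
      then have "j - 1 \<noteq> i" "j - 1 \<noteq> i - 1" using j assms(2) by auto
      then show ?thesis using nth w(2)[OF j] 3 by (simp add: transpose_apply_other)
    qed
  qed
  then show ?thesis using assms by (simp add: comps_of_def)
qed

lemma Gop_comps_of:
  assumes v: "v \<in> supported (comps_of s)" and i: "i \<in> {1..<n}"
  shows "Gop i v \<in> supported (comps_of (s \<circ> adj i))"
proof (rule linear_op_supported[OF linear_op_act_gen _ v])
  fix w assume w: "comps_of s w"
  then have len: "1 \<le> i" "i < length w" using i by (auto simp: comps_of_def)
  have sw: "word_tensor (swap_at i w) \<in> supported (comps_of (s \<circ> adj i))"
    using comps_of_swap_at[OF w i] by (simp add: supported_closed)
  \<comment> \<open>The unexchanged word occurs only if the places \<open>i\<close> and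
    \<open>i + 1\<close> have the same component, and then the prescription \<open>s\<close> is
    unchanged by \<open>adj i\<close>.\<close>
  have stay: "scale (stay_coeff q (w ! (i - 1)) (w ! i)) (word_tensor w) \<in> supported (comps_of (s \<circ> adj i))"
  proof (cases "snd (w ! (i - 1)) = snd (w ! i)")
    case True
    have "snd (w ! (i - 1)) = s i" "snd (w ! i) = s (Suc i)"
      using w i unfolding comps_of_def by (auto dest: bspec[of _ _ i] bspec[of _ _ "Suc i"])
    then have "s \<circ> adj i = s"
      using True by (auto simp: fun_eq_iff Transposition.transpose_def)
    then show ?thesis using w by (simp add: supported_closed)
  qed (simp add: coeff_diff_component supported_closed)
  show "Gop i (word_tensor w) \<in> supported (comps_of (s \<circ> adj i))"
    unfolding act_G_word[OF len] by (intro supported_closed(2) stay supported_closed(4) sw)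
qed

lemma Eop_comps_of:
  assumes v: "v \<in> supported (comps_of s)" and i: "i \<in> {1..<n}"
  shows "Eop i v = (if s i = s (Suc i) then v else 0)"
proof -
  have word: "Eop i (word_tensor w) = (if s i = s (Suc i) then word_tensor w else 0)"
    if w: "comps_of s w" for w
  proof -
    have "snd (w ! (i - 1)) = s i" "snd (w ! i) = s (Suc i)" "1 \<le> i" "i < length w"
      using w i unfolding comps_of_def by (auto dest: bspec[of _ _ i] bspec[of _ _ "Suc i"])
    then show ?thesis by (simp add: act_E_word del: act_gen.simps)
  qed
  show ?thesis
  proof (cases "s i = s (Suc i)")
    case True
    have "Eop i v = v"
      by (rule linear_op_eqI[of _ "\<lambda>v. v"]) (use v word True in \<open>auto simp: supported_def simp del: act_gen.simps\<close>)
    then show ?thesis using True by simp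
  next
    case False
    have "Eop i v = 0"
      by (rule linear_op_zero_on_supported[OF linear_op_act_gen _ v]) (use word False in simp)
    then show ?thesis using False by simp
  qed
qed

lemma bt_Eij_closed:
  assumes "1 \<le> i" "i < j" "j \<le> n"
  shows "bt_Eij n q i j \<in> carrier Q"
  using proj_closed[of "fam.E_pair i j"] by (simp add: proj_E_pair[OF assms])

text \<open>\<open>E\<^sub>i\<^sub>j\<close> is conjugate by \<open>g\<^sub>i\<close> to the
  idempotent for \<open>i + 1\<close> and \<open>j\<close>. After applying \<open>g\<^sub>i\<close>
  the component formerly prescribed at place \<open>i\<close> is the one at place
  \<open>i + 1\<close>.\<close>

lemma ract_Eij:
  assumes "1 \<le> i" "i < j" "j \<le> n" and v: "v \<in> supported (comps_of s)"
  shows "v \<star> bt_Eij n q i j = (if s i = s j then v else 0)"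
  using assms
proof (induction "j - i" arbitrary: i s v rule: less_induct)
  case less
  note vw = supported_comps_of_words[OF less.prems(4)]
  have i: "i \<in> {1..<n}" using less.prems by auto
  show ?case
  proof (cases "j = Suc i")
    case True
    then show ?thesis
      using Eop_comps_of[OF less.prems(4) i] by (simp add: bt_Eij.simps ract_gens[OF vw])
  next
    case False
    let ?g = "bt_g n q i" and ?E = "bt_Eij n q (Suc i) j" and ?gi = "inv\<^bsub>B\<^esub> bt_g n q i"
    have gi: "?gi \<in> carrier Q" "?g \<otimes>\<^bsub>Q\<^esub> ?gi = \<one>\<^bsub>Q\<^esub>"
      using proj_closed[of "fam.g_inv i"] arg_cong[OF fam.g_g_inv[OF i], of proj]
      by (simp_all add: proj_g_inv[OF i] proj_fam(1)[OF i] proj_simps)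
    have E: "?E \<in> carrier Q" using less.prems False by (intro bt_Eij_closed) auto
    have Eij: "bt_Eij n q i j = ?g \<otimes>\<^bsub>Q\<^esub> ?E \<otimes>\<^bsub>Q\<^esub> ?gi"
      using False less.prems by (subst bt_Eij.simps) simp
    have gv: "v \<star> ?g \<in> supported (comps_of (s \<circ> adj i))"
      unfolding ract_gens[OF vw] by (rule Gop_comps_of[OF less.prems(4) i])
    have g: "?g \<in> carrier Q" using i by (rule bt_gens_closed)
    have "(v \<star> ?g) \<star> ?E = (if (s \<circ> adj i) (Suc i) = (s \<circ> adj i) j then v \<star> ?g else 0)"
      using less.prems False by (intro less.hyps gv) auto
    also have "(s \<circ> adj i) (Suc i) = s i" by simp
    also have "(s \<circ> adj i) j = s j" using less.prems False by (simp add: transpose_apply_other)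
    finally have "(v \<star> ?g) \<star> ?E = (if s i = s j then v \<star> ?g else 0)" .
    moreover have "v \<star> bt_Eij n q i j = ((v \<star> ?g) \<star> ?E) \<star> ?gi"
      unfolding Eij using ract_simps(2)[OF vw _ gi(1), of "?g \<otimes>\<^bsub>Q\<^esub> ?E"] ract_simps(2)[OF vw g E] g E
      by simp
    moreover have "(v \<star> ?g) \<star> ?gi = v"
      using ract_simps(2)[OF vw g gi(1)] gi(2) ract_one[OF vw] by simp
    moreover have "0 \<star> ?gi = 0"
      using ract_left(2)[OF supported_closed(1) supported_closed(1) gi(1), of 0] by simp
    ultimately show ?thesis by simp
  qed
qed

lemma ract_bt_E:
  assumes B: "partition_on {1..n} A" and v: "v \<in> supported (comps_of s)"
  shows "v \<star> bt_E n q A = (if refines {1..n} A (fibre_partition n s) then v else 0)"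
proof -
  note vw = supported_comps_of_words[OF v]
  have zero: "0 \<star> a = 0" if "a \<in> carrier Q" for a
    using ract_left(2)[OF supported_closed(1) supported_closed(1) that, of 0] by simp
  have "v \<star> bt_prod n q (map (\<lambda>(i, j). bt_Eij n q i j) ps) =
      (if \<forall>(i, j)\<in>set ps. s i = s j then v else 0) \<and>
      bt_prod n q (map (\<lambda>(i, j). bt_Eij n q i j) ps) \<in> carrier Q"
    if "set ps \<subseteq> set (block_pairs n A)" for ps
    using that
  proof (induction ps)
    case Nil
    then show ?case using ract_one[OF vw] by (simp add: bt_prod_def)
  next
    case (Cons p ps)
    obtain i j where p: "p = (i, j)" by (cases p)
    have ij: "1 \<le> i" "i < j" "j \<le> n" using Cons.prems p by (auto simp: set_block_pairs)
    let ?P = "bt_prod n q (map (\<lambda>(i, j). bt_Eij n q i j) ps)"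
    have P: "?P \<in> carrier Q" "v \<star> ?P = (if \<forall>(i, j)\<in>set ps. s i = s j then v else 0)"
      using Cons by auto
    have prod: "bt_prod n q (map (\<lambda>(i, j). bt_Eij n q i j) (p # ps)) = bt_Eij n q i j \<otimes>\<^bsub>Q\<^esub> ?P"
      by (simp add: p bt_prod_def)
    have "v \<star> (bt_Eij n q i j \<otimes>\<^bsub>Q\<^esub> ?P) = (if s i = s j then v else 0) \<star> ?P"
      unfolding ract_simps(2)[OF vw bt_Eij_closed[OF ij] P(1)] ract_Eij[OF ij v] ..
    then show ?case
      unfolding prod using P zero[OF P(1)] bt_Eij_closed[OF ij] by (auto simp: p)
  qed
  then have "v \<star> bt_E n q A = (if \<forall>(i, j)\<in>set (block_pairs n A). s i = s j then v else 0)"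
    unfolding bt_E_eq by blast
  moreover have "(\<forall>(i, j)\<in>set (block_pairs n A). s i = s j) \<longleftrightarrow> (\<forall>i j. same_block A i j \<longrightarrow> s i = s j)"
  proof
    assume *: "\<forall>(i, j)\<in>set (block_pairs n A). s i = s j"
    show "\<forall>i j. same_block A i j \<longrightarrow> s i = s j"
    proof (intro allI impI)
      fix i j assume ij: "same_block A i j"
      then have "i \<in> {1..n}" "j \<in> {1..n}" using same_block_in[OF B] by auto
      then have "i = j \<or> (i, j) \<in> set (block_pairs n A) \<or> (j, i) \<in> set (block_pairs n A)"
        using ij same_block_sym[of A] by (auto simp: set_block_pairs)
      then show "s i = s j" using * by auto
    qed
  qed (auto simp: set_block_pairs)
  ultimately show ?thesis unfolding refines_fibre_partition[OF B] by simp
qed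

lemma ract_finsum:
  assumes "finite S" "\<And>x. x \<in> S \<Longrightarrow> f x \<in> carrier Q" and v: "v \<in> words"
  shows "v \<star> (\<Oplus>\<^bsub>B\<^esub>x\<in>S. f x) = (\<Sum>x\<in>S. v \<star> f x)"
  using assms(1,2)
proof (induction S rule: finite_induct)
  case empty
  interpret BR: ring B by (rule ring_bt_algebra)
  show ?case using ract_zero[OF v] by simp
next
  case (insert x S)
  interpret BR: ring B by (rule ring_bt_algebra)
  have "(\<Oplus>\<^bsub>B\<^esub>x\<in>S. f x) \<in> carrier B" using insert.prems by (intro BR.finsum_closed) auto
  then show ?case
    using insert by (subst BR.finsum_insert) (auto simp: ract_simps(1)[OF v])
qed

lemma bt_idems_closed [simp]:
  "bt_E n q A \<in> carrier Q" "bt_idem n q A \<in> carrier Q" "bt_central_idem n q \<alpha> \<in> carrier Q"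
  using proj_closed by (simp_all flip: proj_E_part proj_idem_part proj_idem_type)

text \<open>Each \<open>bt_E\<close> acts by 0 or 1, so the idempotent acts by a Moebius sum over
  the interval from \<open>A\<close> to the kernel of \<open>s\<close>.\<close>

lemma ract_bt_idem:
  assumes v: "v \<in> supported (comps_of s)"
  shows "v \<star> bt_idem n q A = (if A = fibre_partition n s then v else 0)"
proof -
  note vw = supported_comps_of_words[OF v]
  let ?D = "fibre_partition n s" and ?S = "{B \<in> set_partitions n. refines {1..n} A B}"
  have "v \<star> bt_idem n q A = (\<Sum>B\<in>?S. scale (of_int (sp_mobius n A B)) (v \<star> bt_E n q B))"
    unfolding bt_idem_def
    by (subst ract_finsum[OF _ _ vw]) (simp_all add: ract_smult[OF vw] cong: sum.cong)
  also have "\<dots> = (\<Sum>B\<in>?S. scale (of_int (if refines {1..n} B ?D then sp_mobius n A B else 0)) v)"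
    by (rule sum.cong[OF refl]) (simp add: set_partitions_def ract_bt_E[OF _ v])
  also have "\<dots> = scale (of_int (\<Sum>B\<in>?S. if refines {1..n} B ?D then sp_mobius n A B else 0)) v"
    by (intro poly_mapping_eqI) (simp add: lookup_sum sum_distrib_right)
  also have "\<dots> = (if A = ?D then v else 0)"
    unfolding sum_sp_mobius_fibre[OF partition_on_fibre_partition] by simp
  finally show ?thesis .
qed

lemma ract_bt_central_idem:
  assumes v: "v \<in> supported (comps_of s)"
  shows "v \<star> bt_central_idem n q \<alpha> = (if sp_type (fibre_partition n s) = \<alpha> then v else 0)"
proof -
  have "v \<star> bt_central_idem n q \<alpha> =
      (\<Sum>A\<in>{A \<in> set_partitions n. sp_type A = \<alpha>}. if A = fibre_partition n s then v else 0)"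
    unfolding bt_central_idem_def
    by (subst ract_finsum[OF _ _ supported_comps_of_words[OF v]]) (simp_all add: ract_bt_idem[OF v])
  then show ?thesis
    unfolding sum.delta[OF finite_set_partitions]
    using partition_on_fibre_partition[of n s] by (simp add: set_partitions_def)
qed

text \<open>The word with the letter \<open>f a\<close> at place \<open>d a\<close>; for
  \<open>d = id\<close> the letters stand in their original order.\<close>

definition spread :: "(nat \<Rightarrow> 'b) \<Rightarrow> (nat \<Rightarrow> nat) \<Rightarrow> 'b list"
  where "spread f d = map (\<lambda>i. f (pinv d i)) [1..<n+1]"

lemma length_spread [simp]: "length (spread f d) = n"
  by (simp add: spread_def del: upt_Suc)

lemma nth_spread: "j \<in> {1..n} \<Longrightarrow> spread f d ! (j - 1) = f (pinv d j)"
  by (auto simp: spread_def nth_append simp del: upt_Suc)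

lemma bt_gw_closed: "w permutes {1..n} \<Longrightarrow> bt_gw n q w \<in> carrier Q"
  using proj_closed by (simp flip: proj_g_perm)

text \<open>Every letter of a reduced word creates one inversion of the final permutation. The
  hypothesis on that inversion makes the two letters being exchanged different in component or
  increasing, and on such a pair \<open>G\<close> is the plain exchange.\<close>

lemma ract_g_perm_spread:
  assumes w: "w permutes {1..n}"
    and inv: "\<And>a b. (a, b) \<in> inversion_set n w \<Longrightarrow> snd (f a) \<noteq> snd (f b) \<or> fst (f a) < fst (f b)"
  shows "word_tensor (spread f id) \<star> bt_gw n q w = word_tensor (spread f w)"
proof -
  have key: "word_tensor (spread f id) \<star> bt_gw n q (word_perm us) = word_tensor (spread f (word_perm us))"
    if "reduced_word n us"
      "\<And>a b. (a, b) \<in> inversion_set n (word_perm us) \<Longrightarrow> snd (f a) \<noteq> snd (f b) \<or> fst (f a) < fst (f b)"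
    for us
    using that
  proof (induction us rule: rev_induct)
    case Nil
    have "word_tensor (spread f id) \<in> words" by (simp add: supported_closed)
    then show ?case
      using ract_one proj_g_perm[OF permutes_id[of "{1..n}"]] unfolding word_perm_Nil
      by (simp only: proj_simps fam.g_perm_id)
  next
    case (snoc i us)
    note red = reduced_word_snocD[OF snoc.prems(1)]
    let ?w = "word_perm us"
    have w: "?w permutes {1..n}"
      using red(1) by (intro word_perm_permutes) (simp add: reduced_word_def)
    have iw: "adj i \<circ> ?w permutes {1..n}" by (intro permutes_compose w adj_permutes red(2))
    have ins: "inversion_set n (adj i \<circ> ?w) = insert (pinv ?w i, pinv ?w (Suc i)) (inversion_set n ?w)"
      by (rule inversion_set_adj_comp[OF w red(2,3)])
    have IH: "word_tensor (spread f id) \<star> bt_gw n q ?w = word_tensor (spread f ?w)"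
      using snoc.prems(2)[unfolded word_perm_snoc ins] by (intro snoc.IH red(1)) blast
    define a b where "a = f (pinv ?w i)" and "b = f (pinv ?w (Suc i))"
    have ab: "snd a \<noteq> snd b \<or> fst a < fst b"
      unfolding a_def b_def using snoc.prems(2)[unfolded word_perm_snoc ins] by blast
    have nth: "spread f ?w ! (i - 1) = a" "spread f ?w ! i = b"
      using nth_spread[of i f ?w] nth_spread[of "Suc i" f ?w] red(2) by (auto simp: a_def b_def)
    have sw: "swap_at i (spread f ?w) = spread f (adj i \<circ> ?w)"
    proof (rule nth_equalityI)
      fix m assume "m < length (swap_at i (spread f ?w))"
      then have m: "m < n" "Suc m \<in> {1..n}" by auto
      have "spread f (adj i \<circ> ?w) ! m = f (pinv ?w (adj i (Suc m)))"
        using nth_spread[OF m(2), of f "adj i \<circ> ?w"] inv_adj_comp(1)[OF permutes_bij[OF w]] by simp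
      moreover have "swap_at i (spread f ?w) ! m = f (pinv ?w (adj i (Suc m)))"
      proof -
        consider "m = i" | "m = i - 1" "m \<noteq> i" | "m \<noteq> i" "m \<noteq> i - 1" by blast
        then show ?thesis
        proof cases
          case 1
          then show ?thesis using nth_swap_at[of i "spread f ?w" m] red(2) nth m by (auto simp: a_def)
        next
          case 2
          then have "Suc m = i" using red(2) by auto
          then show ?thesis using nth_swap_at[of i "spread f ?w" m] red(2) nth m 2 by (auto simp: b_def)
        next
          case 3
          then have "Suc m \<noteq> i" "Suc m \<noteq> Suc i" using red(2) by auto
          then show ?thesis
            using nth_swap_at[of i "spread f ?w" m] red(2) m 3 nth_spread[OF m(2), of f ?w]
            by (auto simp: transpose_apply_other)
        qed
      qed
      ultimately show "swap_at i (spread f ?w) ! m = spread f (adj i \<circ> ?w) ! m" by simp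
    qed simp
    have coeff: "stay_coeff q a b = 0" "swap_coeff a b = (1 :: 's)"
      using ab by (auto simp: stay_coeff_def swap_coeff_def)
    have G: "Gop i (word_tensor (spread f ?w)) = word_tensor (spread f (adj i \<circ> ?w))"
      using act_G_word[of i "spread f ?w" q] red(2)
      by (simp add: nth coeff sw del: act_gen.simps One_nat_def)
    have "bt_gw n q (adj i \<circ> ?w) = bt_gw n q ?w \<otimes>\<^bsub>Q\<^esub> bt_g n q i"
      unfolding proj_g_perm[OF w, symmetric] proj_g_perm[OF iw, symmetric]
        fam.g_perm_adj_comp[OF w red(2,3)] proj_simps proj_fam(1)[OF red(2)] ..
    moreover have u: "word_tensor (spread f id) \<in> words" "word_tensor (spread f ?w) \<in> words"
      by (simp_all add: supported_closed)
    ultimately have "word_tensor (spread f id) \<star> bt_gw n q (adj i \<circ> ?w) =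
        (word_tensor (spread f id) \<star> bt_gw n q ?w) \<star> bt_g n q i"
      using ract_simps(2)[OF u(1) bt_gw_closed[OF w] bt_gens_closed(1)[OF red(2)]] by (simp only:)
    then show ?case
      unfolding word_perm_snoc IH ract_gens(1)[OF u(2)] G .
  qed
  obtain us where "reduced_word n us" "word_perm us = w" using reduced_word_exists[OF w] by auto
  then show ?thesis using key[of us] inv by simp
qed

lemma supported_induct [consumes 1, case_names zero add]:
  assumes v: "v \<in> supported P" and zero: "R 0"
    and add: "\<And>c w u. P w \<Longrightarrow> u \<in> supported P \<Longrightarrow> R u \<Longrightarrow> R (scale c (word_tensor w) + u)"
  shows "R v"
proof -
  have "R (\<Sum>w\<in>S. scale (f w) (word_tensor w))" if "finite S" "\<And>w. w \<in> S \<Longrightarrow> P w" for S f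
    using that
  proof (induction S rule: finite_induct)
    case (insert w S)
    then have "(\<Sum>w\<in>S. scale (f w) (word_tensor w)) \<in> supported P"
      by (intro supported_sum supported_closed) auto
    then show ?case using insert add by simp
  qed (simp add: zero)
  from this[of "Poly_Mapping.keys v" "Poly_Mapping.lookup v"] show ?thesis
    using v poly_mapping_sum_singles[of v] by (simp add: supported_def)
qed

end

lemma free_algebra_induct [consumes 1, case_names const g e add mult]:
  fixes P :: "'s::comm_ring_1 bt_free \<Rightarrow> bool"
  assumes p: "p \<in> carrier (free_algebra n)"
    and const: "\<And>c. P (free_const c)" and g: "\<And>i. i \<in> {1..<n} \<Longrightarrow> P (free_g i)"
    and e: "\<And>i. i \<in> {1..<n} \<Longrightarrow> P (free_e i)"
    and add: "\<And>p p'. p \<in> carrier (free_algebra n) \<Longrightarrow> p' \<in> carrier (free_algebra n) \<Longrightarrow> P p \<Longrightarrow> P p' \<Longrightarrow> P (p + p')"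
    and mult: "\<And>p p'. p \<in> carrier (free_algebra n) \<Longrightarrow> p' \<in> carrier (free_algebra n) \<Longrightarrow> P p \<Longrightarrow> P p' \<Longrightarrow> P (p * p')"
  shows "P p"
proof -
  let ?F = "carrier (free_algebra n :: 's bt_free ring)" and ?L = "GenG ` {1..<n} \<union> GenE ` {1..<n}"
  have word: "Poly_Mapping.single (FWord xs) 1 \<in> ?F \<and> P (Poly_Mapping.single (FWord xs) 1)"
    if "set xs \<subseteq> ?L" for xs
    using that
  proof (induction xs)
    case Nil
    have "Poly_Mapping.single (FWord []) 1 = (free_const 1 :: 's bt_free)"
      by (simp add: free_const_def zero_fword_def)
    then show ?case using const[of 1] by (simp del: free_const_mult(3))
  next
    case (Cons x xs)
    have "Poly_Mapping.single (FWord [x]) 1 \<in> ?F \<and> P (Poly_Mapping.single (FWord [x]) 1)"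
      using Cons.prems g e by (auto simp: free_algebra_def simp flip: free_g_def free_e_def simp del: atLeastLessThan_iff)
    moreover have "Poly_Mapping.single (FWord (x # xs)) 1 =
        Poly_Mapping.single (FWord [x]) 1 * (Poly_Mapping.single (FWord xs) 1 :: 's bt_free)"
      by (simp add: mult_single plus_fword_def)
    ultimately show ?case using Cons mult by simp
  qed
  have single: "scale c (Poly_Mapping.single w 1) \<in> ?F \<and> P (scale c (Poly_Mapping.single w 1))"
    if "set (letters w) \<subseteq> ?L" for w c
    unfolding scale_eq_free_const using word[OF that] const mult by simp
  have "(\<Sum>w\<in>S. scale (f w) (Poly_Mapping.single w 1)) \<in> ?F \<and> P (\<Sum>w\<in>S. scale (f w) (Poly_Mapping.single w 1))"
    if "finite S" "\<And>w. w \<in> S \<Longrightarrow> set (letters w) \<subseteq> ?L" for S f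
    using that
  proof (induction S rule: finite_induct)
    case empty
    have "P (free_const 0)" by (rule const)
    then show ?case by (simp add: free_const_def free_algebra_def)
  next
    case (insert w S)
    then have "scale (f w) (Poly_Mapping.single w 1) \<in> ?F" "P (scale (f w) (Poly_Mapping.single w 1))"
      using single by blast+
    then show ?case
      using insert add by (simp del: scale_simps)
  qed
  from this[of "Poly_Mapping.keys p" "Poly_Mapping.lookup p"] show ?thesis
    using p poly_mapping_sum_singles[of p] by (simp add: free_algebra_def del: scale_simps)
qed

section \<open>Permutation modules as weight spaces\<close>

lemma fibre_partition_cong:
  "(\<And>j. j \<in> {1..n} \<Longrightarrow> s j = s' j) \<Longrightarrow> fibre_partition n s = fibre_partition n s'"
  unfolding fibre_partition_def by (intro image_cong refl) auto

text \<open>\<open>w\<close> maps the blocks of the original kernel bijectively onto those of the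
  new one.\<close>

lemma sp_type_fibre_partition_pinv:
  assumes w: "w permutes {1..n}"
  shows "sp_type (fibre_partition n (s \<circ> pinv w)) = sp_type (fibre_partition n s)"
proof -
  let ?A = "fibre_partition n s"
  have wi: "w (pinv w x) = x" "pinv w (w x) = x" for x using permutes_inverses[OF w] by auto
  have "fibre_partition n (s \<circ> pinv w) = (`) w ` ?A"
  proof -
    have "{k\<in>{1..n}. (s \<circ> pinv w) k = (s \<circ> pinv w) (w j)} = w ` {k\<in>{1..n}. s k = s j}" for j
    proof -
      have "k \<in> w ` {k\<in>{1..n}. s k = s j} \<longleftrightarrow> k \<in> {1..n} \<and> s (pinv w k) = s j" for k
      proof
        assume "k \<in> w ` {k\<in>{1..n}. s k = s j}"
        then show "k \<in> {1..n} \<and> s (pinv w k) = s j"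
          using permutes_in_image[OF w] wi by auto
      next
        assume "k \<in> {1..n} \<and> s (pinv w k) = s j"
        then show "k \<in> w ` {k\<in>{1..n}. s k = s j}"
          using permutes_in_image[OF permutes_inv[OF w]] wi by (intro image_eqI[of _ _ "pinv w k"]) auto
      qed
      then show ?thesis using wi by auto
    qed
    then have "(\<lambda>j. {k\<in>{1..n}. (s \<circ> pinv w) k = (s \<circ> pinv w) j}) ` w ` {1..n} = (`) w ` ?A"
      unfolding fibre_partition_def image_image by simp
    then show ?thesis
      unfolding permutes_image[OF w] by (simp only: fibre_partition_def)
  qed
  moreover have "inj_on ((`) w) ?A"
    using permutes_inj[OF w] by (auto simp: inj_on_def inj_image_eq_iff)
  moreover have "card (w ` b) = card b" for b
    using permutes_inj_on[OF w] by (rule card_image)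
  ultimately show ?thesis
    by (simp add: sp_type_def image_mset_mset_set[symmetric] multiset.map_comp comp_def)
qed

lemma lin_ext_in_free_algebra:
  assumes "\<And>k. f k \<in> carrier (free_algebra n)"
  shows "lin_ext f u \<in> carrier (free_algebra n)"
proof -
  have "(\<Sum>k\<in>S. scale (g k) (f k)) \<in> carrier (free_algebra n)" for S g
    by (induction S rule: infinite_finite_induct)
      (simp_all add: scale_eq_free_const assms, simp_all add: free_algebra_def)
  then show ?thesis by (simp add: lin_ext_def)
qed

locale bt_weight = bt_unit +
  fixes \<nu> :: "nat list list"
  assumes total: "sum_list (map sum_list \<nu>) = n"
begin

abbreviation c where "c \<equiv> initial_pos \<nu>"

abbreviation weight_space :: "'a tensor set"
  where "weight_space \<equiv> supported (has_weight n \<nu>)"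

lemma stable_has_weight: "stable (has_weight n \<nu>)"
  by (auto simp: stable_def has_weight_def)

lemma weight_space_words: "v \<in> weight_space \<Longrightarrow> v \<in> words"
  using supported_mono[of "has_weight n \<nu>" "\<lambda>w. length w = n"] by (auto simp: has_weight_def)

text \<open>On the word of a row standard tableau this recovers the permutation
  \<open>tableau_perm\<close> of the tableau.\<close>

definition std :: "basis_index list \<Rightarrow> nat \<Rightarrow> nat"
  where "std b = (THE d. standardizes n c b d)"

lemma std_eqI: "standardizes n c b d \<Longrightarrow> std b = d"
  unfolding std_def using standardizes_unique by blast

lemma std_standardizes: "has_weight n \<nu> b \<Longrightarrow> standardizes n c b (std b)"
  using has_weight_standardizes[OF total] std_eqI by metis

lemma std_permutes: "has_weight n \<nu> b \<Longrightarrow> std b permutes {1..n}"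
  using std_standardizes by (auto simp: standardizes_def)

lemma letter_eq_pos:
  assumes "standardizes n c b d" "i \<in> {1..n}"
  shows "b ! (i - 1) = c (pinv d i)"
proof -
  have d: "d permutes {1..n}" using assms by (simp add: standardizes_def)
  have "pinv d i \<in> {1..n}" using permutes_in_image[OF permutes_inv[OF d]] assms(2) by simp
  then have "b ! (d (pinv d i) - 1) = c (pinv d i)" using assms(1) unfolding standardizes_def by blast
  then show ?thesis using permutes_inverses(1)[OF d] by simp
qed

definition gen :: "(nat \<Rightarrow> nat) \<Rightarrow> 'a bt_free set"
  where "gen d = proj (fam.stab_basis c d)"

lemma gen_closed [simp]: "gen d \<in> carrier Q"
  by (simp add: gen_def)

lemma perm_gen_eq: "perm_gen n q \<nu> = proj (fam.stab_gen c)"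
proof -
  have "fam.stab c = row_stabilizer n \<nu>"
    by (simp add: fam.stab_def row_stabilizer_eq[OF total])
  then show ?thesis
    by (simp add: perm_gen_def fam.stab_gen_def proj_simps proj_idem_part proj_stab_sum
        comp_partition_eq[OF total])
qed

lemma gen_eq: "d permutes {1..n} \<Longrightarrow> gen d = perm_gen n q \<nu> \<otimes>\<^bsub>Q\<^esub> bt_gw n q d"
  by (simp add: gen_def fam.stab_basis_def proj_simps perm_gen_eq proj_g_perm)

lemma gen_id: "gen id = perm_gen n q \<nu>"
  by (simp add: gen_def fam.stab_basis_def perm_gen_eq)

lemma perm_basis_eq: "t \<in> RStd n \<nu> \<Longrightarrow> perm_basis n q \<nu> t = gen (std (tableau_word n \<nu> t))"
  using std_eqI[OF RStd_standardizes[OF total]] tableau_perm(1)[OF total]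
  by (simp add: perm_basis_def gen_eq RStd_def del: upt_Suc)

text \<open>Representatives in the free algebra allow \<open>Psi\<close> to be a linear extension
  followed by the class map, so that its linearity needs no separate argument.\<close>

definition rep :: "basis_index list \<Rightarrow> 'a bt_free"
  where "rep b = (SOME p. p \<in> carrier (free_algebra n) \<and> bt_class n q p = gen (std b))"

lemma rep: "rep b \<in> carrier (free_algebra n)" "bt_class n q (rep b) = gen (std b)"
proof -
  obtain p where "p \<in> carrier (free_algebra n)" "gen (std b) = bt_class n q p"
    using bt_class_surj[OF gen_closed] .
  then have "\<exists>p. p \<in> carrier (free_algebra n) \<and> bt_class n q p = gen (std b)" by auto
  from someI_ex[OF this] show "rep b \<in> carrier (free_algebra n)" "bt_class n q (rep b) = gen (std b)"
    by (simp_all add: rep_def)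
qed

text \<open>The inverse of the embedding.\<close>

definition Psi :: "'a tensor \<Rightarrow> 'a bt_free set"
  where "Psi v = bt_class n q (lin_ext rep v)"

lemma lin_ext_rep [simp]: "lin_ext rep v \<in> carrier (free_algebra n)"
  by (rule lin_ext_in_free_algebra) (rule rep)

lemma Psi_simps:
  "Psi v \<in> carrier Q" "Psi (u + v) = Psi u \<oplus>\<^bsub>Q\<^esub> Psi v"
  "Psi (scale a v) = bt_class n q (free_const a) \<otimes>\<^bsub>Q\<^esub> Psi v" "Psi 0 = \<zero>\<^bsub>Q\<^esub>"
  "Psi (word_tensor b) = gen (std b)"
proof -
  show "Psi (word_tensor b) = gen (std b)" by (simp add: Psi_def rep(2))
qed (simp_all only: Psi_def linear_opD[OF linear_op_lin_ext] bt_class_closed bt_class_arith bt_class_zero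
    lin_ext_rep free_gens_in_free_algebra scale_eq_free_const)

text \<open>\<open>adj i\<close> can reverse only the pair of places \<open>i\<close>,
  \<open>i + 1\<close>, and these carry different letters, so the order among equal letters is
  kept.\<close>

lemma standardizes_swap_at:
  assumes d: "standardizes n c b d" and i: "i \<in> {1..<n}" and ne: "b ! (i - 1) \<noteq> b ! i"
  shows "standardizes n c (swap_at i b) (adj i \<circ> d)"
proof -
  have dp: "d permutes {1..n}" and len: "length b = n"
    and letter: "\<And>j. j \<in> {1..n} \<Longrightarrow> b ! (d j - 1) = c j"
    and inc: "\<And>j k. j \<in> {1..n} \<Longrightarrow> k \<in> {1..n} \<Longrightarrow> j < k \<Longrightarrow> c j = c k \<Longrightarrow> d j < d k"
    using d by (auto simp: standardizes_def)
  have "swap_at i b ! ((adj i \<circ> d) j - 1) = c j" if j: "j \<in> {1..n}" for j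
  proof -
    have dj: "d j \<in> {1..n}" using permutes_in_image[OF dp] j by simp
    have "swap_at i b ! (adj i (d j) - 1) = b ! (d j - 1)"
    proof -
      consider "d j = i" | "d j = Suc i" | "d j \<noteq> i" "d j \<noteq> Suc i" by blast
      then show ?thesis
      proof cases
        case 1
        then show ?thesis using i len nth_swap_at[of i b i] by simp
      next
        case 2
        then show ?thesis using i len nth_swap_at[of i b "i - 1"] by auto
      next
        case 3
        then have "d j - 1 \<noteq> i" "d j - 1 \<noteq> i - 1" using dj i by auto
        then show ?thesis using i len dj nth_swap_at[of i b "d j - 1"] 3 by (auto simp: transpose_apply_other)
      qed
    qed
    then show ?thesis using letter[OF j] by simp
  qed
  moreover have "(adj i \<circ> d) j < (adj i \<circ> d) k"
    if jk: "j \<in> {1..n}" "k \<in> {1..n}" "j < k" "c j = c k" for j k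
  proof -
    have "d j < d k" using inc jk by blast
    moreover have "\<not> (d j = i \<and> d k = Suc i)"
      using letter[OF jk(1)] letter[OF jk(2)] jk(4) ne by auto
    ultimately show ?thesis
      by (auto simp: Transposition.transpose_def)
  qed
  moreover have "adj i \<circ> d permutes {1..n}" by (intro permutes_compose dp adj_permutes i)
  ultimately show ?thesis using len by (simp add: standardizes_def)
qed

lemma gen_e:
  assumes d: "standardizes n c b d" and i: "i \<in> {1..<n}"
  shows "gen d \<otimes>\<^bsub>Q\<^esub> bt_e n q i = (if snd (b ! (i - 1)) = snd (b ! i) then gen d else \<zero>\<^bsub>Q\<^esub>)"
proof -
  have dp: "d permutes {1..n}" using d by (simp add: standardizes_def)
  have lets: "b ! (i - 1) = c (pinv d i)" "b ! i = c (pinv d (Suc i))"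
    using letter_eq_pos[OF d, of i] letter_eq_pos[OF d, of "Suc i"] i by auto
  have "gen d \<otimes>\<^bsub>Q\<^esub> bt_e n q i = proj (fam.stab_basis c d * fam_e i)"
    unfolding gen_def proj_simps proj_fam(2)[OF i] ..
  then show ?thesis
    unfolding fam.stab_basis_e[OF dp i] lets by (simp add: gen_def proj_simps)
qed

text \<open>Since \<open>c\<close> increases weakly by component and then by row, comparing the
  lower indices of two distinct letters of one component is the same as comparing \<open>j\<close>
  and \<open>k\<close>. Thus the case distinction in \<open>G\<close> is the one between ascents and
  descents of \<open>d\<close>.\<close>

lemma gen_g:
  assumes d: "standardizes n c b d" and i: "i \<in> {1..<n}"
  shows "gen d \<otimes>\<^bsub>Q\<^esub> bt_g n q i =
    bt_class n q (free_const (stay_coeff q (b ! (i - 1)) (b ! i))) \<otimes>\<^bsub>Q\<^esub> gen d \<oplus>\<^bsub>Q\<^esub>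
    bt_class n q (free_const (swap_coeff (b ! (i - 1)) (b ! i))) \<otimes>\<^bsub>Q\<^esub> gen (adj i \<circ> d)"
proof -
  have dp: "d permutes {1..n}" using d by (simp add: standardizes_def)
  define j k where "j = pinv d i" and "k = pinv d (Suc i)"
  have dj: "d j = i" "d k = Suc i" using permutes_inverses(1)[OF dp] by (simp_all add: j_def k_def)
  have jk: "j \<in> {1..n}" "k \<in> {1..n}"
    using permutes_in_image[OF permutes_inv[OF dp]] i unfolding j_def k_def by auto
  have lets: "b ! (i - 1) = c j" "b ! i = c k"
    using letter_eq_pos[OF d, of i] letter_eq_pos[OF d, of "Suc i"] i unfolding j_def k_def by auto
  have inc: "\<And>j k. j \<in> {1..n} \<Longrightarrow> k \<in> {1..n} \<Longrightarrow> j < k \<Longrightarrow> c j = c k \<Longrightarrow> d j < d k"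
    using d by (auto simp: standardizes_def)
  have mult: "gen d \<otimes>\<^bsub>Q\<^esub> bt_g n q i = proj (fam.stab_basis c d * fam_g i)"
    unfolding gen_def proj_simps proj_fam(1)[OF i] ..
  have one: "bt_class n q (free_const 1) = \<one>\<^bsub>Q\<^esub>" and zero: "bt_class n q (free_const 0) = \<zero>\<^bsub>Q\<^esub>"
    by (simp_all add: free_const_mult free_const_def bt_class_zero)
  consider "c j = c k" | "c j \<noteq> c k" "j < k" | "c j \<noteq> c k" "k < j"
    using dj by (metis linorder_neqE_nat n_not_Suc_n)
  then show ?thesis
  proof cases
    case 1
    have "j < k" using inc[OF jk(2,1)] 1 dj by (metis less_irrefl linorder_neqE_nat not_less_eq less_Suc_eq)
    \<comment> \<open>An index strictly between \<open>j\<close> and \<open>k\<close> would have the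
      same position by monotonicity, and \<open>d\<close> would send it strictly between
      \<open>i\<close> and \<open>i + 1\<close>.\<close>
    have "k = Suc j"
    proof (rule ccontr)
      assume "k \<noteq> Suc j"
      then have m: "j < Suc j" "Suc j < k" "Suc j \<in> {1..n}" using \<open>j < k\<close> jk by auto
      have "c (Suc j) = c j"
        using initial_pos_mono[OF total jk(1) m(3) less_imp_le[OF m(1)]]
          initial_pos_mono[OF total m(3) jk(2) less_imp_le[OF m(2)], folded 1]
        by (intro prod_eqI) linarith+
      then have "d j < d (Suc j)" "d (Suc j) < d k" using inc jk m 1 by metis+
      then show False using dj by simp
    qed
    then have "fam.stab_basis c d * fam_g i = fam_scalar q * fam.stab_basis c d"
      using dj jk 1 i by (intro fam.stab_basis_g_same[OF dp, of j]) auto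
    moreover have "stay_coeff q (c j) (c k) = q" "swap_coeff (c j) (c k) = (0 :: 'a)"
      using 1 by (simp_all add: stay_coeff_def swap_coeff_def)
    ultimately show ?thesis
      unfolding mult lets by (simp add: proj_simps proj_fam(3) zero flip: gen_def)
  next
    case 2
    have "stay_coeff q (c j) (c k) = 0" "swap_coeff (c j) (c k) = (1 :: 'a)"
      using 2 initial_pos_mono[OF total jk]
      by (auto simp: stay_coeff_def swap_coeff_def prod_eq_iff)
    moreover have "fam.stab_basis c d * fam_g i = fam.stab_basis c (adj i \<circ> d)"
      using 2 by (intro fam.stab_basis_g_asc[OF dp i]) (simp add: j_def k_def)
    ultimately show ?thesis
      unfolding mult lets by (simp add: one zero flip: gen_def)
  next
    case 3
    have "stay_coeff q (c j) (c k) = (if snd (c j) = snd (c k) then q - q' else 0)"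
      "swap_coeff (c j) (c k) = (1 :: 'a)"
      using 3 initial_pos_mono[OF total jk(2,1)]
      by (auto simp: stay_coeff_def swap_coeff_def prod_eq_iff unit_inv_eq[OF unit])
    moreover have "fam.stab_basis c d * fam_g i = fam.stab_basis c (adj i \<circ> d) +
        (if snd (c j) = snd (c k) then (fam_scalar q - fam_scalar q') * fam.stab_basis c d else 0)"
      unfolding j_def k_def using 3 by (intro fam.stab_basis_g_desc[OF dp i]) (simp add: j_def k_def)
    ultimately show ?thesis
      unfolding mult lets
      by (simp add: one zero proj_simps proj_fam(3) bt_class_diff Q.a_comm
          flip: gen_def free_const_mult(4))
  qed
qed

lemma Psi_act_gen:
  assumes v: "v \<in> weight_space" and i: "i \<in> {1..<n}"
  shows "Psi v \<otimes>\<^bsub>Q\<^esub> bt_g n q i = Psi (Gop i v)" "Psi v \<otimes>\<^bsub>Q\<^esub> bt_e n q i = Psi (Eop i v)"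
proof -
  have len: "1 \<le> i" "i < length b" if "has_weight n \<nu> b" for b
    using that i by (auto simp: has_weight_def)
  have stdsw: "gen (adj i \<circ> std b) = gen (std (swap_at i b))"
    if b: "has_weight n \<nu> b" and "b ! (i - 1) \<noteq> b ! i" for b
    using std_eqI[OF standardizes_swap_at[OF std_standardizes[OF b] i that(2)]] by simp
  have zero: "bt_class n q (free_const 0) = \<zero>\<^bsub>Q\<^esub>"
    by (simp add: free_const_def bt_class_zero)
  note lin = linear_opD(1-3)[OF linear_op_act_gen]
  \<comment> \<open>For equal letters the exchange coefficient is 0 and only the multiple of the
    word remains; for different letters \<open>stdsw\<close> identifies the exchanged terms.\<close>
  have wg: "Psi (word_tensor b) \<otimes>\<^bsub>Q\<^esub> bt_g n q i = Psi (Gop i (word_tensor b))"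
    if b: "has_weight n \<nu> b" for b
    unfolding act_G_word[OF len[OF b]] Psi_simps gen_g[OF std_standardizes[OF b] i]
    using stdsw[OF b] by (cases "b ! (i - 1) = b ! i") (simp_all add: swap_coeff_def zero)
  have we: "Psi (word_tensor b) \<otimes>\<^bsub>Q\<^esub> bt_e n q i = Psi (Eop i (word_tensor b))"
    if b: "has_weight n \<nu> b" for b
    unfolding act_E_word[OF len[OF b]] Psi_simps gen_e[OF std_standardizes[OF b] i]
    by (simp add: Psi_simps)
  have g: "bt_g n q i \<in> carrier Q" and e: "bt_e n q i \<in> carrier Q" using i by (rule bt_gens_closed)+
  from v show "Psi v \<otimes>\<^bsub>Q\<^esub> bt_g n q i = Psi (Gop i v)"
  proof (induction v rule: supported_induct)
    case (add a w u)
    then show ?case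
      using g wg[OF add(1)] Psi_simps(1) unfolding lin Psi_simps(2,3)
      by (simp add: Q.l_distr Q.m_assoc del: act_gen.simps)
  qed (use g in \<open>simp add: lin Psi_simps del: act_gen.simps\<close>)
  from v show "Psi v \<otimes>\<^bsub>Q\<^esub> bt_e n q i = Psi (Eop i v)"
  proof (induction v rule: supported_induct)
    case (add a w u)
    then show ?case
      using e we[OF add(1)] Psi_simps(1) unfolding lin Psi_simps(2,3)
      by (simp add: Q.l_distr Q.m_assoc del: act_gen.simps)
  qed (use e in \<open>simp add: lin Psi_simps del: act_gen.simps\<close>)
qed

lemma Psi_act:
  assumes v: "v \<in> weight_space" and a: "a \<in> carrier Q"
  shows "Psi v \<otimes>\<^bsub>Q\<^esub> a = Psi (v \<star> a)"
proof -
  obtain p where p: "p \<in> carrier (free_algebra n)" "a = bt_class n q p"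
    using bt_class_surj[OF a] .
  have "\<forall>v\<in>weight_space. Psi v \<otimes>\<^bsub>Q\<^esub> bt_class n q p = Psi (act_free q v p)"
    using p(1)
  proof (induction p rule: free_algebra_induct)
    case (const c)
    then show ?case
      by (simp add: act_free_gens Psi_simps bt_scalar_central[OF Psi_simps(1)])
  next
    case (g i)
    then show ?case using Psi_act_gen(1) by (simp add: act_free_gens bt_g_def del: act_gen.simps)
  next
    case (e i)
    then show ?case using Psi_act_gen(2) by (simp add: act_free_gens bt_e_def del: act_gen.simps)
  next
    case (add p p')
    then show ?case
      by (simp add: bt_class_arith linear_opD(1)[OF linear_op_act_free_right] Psi_simps Q.r_distr)
  next
    case (mult p p')
    have "act_free q v p \<in> weight_space" if "v \<in> weight_space" for v
      by (rule act_free_supported[OF stable_has_weight that mult(1)])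
    then show ?case
      using mult by (simp add: bt_class_arith act_free_mult Psi_simps Q.m_assoc[symmetric])
  qed
  then show ?thesis using v by (simp add: p(2) ract_class[OF weight_space_words[OF v]])
qed

lemma gen_central_idem:
  assumes "d permutes {1..n}"
  shows "gen d \<otimes>\<^bsub>Q\<^esub> bt_central_idem n q (sp_type (comp_partition \<nu>)) = gen d"
proof -
  have "fam.stab_basis c d * fam.idem_type (sp_type (comp_partition \<nu>)) = fam.stab_basis c d"
    using fam.stab_basis_idem_type[OF assms, of c] sp_type_fibre_partition_pinv[OF assms, of "snd \<circ> c"]
    by (simp add: comp_partition_eq[OF total])
  then show ?thesis
    using proj_simps(4)[of "fam.stab_basis c d" "fam.idem_type (sp_type (comp_partition \<nu>))"]
    by (simp add: gen_def proj_idem_type)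
qed

section \<open>The permutation module as the image of the weight space\<close>

definition initial_word :: "basis_index list"
  where "initial_word = tableau_word n \<nu> (initial_tableau \<nu>)"

lemma initial_word_weight: "has_weight n \<nu> initial_word"
  unfolding initial_word_def by (rule tableau_word_has_weight[OF initial_tableau_in_tableaux[OF total]])

lemma std_initial_word: "std initial_word = id"
proof (rule std_eqI)
  have "initial_word ! (j - 1) = c j" if "j \<in> {1..n}" for j
    using that by (auto simp: initial_word_def nth_append simp del: upt_Suc)
  then show "standardizes n c initial_word id"
    by (simp add: standardizes_def initial_word_def permutes_id del: upt_Suc)
qed

text \<open>The generator is fixed by right multiplication with the central idempotent, so
  multiplying it by the block or by the whole algebra gives the same set.\<close>

lemma carrier_perm_module:
  "carrier (perm_module n q \<nu>) = (\<lambda>a. perm_gen n q \<nu> \<otimes>\<^bsub>Q\<^esub> a) ` carrier Q"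
proof -
  let ?X = "perm_gen n q \<nu>" and ?E = "bt_central_idem n q (sp_type (comp_partition \<nu>))"
  have XE: "?X \<otimes>\<^bsub>Q\<^esub> ?E = ?X" using gen_central_idem[OF permutes_id] by (simp only: gen_id)
  have X: "?X \<in> carrier Q" using gen_closed[of id] by (simp only: gen_id)
  have "carrier (perm_module n q \<nu>) = (\<lambda>a. ?X \<otimes>\<^bsub>Q\<^esub> (?E \<otimes>\<^bsub>Q\<^esub> a)) ` carrier Q"
    by (simp add: perm_module_def bt_block_def image_image)
  also have "\<dots> = (\<lambda>a. ?X \<otimes>\<^bsub>Q\<^esub> a) ` carrier Q"
    by (rule image_cong[OF refl]) (use X XE in \<open>simp add: Q.m_assoc[symmetric]\<close>)
  finally show ?thesis .
qed

text \<open>The generator is the image of the initial word, so equivariance yields one inclusion.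
  Conversely the image of a word is the generator times some \<open>g\<^sub>w\<close>, and the
  module is closed under linear combinations.\<close>

lemma carrier_perm_module_Psi: "carrier (perm_module n q \<nu>) = Psi ` weight_space"
proof
  let ?u = "word_tensor initial_word :: 'a tensor"
  have u: "?u \<in> weight_space" using initial_word_weight by (simp add: supported_closed)
  have Pu: "Psi ?u = perm_gen n q \<nu>" by (simp add: Psi_simps std_initial_word gen_id)
  have X: "perm_gen n q \<nu> \<in> carrier Q" using gen_closed[of id] by (simp only: gen_id)
  show "carrier (perm_module n q \<nu>) \<subseteq> Psi ` weight_space"
    unfolding carrier_perm_module Pu[symmetric]
    using Psi_act[OF u] ract_supported[OF stable_has_weight u] by auto
  show "Psi ` weight_space \<subseteq> carrier (perm_module n q \<nu>)"
  proof clarify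
    fix v assume "v \<in> weight_space"
    then show "Psi v \<in> carrier (perm_module n q \<nu>)"
    proof (induction v rule: supported_induct)
      case zero
      then show ?case
        unfolding carrier_perm_module Psi_simps using X by (intro image_eqI[of _ _ "\<zero>\<^bsub>Q\<^esub>"]) auto
    next
      case (add a w u)
      then obtain y where y: "y \<in> carrier Q" "Psi u = perm_gen n q \<nu> \<otimes>\<^bsub>Q\<^esub> y"
        unfolding carrier_perm_module by auto
      have gw: "bt_gw n q (std w) \<in> carrier Q"
        by (rule bt_gw_closed[OF std_permutes[OF add(1)]])
      let ?a = "bt_class n q (free_const a)"
      have a: "?a \<in> carrier Q" by simp
      have "Psi (scale a (word_tensor w) + u) =
          ?a \<otimes>\<^bsub>Q\<^esub> (perm_gen n q \<nu> \<otimes>\<^bsub>Q\<^esub> bt_gw n q (std w)) \<oplus>\<^bsub>Q\<^esub> perm_gen n q \<nu> \<otimes>\<^bsub>Q\<^esub> y"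
        unfolding Psi_simps(2,3,5) y(2) gen_eq[OF std_permutes[OF add(1)]] ..
      also have "?a \<otimes>\<^bsub>Q\<^esub> (perm_gen n q \<nu> \<otimes>\<^bsub>Q\<^esub> bt_gw n q (std w)) =
          perm_gen n q \<nu> \<otimes>\<^bsub>Q\<^esub> (?a \<otimes>\<^bsub>Q\<^esub> bt_gw n q (std w))"
        unfolding Q.m_assoc[OF a X gw, symmetric] Q.m_assoc[OF X a gw, symmetric]
          bt_scalar_central[OF X] ..
      finally have "Psi (scale a (word_tensor w) + u) =
          perm_gen n q \<nu> \<otimes>\<^bsub>Q\<^esub> (?a \<otimes>\<^bsub>Q\<^esub> bt_gw n q (std w) \<oplus>\<^bsub>Q\<^esub> y)"
        unfolding Q.r_distr[OF Q.m_closed[OF a gw] y(1) X] .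
      then show ?case
        unfolding carrier_perm_module by (rule image_eqI) (intro Q.a_closed Q.m_closed a gw y(1))
    qed
  qed
qed

text \<open>Injectivity is tested on a tensor with pairwise distinct lower indices, on which the
  \<open>g\<^sub>w\<close> act by place permutations.\<close>

definition label :: "nat \<Rightarrow> basis_index"
  where "label j = (j, snd (c j))"

text \<open>The idempotent fixes the test word, whose components are those of \<open>c\<close>. Its
  lower indices increase from place to place, so each \<open>g\<^sub>v\<close> of the row sum is a
  plain rearrangement; afterwards the same must be shown for \<open>g\<^sub>d\<close>.\<close>

lemma ract_label_gen:
  assumes d: "standardizes n c b d"
  shows "word_tensor (spread label id) \<star> gen d =
    (\<Sum>v\<in>row_stabilizer n \<nu>. scale (q ^ perm_length n v) (word_tensor (spread (label \<circ> pinv v) d)))"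
proof -
  have dp: "d permutes {1..n}" using d by (simp add: standardizes_def)
  let ?u = "word_tensor (spread label id) :: 'a tensor"
  let ?S = "row_stabilizer n \<nu>"
  have fin: "finite ?S"
    by (rule finite_subset[OF _ finite_permutations[of "{1..n}"]]) (auto simp: row_stabilizer_def)
  have u: "?u \<in> words" by (simp add: supported_closed)
  have vp: "v permutes {1..n}" if "v \<in> ?S" for v using that by (simp add: row_stabilizer_def)
  have rs: "row_sum n q \<nu> \<in> carrier Q"
  proof -
    have "fam.stab c = ?S" by (simp add: fam.stab_def row_stabilizer_eq[OF total])
    then show ?thesis using proj_closed[of "fam.stab_sum c"] by (simp add: proj_stab_sum)
  qed
  have comps: "comps_of (snd \<circ> c) (spread label id)"
    using nth_spread[of _ label id] by (simp add: comps_of_def label_def)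
  have idem: "?u \<star> bt_idem n q (comp_partition \<nu>) = ?u"
    using ract_bt_idem[of ?u "snd \<circ> c"] comps by (simp add: supported_closed comp_partition_eq[OF total])
  have spread_comp: "spread label v = spread (label \<circ> pinv v) id" for v
    by (simp add: spread_def)
  have gv: "?u \<star> bt_gw n q v = word_tensor (spread (label \<circ> pinv v) id)" if "v \<in> ?S" for v
    unfolding spread_comp[symmetric]
    by (rule ract_g_perm_spread[OF vp[OF that]]) (auto simp: label_def inversion_set_def)
  have gwc: "bt_gw n q v \<in> carrier Q" if "v \<in> ?S" for v by (rule bt_gw_closed[OF vp[OF that]])
  have "?u \<star> row_sum n q \<nu> = (\<Sum>v\<in>?S. scale (q ^ perm_length n v) (?u \<star> bt_gw n q v))"
    unfolding row_sum_def
    by (subst ract_finsum[OF fin _ u]) (simp_all add: gwc ract_smult[OF u] cong: sum.cong)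
  also have "\<dots> = (\<Sum>v\<in>?S. scale (q ^ perm_length n v) (word_tensor (spread (label \<circ> pinv v) id)))"
    by (intro sum.cong refl) (simp only: gv)
  finally have ur: "?u \<star> row_sum n q \<nu> = \<dots>" .
  have dv: "word_tensor (spread (label \<circ> pinv v) id) \<star> bt_gw n q d = word_tensor (spread (label \<circ> pinv v) d)"
    if v: "v \<in> ?S" for v
  proof (rule ract_g_perm_spread[OF dp])
    fix a b' assume ab: "(a, b') \<in> inversion_set n d"
    then have r: "a \<in> {1..n}" "b' \<in> {1..n}" "a < b'" "d b' < d a" by (auto simp: inversion_set_def)
    have ne: "c a \<noteq> c b'"
      using d r unfolding standardizes_def by (metis less_asym)
    have vs: "v \<in> fam.stab c" using v by (simp add: fam.stab_def row_stabilizer_eq[OF total])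
    have pc: "c (pinv v x) = c x" for x by (rule fam.stab_pinv[OF vs])
    have pr: "pinv v a \<in> {1..n}" "pinv v b' \<in> {1..n}"
      using permutes_in_image[OF permutes_inv[OF vp[OF v]]] r by auto
    \<comment> \<open>An inversion of \<open>d\<close> involves two different positions. Within one
      component the row of \<open>a\<close> is then strictly earlier than that of \<open>b'\<close>,
      and \<open>pinv v\<close> preserves rows, so it cannot reverse the two.\<close>
    have "pinv v a < pinv v b'" if same: "snd (c a) = snd (c b')"
    proof (rule ccontr)
      assume "\<not> ?thesis"
      then have "pinv v b' \<le> pinv v a" by simp
      then have "fst (c b') \<le> fst (c a)"
        using initial_pos_mono[OF total pr(2,1)] same by (simp add: pc)
      moreover have "fst (c a) \<le> fst (c b')"
        using initial_pos_mono[OF total r(1,2)] r(3) same by simp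
      ultimately show False using ne same by (simp add: prod_eq_iff)
    qed
    then show "snd ((label \<circ> pinv v) a) \<noteq> snd ((label \<circ> pinv v) b') \<or>
        fst ((label \<circ> pinv v) a) < fst ((label \<circ> pinv v) b')"
      by (auto simp: label_def pc)
  qed
  have gw: "bt_gw n q d \<in> carrier Q" by (rule bt_gw_closed[OF dp])
  have "?u \<star> gen d = (?u \<star> row_sum n q \<nu>) \<star> bt_gw n q d"
  proof -
    have "gen d = (bt_idem n q (comp_partition \<nu>) \<otimes>\<^bsub>Q\<^esub> row_sum n q \<nu>) \<otimes>\<^bsub>Q\<^esub> bt_gw n q d"
      by (simp add: gen_eq[OF dp] perm_gen_def)
    then show ?thesis
      using ract_simps(2)[OF u _ gw, of "bt_idem n q (comp_partition \<nu>) \<otimes>\<^bsub>Q\<^esub> row_sum n q \<nu>"]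
        ract_simps(2)[OF u bt_idems_closed(2) rs] rs idem by (simp only: Q.m_closed bt_idems_closed)
  qed
  also have "\<dots> = (\<Sum>v\<in>?S. scale (q ^ perm_length n v)
      (word_tensor (spread (label \<circ> pinv v) id) \<star> bt_gw n q d))"
  proof -
    obtain p where p: "p \<in> carrier (free_algebra n)" "bt_gw n q d = bt_class n q p"
      using bt_class_surj[OF gw] .
    have w: "word_tensor (spread (label \<circ> pinv v) id) \<in> words" for v
      by (simp add: supported_closed)
    have s: "(\<Sum>v\<in>?S. scale (q ^ perm_length n v) (word_tensor (spread (label \<circ> pinv v) id))) \<in> words"
      by (intro supported_sum supported_closed(4) w)
    show ?thesis
      unfolding ur p ract_class[OF s] ract_class[OF w] linear_opD[OF linear_op_act_free_left] ..
  qed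
  also have "\<dots> = (\<Sum>v\<in>?S. scale (q ^ perm_length n v) (word_tensor (spread (label \<circ> pinv v) d)))"
    by (intro sum.cong refl) (simp only: dv)
  finally show ?thesis .
qed

text \<open>If two of the words agree, comparing labels gives
  \<open>pinv v (pinv d i) = pinv d' i\<close> at every place. As \<open>v\<close> preserves
  \<open>c\<close>, the letters of \<open>b\<close> and \<open>b'\<close> agree, hence
  \<open>d = d'\<close> and \<open>v = id\<close>, a term with coefficient
  \<open>q ^ 0\<close>.\<close>

lemma lookup_ract_label_gen:
  assumes d: "standardizes n c b d" and d': "standardizes n c b' d'"
  shows "Poly_Mapping.lookup (word_tensor (spread label id) \<star> gen d) (spread label d') = (if b = b' then 1 else 0)"
proof -
  let ?S = "row_stabilizer n \<nu>"
  have dp: "d permutes {1..n}" "d' permutes {1..n}" using d d' by (auto simp: standardizes_def)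
  have fin: "finite ?S"
    by (rule finite_subset[OF _ finite_permutations[of "{1..n}"]]) (auto simp: row_stabilizer_def)
  have eq_iff: "spread (label \<circ> pinv v) d = spread label d' \<longleftrightarrow> b = b' \<and> v = id" if v: "v \<in> ?S" for v
  proof
    assume eq: "spread (label \<circ> pinv v) d = spread label d'"
    have vp: "v permutes {1..n}" using v by (simp add: row_stabilizer_def)
    have vs: "v \<in> fam.stab c" using v by (simp add: fam.stab_def row_stabilizer_eq[OF total])
    have p: "pinv v (pinv d i) = pinv d' i" if i: "i \<in> {1..n}" for i
      using arg_cong[OF eq, of "\<lambda>xs. xs ! (i - 1)"] nth_spread[OF i, of label d']
        nth_spread[OF i, of "label \<circ> pinv v" d] by (simp add: label_def)
    have "b ! (i - 1) = b' ! (i - 1)" if i: "i \<in> {1..n}" for i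
      using letter_eq_pos[OF d i] letter_eq_pos[OF d' i] p[OF i] fam.stab_pinv[OF vs, of "pinv d i"] by simp
    then have "b = b'"
    proof -
      assume *: "\<And>i. i \<in> {1..n} \<Longrightarrow> b ! (i - 1) = b' ! (i - 1)"
      have "b ! i = b' ! i" if "i < n" for i using *[of "Suc i"] that by simp
      then show ?thesis using d d' by (intro nth_equalityI) (auto simp: standardizes_def)
    qed
    then have dd: "d = d'" using standardizes_unique d d' by blast
    have "pinv v x = x" for x
    proof (cases "x \<in> {1..n}")
      case True
      then have "d x \<in> {1..n}" using permutes_in_image[OF dp(1)] by simp
      from p[OF this] show ?thesis using permutes_inverses(2)[OF dp(1)] dd by simp
    next
      case False
      then show ?thesis using permutes_not_in[OF permutes_inv[OF vp]] by simp
    qed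
    then have "v = id" using permutes_inverses(1)[OF vp] by (metis eq_id_iff)
    then show "b = b' \<and> v = id" using \<open>b = b'\<close> by simp
  next
    assume "b = b' \<and> v = id"
    then have "d = d'" "v = id" using standardizes_unique d d' by blast+
    then show "spread (label \<circ> pinv v) d = spread label d'" by (simp add: comp_def inv_id)
  qed
  have id: "id \<in> ?S" by (simp add: row_stabilizer_def permutes_id)
  have len: "perm_length n id = 0"
    using perm_length_eq_inversions[OF permutes_id[of "{1..n}"]] by simp
  have "Poly_Mapping.lookup (word_tensor (spread label id) \<star> gen d) (spread label d') =
      (\<Sum>v\<in>?S. if v = id then (if b = b' then 1 else 0) else 0)"
    unfolding ract_label_gen[OF d] lookup_sum lookup_scale lookup_single
    by (intro sum.cong refl) (auto simp: eq_iff len when_def)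
  then show ?thesis using id fin by (simp add: sum.delta)
qed

text \<open>The coefficients of \<open>v\<close> reappear when \<open>Psi v\<close> is applied to
  the test tensor; this yields injectivity.\<close>

lemma lookup_ract_label_Psi:
  assumes v: "v \<in> weight_space" and b: "has_weight n \<nu> b"
  shows "Poly_Mapping.lookup (word_tensor (spread label id) \<star> Psi v) (spread label (std b)) =
    Poly_Mapping.lookup v b"
  using v
proof (induction v rule: supported_induct)
  case zero
  have u: "word_tensor (spread label id) \<in> words" by (simp add: supported_closed)
  show ?case by (simp only: Psi_simps ract_zero[OF u] lookup_zero)
next
  case (add a w u)
  have u: "word_tensor (spread label id) \<in> words" by (simp add: supported_closed)
  have eq: "word_tensor (spread label id) \<star> Psi (scale a (word_tensor w) + u) =
      scale a (word_tensor (spread label id) \<star> gen (std w)) + word_tensor (spread label id) \<star> Psi u"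
    unfolding Psi_simps(2,3,5)
    by (subst ract_simps(1)[OF u]) (simp_all add: Psi_simps ract_smult[OF u])
  show ?case
    unfolding eq lookup_add lookup_scale add(3)
      lookup_ract_label_gen[OF std_standardizes[OF add(1)] std_standardizes[OF b]] lookup_single
    by (simp add: when_def)
qed

lemma inj_on_Psi: "inj_on Psi weight_space"
proof (rule inj_onI)
  fix v v' assume v: "v \<in> weight_space" and v': "v' \<in> weight_space" and eq: "Psi v = Psi v'"
  show "v = v'"
  proof (rule poly_mapping_eqI)
    fix b
    show "Poly_Mapping.lookup v b = Poly_Mapping.lookup v' b"
    proof (cases "has_weight n \<nu> b")
      case True
      then show ?thesis using lookup_ract_label_Psi[OF v True] lookup_ract_label_Psi[OF v' True] eq by simp
    next
      case False
      then have "b \<notin> Poly_Mapping.keys v" "b \<notin> Poly_Mapping.keys v'"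
        using v v' by (auto simp: supported_def)
      then show ?thesis by (simp add: in_keys_iff)
    qed
  qed
qed

end

section \<open>Weights of words\<close>

text \<open>Yields the representative of a composition that \<open>multicomps\<close>
  admits.\<close>

definition strip_zeros :: "nat list \<Rightarrow> nat list"
  where "strip_zeros xs = rev (dropWhile ((=) 0) (rev xs))"

lemma strip_zeros_append:
  "\<exists>k. xs = strip_zeros xs @ replicate k 0"
proof -
  have "rev xs = takeWhile ((=) 0) (rev xs) @ dropWhile ((=) 0) (rev xs)" by simp
  then have "xs = strip_zeros xs @ rev (takeWhile ((=) 0) (rev xs))"
    unfolding strip_zeros_def by (metis rev_append rev_rev_ident)
  moreover have "takeWhile ((=) 0) ys = replicate (length (takeWhile ((=) 0) ys)) 0" for ys :: "nat list"
    by (induction ys) auto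
  ultimately show ?thesis by (metis rev_replicate)
qed

lemma strip_zeros_props:
  "length (strip_zeros xs) \<le> length xs" "sum_list (strip_zeros xs) = sum_list xs"
  "strip_zeros xs = [] \<or> last (strip_zeros xs) \<noteq> 0"
  "i < length xs \<Longrightarrow> (if i < length (strip_zeros xs) then strip_zeros xs ! i else 0) = xs ! i"
proof -
  obtain k where k: "xs = strip_zeros xs @ replicate k 0" using strip_zeros_append by blast
  show "length (strip_zeros xs) \<le> length xs" by (subst (2) k) simp
  show "sum_list (strip_zeros xs) = sum_list xs" by (subst (2) k) (simp add: sum_list_replicate)
  define ys where "ys = dropWhile ((=) 0) (rev xs)"
  have "ys = [] \<or> hd ys \<noteq> 0"
    using hd_dropWhile[of "(=) 0" "rev xs"] unfolding ys_def by metis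
  then show "strip_zeros xs = [] \<or> last (strip_zeros xs) \<noteq> 0"
    unfolding strip_zeros_def ys_def[symmetric] by (simp add: last_rev)
  assume i: "i < length xs"
  have "length xs = length (strip_zeros xs) + k" by (subst k) simp
  moreover have "xs ! i = (strip_zeros xs @ replicate k 0) ! i" by (subst k) simp
  ultimately show "(if i < length (strip_zeros xs) then strip_zeros xs ! i else 0) = xs ! i"
    using i by (simp add: nth_append)
qed

section \<open>Multicompositions as weights of words\<close>

lemma sum_list_map_upt: "sum_list (map f [1..<m+1]) = (\<Sum>i\<in>{1..m}. f i)" for f :: "nat \<Rightarrow> nat"
  by (induction m) auto

text \<open>Component \<open>p\<close> has the multiplicities of the letters
  \<open>(1, p), ..., (N, p)\<close> as its row lengths, and the total size counts all letters of
  \<open>w\<close>.\<close>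

lemma exists_multicomp_of_word:
  assumes w: "length w = n" "set w \<subseteq> {1..N} \<times> {1..r}"
  shows "\<exists>\<nu>\<in>multicomps r n N. has_weight n \<nu> w"
proof -
  define row where "row p = map (\<lambda>x. count (mset w) (x, p)) [1..<N+1]" for p
  define \<nu> where "\<nu> = map (\<lambda>p. strip_zeros (row p)) [1..<r+1]"
  have nth: "\<nu> ! (p - 1) = strip_zeros (row p)" if "p \<in> {1..r}" for p
    using that by (auto simp: \<nu>_def nth_append simp del: upt_Suc)
  have len: "length \<nu> = r" by (simp add: \<nu>_def del: upt_Suc)
  have row: "length (row p) = N" for p by (simp add: row_def del: upt_Suc)
  have zero: "count (mset w) (x, p) = 0" if "\<not> (x \<in> {1..N} \<and> p \<in> {1..r})" for x p
    using that w(2) by (auto simp: not_in_iff[symmetric] count_eq_zero_iff)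
  have weight: "weight \<nu> (x, p) = count (mset w) (x, p)" for x p
  proof (cases "x \<in> {1..N} \<and> p \<in> {1..r}")
    case True
    then have "row p ! (x - 1) = count (mset w) (x, p)"
      by (auto simp: row_def nth_append simp del: upt_Suc)
    moreover have "x - 1 < length (row p)" using True row by auto
    moreover have "x \<in> {1..length (strip_zeros (row p))} \<longleftrightarrow> x - 1 < length (strip_zeros (row p))"
      using True by auto
    ultimately show ?thesis
      using strip_zeros_props(4)[of "x - 1" "row p"] True nth[of p] by (auto simp: weight_def len)
  next
    case False
    have "x \<le> N" if "x \<in> {1..length (\<nu> ! (p - 1))}" "p \<in> {1..r}"
      using that nth[of p] strip_zeros_props(1)[of "row p"] row[of p] by auto
    then show ?thesis using False zero[OF False] by (auto simp: weight_def len)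
  qed
  have "sum_list (map sum_list \<nu>) = sum_list (map (\<lambda>p. sum_list (row p)) [1..<r+1])"
    by (simp add: \<nu>_def comp_def strip_zeros_props(2) del: upt_Suc)
  also have "\<dots> = (\<Sum>p\<in>{1..r}. \<Sum>x\<in>{1..N}. count (mset w) (x, p))"
    unfolding row_def sum_list_map_upt ..
  also have "\<dots> = (\<Sum>x\<in>{1..N}. \<Sum>p\<in>{1..r}. count (mset w) (x, p))" by (rule sum.swap)
  also have "\<dots> = (\<Sum>a\<in>{1..N} \<times> {1..r}. count (mset w) a)" by (simp add: sum.cartesian_product)
  also have "\<dots> = (\<Sum>a\<in>set w. count (mset w) a)"
    by (rule sum.mono_neutral_right) (use w(2) in \<open>auto simp: count_eq_zero_iff\<close>)
  also have "\<dots> = n" using w(1) size_multiset_overloaded_eq[of "mset w"] by simp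
  finally have "sum_list (map sum_list \<nu>) = n" .
  moreover have "length c \<le> N \<and> (c = [] \<or> last c \<noteq> 0)" if c: "c \<in> set \<nu>" for c
  proof -
    obtain p where "c = strip_zeros (row p)" using c by (auto simp: \<nu>_def simp del: upt_Suc)
    then show ?thesis using strip_zeros_props(1,3)[of "row p"] row[of p] by metis
  qed
  ultimately have "\<nu> \<in> multicomps r n N" by (simp add: multicomps_def len)
  moreover have "has_weight n \<nu> w" using weight w(1) by (auto simp: has_weight_def)
  ultimately show ?thesis by blast
qed

text \<open>A list without trailing zeros is determined by its extension by zeros: its last entry is
  nonzero, so neither of two such lists can be the longer one.\<close>

lemma weight_determines_multicomp:
  assumes \<nu>: "\<nu> \<in> multicomps r n N" and \<mu>: "\<mu> \<in> multicomps r n N" and eq: "weight \<nu> = weight \<mu>"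
  shows "\<nu> = \<mu>"
proof (rule nth_equalityI)
  have len: "length \<nu> = r" "length \<mu> = r" using \<nu> \<mu> by (auto simp: multicomps_def)
  show "length \<nu> = length \<mu>" using len by simp
  fix i assume i: "i < length \<nu>"
  define a b where "a = \<nu> ! i" and "b = \<mu> ! i"
  have last: "a = [] \<or> last a \<noteq> 0" "b = [] \<or> last b \<noteq> 0"
    using \<nu> \<mu> i len by (auto simp: multicomps_def a_def b_def)
  have ab: "(if x < length a then a ! x else 0) = (if x < length b then b ! x else 0)" for x
    using fun_cong[OF eq, of "(Suc x, Suc i)"] i len
    by (simp add: weight_def a_def b_def Suc_le_eq cong: if_cong)
  have le: "length a' \<le> length b'"
    if "a' = [] \<or> last a' \<noteq> 0" "\<And>x. (if x < length a' then a' ! x else 0) = (if x < length b' then b' ! x else 0)"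
    for a' b' :: "nat list"
  proof (rule ccontr)
    assume "\<not> ?thesis"
    then have *: "a' \<noteq> []" "\<not> length a' - 1 < length b'" by auto
    then have "a' ! (length a' - 1) = 0" using that(2)[of "length a' - 1"] by simp
    then show False using that(1) * by (simp add: last_conv_nth)
  qed
  have "length a = length b" using le[OF last(1) ab] le[OF last(2) ab[symmetric]] by simp
  moreover have "a ! x = b ! x" if "x < length a" for x
    using ab[of x] that calculation by simp
  ultimately have "a = b" by (intro nth_equalityI)
  then show "\<nu> ! i = \<mu> ! i" by (simp add: a_def b_def)
qed

lemma finite_multicomps: "finite (multicomps r n N)"
proof -
  let ?C = "{c. set c \<subseteq> {0..n} \<and> length c \<le> N}"
  have "multicomps r n N \<subseteq> {\<nu>. set \<nu> \<subseteq> ?C \<and> length \<nu> = r}"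
  proof
    fix \<nu> assume \<nu>: "\<nu> \<in> multicomps r n N"
    have "c \<in> ?C" if c: "c \<in> set \<nu>" for c
    proof -
      have "sum_list c \<le> n"
        using member_le_sum_list[of "sum_list c" "map sum_list \<nu>"] \<nu> c by (auto simp: multicomps_def)
      then have "x \<le> n" if "x \<in> set c" for x using member_le_sum_list[OF that] by simp
      then show ?thesis using \<nu> c by (auto simp: multicomps_def)
    qed
    then show "\<nu> \<in> {\<nu>. set \<nu> \<subseteq> ?C \<and> length \<nu> = r}" using \<nu> by (auto simp: multicomps_def)
  qed
  moreover have "finite {\<nu>. set \<nu> \<subseteq> ?C \<and> length \<nu> = r}"
    by (intro finite_lists_length_eq finite_lists_length_le) simp
  ultimately show ?thesis by (rule finite_subset)
qed

definition valid_word :: "nat \<Rightarrow> nat \<Rightarrow> nat \<Rightarrow> basis_index list \<Rightarrow> bool"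
  where "valid_word n r N w \<longleftrightarrow> length w = n \<and> set w \<subseteq> {1..N} \<times> {1..r}"

lemma has_weight_valid_word:
  assumes \<nu>: "\<nu> \<in> multicomps r n N" and w: "has_weight n \<nu> w"
  shows "valid_word n r N w"
proof -
  have "a \<in> {1..N} \<times> {1..r}" if "a \<in> set w" for a
  proof -
    obtain x p where a: "a = (x, p)" by (cases a)
    have "count (mset w) (x, p) \<noteq> 0" using that by (simp add: a count_eq_zero_iff)
    then have "weight \<nu> (x, p) \<noteq> 0" using w by (metis has_weight_def)
    then have p: "p \<in> {1..length \<nu>}" "x \<in> {1..length (\<nu> ! (p - 1))}"
      by (auto simp: weight_def split: if_splits)
    moreover have "\<nu> ! (p - 1) \<in> set \<nu>" using p by auto
    ultimately show ?thesis using \<nu> by (auto simp: multicomps_def a)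
  qed
  then show ?thesis using w by (auto simp: valid_word_def has_weight_def)
qed

definition word_type :: "nat \<Rightarrow> basis_index list \<Rightarrow> nat list"
  where "word_type n w = sp_type (fibre_partition n (\<lambda>j. snd (w ! (j - 1))))"

lemma word_type_of_weight:
  assumes sz: "sum_list (map sum_list \<nu>) = n" and w: "has_weight n \<nu> w"
  shows "word_type n w = sp_type (comp_partition \<nu>)"
proof -
  obtain d where d: "standardizes n (initial_pos \<nu>) w d"
    using has_weight_standardizes[OF sz w] by blast
  have dp: "d permutes {1..n}" using d by (simp add: standardizes_def)
  have "snd (w ! (i - 1)) = (snd \<circ> initial_pos \<nu> \<circ> pinv d) i" if i: "i \<in> {1..n}" for i
  proof -
    have "pinv d i \<in> {1..n}" using permutes_in_image[OF permutes_inv[OF dp]] i by simp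
    then have "w ! (d (pinv d i) - 1) = initial_pos \<nu> (pinv d i)"
      using d unfolding standardizes_def by blast
    then show ?thesis using permutes_inverses(1)[OF dp] by simp
  qed
  then have "fibre_partition n (\<lambda>j. snd (w ! (j - 1))) = fibre_partition n (snd \<circ> initial_pos \<nu> \<circ> pinv d)"
    by (rule fibre_partition_cong)
  then show ?thesis
    by (simp only: word_type_def sp_type_fibre_partition_pinv[OF dp] comp_partition_eq[OF sz])
qed

section \<open>Module structures\<close>

lemma bt_block_simps [simp]:
  "carrier (bt_block n q \<alpha>) = (\<lambda>a. bt_central_idem n q \<alpha> \<otimes>\<^bsub>bt_quot n q\<^esub> a) ` carrier (bt_quot n q)"
  "monoid.mult (bt_block n q \<alpha>) = monoid.mult (bt_quot n q)"
  "one (bt_block n q \<alpha>) = bt_central_idem n q \<alpha>"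
  "add (bt_block n q \<alpha>) = add (bt_quot n q)"
  "c \<odot>\<^bsub>bt_block n q \<alpha>\<^esub> a = bt_class n q (free_const c) \<otimes>\<^bsub>bt_quot n q\<^esub> a"
  by (simp_all add: bt_block_def bt_algebra_def Let_def)

lemma perm_module_simps [simp]:
  "zero (perm_module n q \<nu>) = zero (bt_quot n q)"
  "add (perm_module n q \<nu>) = add (bt_quot n q)"
  "c \<odot>\<^bsub>perm_module n q \<nu>\<^esub> a = bt_class n q (free_const c) \<otimes>\<^bsub>bt_quot n q\<^esub> a"
  "m \<lhd>\<^bsub>perm_module n q \<nu>\<^esub> a = m \<otimes>\<^bsub>bt_quot n q\<^esub> a"
  by (simp_all add: perm_module_def Let_def)

lemma tensor_space_simps [simp]:
  "carrier (tensor_space n q r N) = {v. \<forall>w\<in>Poly_Mapping.keys v. valid_word n r N w}"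
  "zero (tensor_space n q r N) = 0"
  "add (tensor_space n q r N) = (+)"
  "c \<odot>\<^bsub>tensor_space n q r N\<^esub> v = scale c v"
  "v \<lhd>\<^bsub>tensor_space n q r N\<^esub> a = the_elem (act_free q v ` a)"
  by (simp_all add: tensor_space_def valid_word_def)

lemma block_tensor_space_simps [simp]:
  "zero (block_tensor_space n q r N \<alpha>) = 0"
  "add (block_tensor_space n q r N \<alpha>) = (+)"
  "c \<odot>\<^bsub>block_tensor_space n q r N \<alpha>\<^esub> v = scale c v"
  "v \<lhd>\<^bsub>block_tensor_space n q r N \<alpha>\<^esub> a = the_elem (act_free q v ` a)"
  by (simp_all add: block_tensor_space_def tensor_space_def)

lemma scalars_simps [simp]:
  "carrier (scalars :: 's::comm_ring_1 ring) = UNIV" "monoid.mult (scalars :: 's ring) = (*)"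
  "one (scalars :: 's ring) = 1" "zero (scalars :: 's ring) = 0" "add (scalars :: 's ring) = (+)"
  by (simp_all add: ring_of_type_algebra_def)

lemma direct_sum_simps [simp]:
  "finite I \<Longrightarrow> carrier (direct_sum I M) = (\<Pi>\<^sub>E i\<in>I. carrier (M i))"
  "zero (direct_sum I M) = (\<lambda>i\<in>I. \<zero>\<^bsub>M i\<^esub>)"
  "f \<oplus>\<^bsub>direct_sum I M\<^esub> f' = (\<lambda>i\<in>I. f i \<oplus>\<^bsub>M i\<^esub> f' i)"
  "c \<odot>\<^bsub>direct_sum I M\<^esub> f = (\<lambda>i\<in>I. c \<odot>\<^bsub>M i\<^esub> f i)"
  "f \<lhd>\<^bsub>direct_sum I M\<^esub> a = (\<lambda>i\<in>I. f i \<lhd>\<^bsub>M i\<^esub> a)"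
  by (auto simp: direct_sum_def)

text \<open>Finiteness of \<open>I\<close> turns the carrier into the full product, on which every
  axiom holds componentwise.\<close>

lemma unital_right_module_direct_sum:
  assumes fin: "finite I" and M: "\<And>i. i \<in> I \<Longrightarrow> unital_right_module A (M i)"
  shows "unital_right_module A (direct_sum I M)"
proof -
  have R: "right_module A (M i)" if "i \<in> I" for i
    using M[OF that] by (simp add: unital_right_module_def)
  have mod: "module scalars (M i)" if "i \<in> I" for i
    using R[OF that] by (rule right_module.scalar_module)
  have ab: "abelian_group (M i)" if "i \<in> I" for i
    using mod[OF that] by (rule module.axioms(2))
  note mon = abelian_group.axioms(1)[OF ab]
  have eqI: "f = f'" if "f \<in> (\<Pi>\<^sub>E i\<in>I. carrier (M i))" "f' \<in> (\<Pi>\<^sub>E i\<in>I. carrier (M i))"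
    "\<And>i. i \<in> I \<Longrightarrow> f i = f' i" for f f'
    using that by (rule PiE_ext)
  have mem: "f i \<in> carrier (M i)" if "f \<in> (\<Pi>\<^sub>E i\<in>I. carrier (M i))" "i \<in> I" for f i
    using that by (rule PiE_mem)
  have "abelian_group (direct_sum I M)"
  proof (rule abelian_groupI)
    fix f assume f: "f \<in> carrier (direct_sum I M)"
    then have f': "f \<in> (\<Pi>\<^sub>E i\<in>I. carrier (M i))" using fin by simp
    show "\<exists>h\<in>carrier (direct_sum I M). h \<oplus>\<^bsub>direct_sum I M\<^esub> f = \<zero>\<^bsub>direct_sum I M\<^esub>"
      using f' fin abelian_group.a_inv_closed[OF ab] abelian_group.l_neg[OF ab]
      by (intro bexI[of _ "\<lambda>i\<in>I. \<ominus>\<^bsub>M i\<^esub> f i"]) (auto intro!: restrict_ext simp: mem[OF f'])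
    show "\<zero>\<^bsub>direct_sum I M\<^esub> \<oplus>\<^bsub>direct_sum I M\<^esub> f = f"
      using f' abelian_monoid.l_zero[OF mon] abelian_monoid.zero_closed[OF mon]
      by (intro eqI) (auto simp: mem[OF f'])
  qed (use fin mem abelian_monoid.a_closed[OF mon] abelian_monoid.zero_closed[OF mon]
      abelian_monoid.a_assoc[OF mon] abelian_monoid.a_comm[OF mon] in
      \<open>auto intro!: restrict_ext\<close>)
  then have "module scalars (direct_sum I M)"
    by (intro moduleI cring_from_type_algebra)
      (use fin mem mod in \<open>auto intro!: restrict_ext eqI abelian_monoid.a_closed[OF mon]
          simp: module.smult_closed module.smult_l_distr module.smult_r_distr module.smult_assoc1 module.smult_one
          module.smult_assoc1[of scalars, simplified] module.smult_one[of scalars, simplified]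
          module.smult_l_distr[of scalars, simplified] module.smult_closed[of scalars, simplified]
          module.smult_r_distr[of scalars, simplified]\<close>)
  then have "right_module A (direct_sum I M)"
    by (rule right_module.intro)
      (use fin mem R in \<open>auto intro!: restrict_ext right_module.act_closed
          simp: right_module.act_add_left[of A] right_module.act_add_right right_module.act_mult
          right_module.act_smult_left[of A] right_module.act_smult_right right_module.act_closed\<close>)
  then show ?thesis
    using fin mem unital_right_module.act_one[OF M]
    by (auto simp: unital_right_module_def unital_right_module_axioms_def intro!: eqI)
qed

section \<open>Spans of words as modules over the block algebra\<close>

context bt_unit
begin

lemma stable_valid_word: "stable (valid_word n r N)"
proof -
  have "set (swap_at k w) = set w" if "k \<in> {1..<n}" "length w = n" for k and w :: "basis_index list"
    using mset_swap_at[of k w] that by (metis atLeastLessThan_iff mset_eq_setD)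
  then show ?thesis by (auto simp: stable_def valid_word_def)
qed

lemma carrier_tensor_space: "carrier (tensor_space n q r N) = supported (valid_word n r N)"
  by (simp add: supported_def)

lemma word_type_swap_at:
  assumes w: "length w = n" and k: "k \<in> {1..<n}"
  shows "word_type n (swap_at k w) = word_type n w"
proof -
  let ?s = "\<lambda>j. snd (w ! (j - 1))"
  have "comps_of ?s w" using w by (simp add: comps_of_def)
  from comps_of_swap_at[OF this k] have "snd (swap_at k w ! (j - 1)) = (?s \<circ> adj k) j" if "j \<in> {1..n}" for j
    using that unfolding comps_of_def by blast
  then have "fibre_partition n (\<lambda>j. snd (swap_at k w ! (j - 1))) = fibre_partition n (?s \<circ> adj k)"
    by (rule fibre_partition_cong)
  moreover have "pinv (adj k) = adj k" by simp
  ultimately show ?thesis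
    using sp_type_fibre_partition_pinv[OF adj_permutes[OF k], of ?s] by (simp only: word_type_def)
qed

definition typed_word :: "nat \<Rightarrow> nat \<Rightarrow> nat list \<Rightarrow> basis_index list \<Rightarrow> bool"
  where "typed_word r N \<alpha> w \<longleftrightarrow> valid_word n r N w \<and> word_type n w = \<alpha>"

lemma stable_typed_word: "stable (typed_word r N \<alpha>)"
  using stable_valid_word[of r N] word_type_swap_at
  by (auto simp: stable_def typed_word_def simp del: atLeastLessThan_iff)

lemma ract_central_idem_word:
  assumes "length w = n"
  shows "word_tensor w \<star> bt_central_idem n q \<alpha> = (if word_type n w = \<alpha> then word_tensor w else 0)"
proof -
  have "comps_of (\<lambda>j. snd (w ! (j - 1))) w" using assms by (simp add: comps_of_def)
  then have "word_tensor w \<in> supported (comps_of (\<lambda>j. snd (w ! (j - 1))))"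
    by (rule supported_closed)
  from ract_bt_central_idem[OF this] show ?thesis by (simp only: word_type_def)
qed

lemma supported_words: "stable P \<Longrightarrow> supported P \<subseteq> words"
  by (rule supported_mono) (auto simp: stable_def)

lemma ract_central_idem_typed:
  assumes "v \<in> supported (typed_word r N \<alpha>)"
  shows "v \<star> bt_central_idem n q \<alpha> = v"
  using assms
proof (induction v rule: supported_induct)
  case zero
  show ?case
    using ract_left(2)[OF supported_closed(1) supported_closed(1) bt_idems_closed(3), of 0] by simp
next
  case (add a w u)
  have w: "length w = n" "word_type n w = \<alpha>" using add(1) by (auto simp: typed_word_def valid_word_def)
  have t: "word_tensor w \<in> words" using w by (simp add: supported_closed)
  have u: "u \<in> words" using add(2) supported_words[OF stable_typed_word] by blast
  show ?case
    unfolding ract_left(1)[OF supported_closed(4)[OF t] u bt_idems_closed(3)]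
      ract_left(2)[OF t t bt_idems_closed(3)] add(3) ract_central_idem_word[OF w(1)] w(2) if_P[OF refl] ..
qed

text \<open>The central idempotent fixes a word of type \<alpha> and kills every other one, so its
  image is spanned by the words it fixes.\<close>

lemma carrier_block_tensor_space:
  "carrier (block_tensor_space n q r N \<alpha>) = supported (typed_word r N \<alpha>)"
proof
  have "v \<star> bt_central_idem n q \<alpha> \<in> supported (typed_word r N \<alpha>)" if "v \<in> supported (valid_word n r N)" for v
    using that
  proof (induction v rule: supported_induct)
    case zero
    have "0 \<star> bt_central_idem n q \<alpha> = 0"
      using ract_left(2)[OF supported_closed(1) supported_closed(1) bt_idems_closed(3), of 0] by simp
    then show ?case by (simp only: supported_closed(1))
  next
    case (add a w u)
    have w: "length w = n" using add(1) by (auto simp: valid_word_def)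
    have t: "word_tensor w \<in> words" using w by (simp add: supported_closed)
    have u: "u \<in> words" using add(2) supported_words[OF stable_valid_word] by blast
    have "(if word_type n w = \<alpha> then word_tensor w else 0) \<in> supported (typed_word r N \<alpha>)"
      using add(1) by (simp add: supported_closed typed_word_def)
    then show ?case
      unfolding ract_left(1)[OF supported_closed(4)[OF t] u bt_idems_closed(3)]
        ract_left(2)[OF t t bt_idems_closed(3)] ract_central_idem_word[OF w]
      by (intro supported_closed add(3))
  qed
  then show "carrier (block_tensor_space n q r N \<alpha>) \<subseteq> supported (typed_word r N \<alpha>)"
    by (auto simp: block_tensor_space_def tensor_space_def supported_def[of "valid_word n r N"] valid_word_def)
  show "supported (typed_word r N \<alpha>) \<subseteq> carrier (block_tensor_space n q r N \<alpha>)"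
  proof
    fix v assume v: "v \<in> supported (typed_word r N \<alpha>)"
    then have "v \<in> carrier (tensor_space n q r N)"
      using supported_mono[of "typed_word r N \<alpha>" "valid_word n r N"]
      unfolding carrier_tensor_space by (auto simp: typed_word_def)
    then show "v \<in> carrier (block_tensor_space n q r N \<alpha>)"
      using ract_central_idem_typed[OF v]
      by (auto simp: block_tensor_space_def simp del: tensor_space_simps(1) intro: image_eqI[of _ _ v])
  qed
qed

lemma block_closed: "a \<in> carrier (bt_block n q \<alpha>) \<Longrightarrow> a \<in> carrier Q"
  by auto

text \<open>Stated for an arbitrary record with these operations, since the tensor space and its
  block part differ in the carrier only.\<close>

lemma right_module_supported:
  fixes L :: "('s, 's tensor, 's bt_free set) right_module"
  assumes P: "stable P" and L: "carrier L = supported P" "zero L = 0" "add L = (+)"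
    "\<And>c v. c \<odot>\<^bsub>L\<^esub> v = scale c v" "\<And>v a. v \<lhd>\<^bsub>L\<^esub> a = v \<star> a"
  shows "right_module (bt_block n q \<alpha>) L"
proof -
  have w: "v \<in> words" if "v \<in> supported P" for v using that supported_words[OF P] by blast
  have "abelian_group L"
  proof (rule abelian_groupI)
    show "\<exists>u\<in>carrier L. u \<oplus>\<^bsub>L\<^esub> v = \<zero>\<^bsub>L\<^esub>" if "v \<in> carrier L" for v
      using that supported_closed(3)[OF supported_closed(1), of v P]
      by (intro bexI[of _ "0 - v"]) (simp_all add: L)
  qed (simp_all add: L supported_closed add_ac)
  then have "module scalars L"
    by (intro moduleI cring_from_type_algebra) (simp_all add: L supported_closed scale_distrib)
  then show ?thesis
  proof (rule right_module.intro)
    fix m m' a b c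
    assume m: "m \<in> carrier L" and a: "a \<in> carrier (bt_block n q \<alpha>)"
    have aQ: "a \<in> carrier Q" by (rule block_closed[OF a])
    have mw: "m \<in> words" using m w by (simp add: L)
    show "m \<lhd>\<^bsub>L\<^esub> a \<in> carrier L" using m ract_supported[OF P _ aQ] by (simp add: L)
    show "(c \<odot>\<^bsub>L\<^esub> m) \<lhd>\<^bsub>L\<^esub> a = c \<odot>\<^bsub>L\<^esub> (m \<lhd>\<^bsub>L\<^esub> a)"
      unfolding L by (rule ract_left(2)[OF mw mw aQ])
    show "m \<lhd>\<^bsub>L\<^esub> (c \<odot>\<^bsub>bt_block n q \<alpha>\<^esub> a) = c \<odot>\<^bsub>L\<^esub> (m \<lhd>\<^bsub>L\<^esub> a)"
      unfolding L bt_block_simps by (rule ract_smult[OF mw aQ])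
    show "(m \<oplus>\<^bsub>L\<^esub> m') \<lhd>\<^bsub>L\<^esub> a = (m \<lhd>\<^bsub>L\<^esub> a) \<oplus>\<^bsub>L\<^esub> (m' \<lhd>\<^bsub>L\<^esub> a)" if "m' \<in> carrier L"
      unfolding L using ract_left(1)[OF mw w aQ, of m'] that by (simp add: L)
    assume b: "b \<in> carrier (bt_block n q \<alpha>)"
    have bQ: "b \<in> carrier Q" by (rule block_closed[OF b])
    show "m \<lhd>\<^bsub>L\<^esub> (a \<oplus>\<^bsub>bt_block n q \<alpha>\<^esub> b) = (m \<lhd>\<^bsub>L\<^esub> a) \<oplus>\<^bsub>L\<^esub> (m \<lhd>\<^bsub>L\<^esub> b)"
      unfolding L bt_block_simps by (rule ract_simps(1)[OF mw aQ bQ])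
    show "m \<lhd>\<^bsub>L\<^esub> (a \<otimes>\<^bsub>bt_block n q \<alpha>\<^esub> b) = m \<lhd>\<^bsub>L\<^esub> a \<lhd>\<^bsub>L\<^esub> b"
      unfolding L bt_block_simps by (rule ract_simps(2)[OF mw aQ bQ])
  qed
qed

lemma right_module_tensor_space: "right_module (bt_block n q \<alpha>) (tensor_space n q r N)"
  by (rule right_module_supported[OF stable_valid_word carrier_tensor_space]) simp_all

lemma unital_right_module_block_tensor_space:
  "unital_right_module (bt_block n q \<alpha>) (block_tensor_space n q r N \<alpha>)"
proof -
  have "right_module (bt_block n q \<alpha>) (block_tensor_space n q r N \<alpha>)"
    by (rule right_module_supported[OF stable_typed_word carrier_block_tensor_space]) simp_all
  then show ?thesis
    unfolding unital_right_module_def unital_right_module_axioms_def carrier_block_tensor_space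
    by (simp add: ract_central_idem_typed)
qed

end

context bt_weight
begin

lemma perm_module_closed: "m \<in> carrier (perm_module n q \<nu>) \<Longrightarrow> m \<in> carrier Q"
  unfolding carrier_perm_module_Psi by (auto simp: Psi_simps)

text \<open>Closure properties are transported from the weight space along \<open>Psi\<close>, and
  the remaining axioms are ring identities of the quotient.\<close>

lemma unital_right_module_perm_module:
  "unital_right_module (bt_block n q (sp_type (comp_partition \<nu>))) (perm_module n q \<nu>)"
proof -
  let ?M = "perm_module n q \<nu>" and ?\<alpha> = "sp_type (comp_partition \<nu>)"
  note cM = carrier_perm_module_Psi
  have closed: "u \<oplus>\<^bsub>Q\<^esub> v \<in> carrier ?M" "bt_class n q (free_const a) \<otimes>\<^bsub>Q\<^esub> u \<in> carrier ?M"
    if "u \<in> carrier ?M" "v \<in> carrier ?M" for u v a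
  proof -
    obtain x y where xy: "x \<in> weight_space" "y \<in> weight_space" "u = Psi x" "v = Psi y"
      using \<open>u \<in> carrier ?M\<close> \<open>v \<in> carrier ?M\<close> unfolding cM by auto
    show "u \<oplus>\<^bsub>Q\<^esub> v \<in> carrier ?M" "bt_class n q (free_const a) \<otimes>\<^bsub>Q\<^esub> u \<in> carrier ?M"
      unfolding xy cM Psi_simps(2,3)[symmetric]
      by (intro imageI supported_closed xy(1,2))+
  qed
  have zero: "\<zero>\<^bsub>Q\<^esub> \<in> carrier ?M"
    unfolding cM Psi_simps(4)[symmetric] by (intro imageI supported_closed)
  have sc: "bt_class n q (free_const a) \<in> carrier Q" for a by simp
  have one: "bt_class n q (free_const 1) = \<one>\<^bsub>Q\<^esub>" by (simp add: free_const_mult)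
  have add: "bt_class n q (free_const (a + b)) = bt_class n q (free_const a) \<oplus>\<^bsub>Q\<^esub> bt_class n q (free_const b)"
    "bt_class n q (free_const (a * b)) = bt_class n q (free_const a) \<otimes>\<^bsub>Q\<^esub> bt_class n q (free_const b)" for a b
    by (simp_all add: bt_class_arith flip: free_const_mult)
  have "abelian_group ?M"
  proof (rule abelian_groupI)
    show "\<exists>u\<in>carrier ?M. u \<oplus>\<^bsub>?M\<^esub> v = \<zero>\<^bsub>?M\<^esub>" if v: "v \<in> carrier ?M" for v
    proof -
      obtain x where x: "x \<in> weight_space" "v = Psi x" using v unfolding cM by auto
      have "Psi (0 - x) \<oplus>\<^bsub>Q\<^esub> Psi x = \<zero>\<^bsub>Q\<^esub>"
        unfolding Psi_simps(2,4)[symmetric] by simp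
      moreover have "Psi (0 - x) \<in> carrier ?M"
        unfolding cM by (intro imageI supported_closed x)
      ultimately show ?thesis using x by auto
    qed
  qed (use closed zero perm_module_closed in \<open>simp_all add: Q.a_assoc Q.a_comm Q.a_lcomm\<close>)
  then have "module scalars ?M"
    by (intro moduleI cring_from_type_algebra)
      (use closed perm_module_closed sc in \<open>simp_all add: one add Q.l_distr Q.r_distr Q.m_assoc\<close>)
  then have "right_module (bt_block n q ?\<alpha>) ?M"
  proof (rule right_module.intro)
    fix m m' a b s
    assume m: "m \<in> carrier ?M" and a: "a \<in> carrier (bt_block n q ?\<alpha>)"
    have aQ: "a \<in> carrier Q" by (rule block_closed[OF a])
    have mQ: "m \<in> carrier Q" by (rule perm_module_closed[OF m])
    obtain x where x: "x \<in> weight_space" "m = Psi x" using m unfolding cM by auto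
    show "m \<lhd>\<^bsub>?M\<^esub> a \<in> carrier ?M"
      unfolding perm_module_simps cM x(2) Psi_act[OF x(1) aQ]
      by (intro imageI ract_supported[OF stable_has_weight x(1) aQ])
    show "(s \<odot>\<^bsub>?M\<^esub> m) \<lhd>\<^bsub>?M\<^esub> a = s \<odot>\<^bsub>?M\<^esub> (m \<lhd>\<^bsub>?M\<^esub> a)"
      unfolding perm_module_simps by (rule Q.m_assoc[OF sc mQ aQ])
    show "m \<lhd>\<^bsub>?M\<^esub> (s \<odot>\<^bsub>bt_block n q ?\<alpha>\<^esub> a) = s \<odot>\<^bsub>?M\<^esub> (m \<lhd>\<^bsub>?M\<^esub> a)"
      unfolding perm_module_simps bt_block_simps Q.m_assoc[OF mQ sc aQ, symmetric]
        Q.m_assoc[OF sc mQ aQ, symmetric] bt_scalar_central[OF mQ] ..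
    show "(m \<oplus>\<^bsub>?M\<^esub> m') \<lhd>\<^bsub>?M\<^esub> a = (m \<lhd>\<^bsub>?M\<^esub> a) \<oplus>\<^bsub>?M\<^esub> (m' \<lhd>\<^bsub>?M\<^esub> a)" if "m' \<in> carrier ?M"
      unfolding perm_module_simps by (rule Q.l_distr[OF mQ perm_module_closed[OF that] aQ])
    assume b: "b \<in> carrier (bt_block n q ?\<alpha>)"
    have bQ: "b \<in> carrier Q" by (rule block_closed[OF b])
    show "m \<lhd>\<^bsub>?M\<^esub> (a \<oplus>\<^bsub>bt_block n q ?\<alpha>\<^esub> b) = (m \<lhd>\<^bsub>?M\<^esub> a) \<oplus>\<^bsub>?M\<^esub> (m \<lhd>\<^bsub>?M\<^esub> b)"
      unfolding perm_module_simps bt_block_simps by (rule Q.r_distr[OF aQ bQ mQ])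
    show "m \<lhd>\<^bsub>?M\<^esub> (a \<otimes>\<^bsub>bt_block n q ?\<alpha>\<^esub> b) = m \<lhd>\<^bsub>?M\<^esub> a \<lhd>\<^bsub>?M\<^esub> b"
      unfolding perm_module_simps bt_block_simps by (rule Q.m_assoc[OF mQ aQ bQ, symmetric])
  qed
  moreover have "m \<otimes>\<^bsub>Q\<^esub> bt_central_idem n q ?\<alpha> = m" if m: "m \<in> carrier ?M" for m
  proof -
    obtain x where x: "x \<in> weight_space" "m = Psi x" using m unfolding cM by auto
    from x(1) have "x \<star> bt_central_idem n q ?\<alpha> = x"
    proof (induction x rule: supported_induct)
      case zero
      show ?case
        using ract_left(2)[OF supported_closed(1) supported_closed(1) bt_idems_closed(3), of 0] by simp
    next
      case (add s w u)
      have w: "length w = n" "word_type n w = ?\<alpha>"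
        using add(1) word_type_of_weight[OF total add(1)] by (simp_all add: has_weight_def)
      have t: "word_tensor w \<in> words" using w by (simp add: supported_closed)
      show ?case
        unfolding ract_left(1)[OF supported_closed(4)[OF t] weight_space_words[OF add(2)] bt_idems_closed(3)]
          ract_left(2)[OF t t bt_idems_closed(3)] add(3) ract_central_idem_word[OF w(1)] w(2) if_P[OF refl] ..
    qed
    then show ?thesis unfolding x(2) Psi_act[OF x(1) bt_idems_closed(3)] by simp
  qed
  ultimately show ?thesis
    by (simp add: unital_right_module_def unital_right_module_axioms_def)
qed

end

section \<open>The embedding and the direct sum decomposition\<close>

context bt_weight
begin

lemma tensor_basis_eq: "tensor_basis n \<nu> t = word_tensor (tableau_word n \<nu> t)"
  by (simp add: tensor_basis_def)

lemma Psi_word_is_perm_basis: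
  assumes "has_weight n \<nu> w"
  shows "\<exists>t\<in>RStd n \<nu>. Psi (word_tensor w) = perm_basis n q \<nu> t \<and> word_tensor w = tensor_basis n \<nu> t"
proof -
  obtain t where "t \<in> RStd n \<nu>" "tableau_word n \<nu> t = w"
    using exists_tableau_of_word[OF assms] by blast
  then show ?thesis
    by (intro bexI[of _ t]) (simp_all only: Psi_simps perm_basis_eq tensor_basis_eq)
qed

text \<open>Restricted to the carrier because \<open>is_iota\<close> asks for an extensional
  function; only so can the description by \<open>THE\<close> be unique.\<close>

definition Psi_inv :: "'a bt_free set \<Rightarrow> 'a tensor"
  where "Psi_inv = (\<lambda>m\<in>carrier (perm_module n q \<nu>). inv_into weight_space Psi m)"

lemma Psi_inv_Psi: "v \<in> weight_space \<Longrightarrow> Psi_inv (Psi v) = v"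
  by (simp add: Psi_inv_def carrier_perm_module_Psi inv_into_f_f[OF inj_on_Psi])

lemma weight_space_tensor_space:
  assumes "\<nu> \<in> multicomps r n N"
  shows "weight_space \<subseteq> carrier (tensor_space n q r N)"
  unfolding carrier_tensor_space by (rule supported_mono) (rule has_weight_valid_word[OF assms])

lemma is_iota_Psi_inv:
  assumes mc: "\<nu> \<in> multicomps r n N"
  shows "is_iota n q r N \<nu> Psi_inv"
proof -
  have "Psi_inv \<in> linear_maps (perm_module n q \<nu>) (tensor_space n q r N)"
    unfolding linear_maps_def
  proof (intro CollectI conjI funcsetI ballI allI)
    fix m a assume "m \<in> carrier (perm_module n q \<nu>)"
    then obtain v where v: "v \<in> weight_space" "m = Psi v" by (auto simp: carrier_perm_module_Psi)
    show "Psi_inv m \<in> carrier (tensor_space n q r N)"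
      unfolding v Psi_inv_Psi[OF v(1)] using v weight_space_tensor_space[OF mc] by blast
    show "Psi_inv (a \<odot>\<^bsub>perm_module n q \<nu>\<^esub> m) = a \<odot>\<^bsub>tensor_space n q r N\<^esub> Psi_inv m"
      unfolding v perm_module_simps tensor_space_simps Psi_simps(3)[symmetric]
        Psi_inv_Psi[OF v(1)] Psi_inv_Psi[OF supported_closed(4)[OF v(1)]] ..
    fix m' assume "m' \<in> carrier (perm_module n q \<nu>)"
    then obtain v' where v': "v' \<in> weight_space" "m' = Psi v'" by (auto simp: carrier_perm_module_Psi)
    show "Psi_inv (m \<oplus>\<^bsub>perm_module n q \<nu>\<^esub> m') = Psi_inv m \<oplus>\<^bsub>tensor_space n q r N\<^esub> Psi_inv m'"
      unfolding v v' perm_module_simps tensor_space_simps Psi_simps(2)[symmetric]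
        Psi_inv_Psi[OF v(1)] Psi_inv_Psi[OF v'(1)] Psi_inv_Psi[OF supported_closed(2)[OF v(1) v'(1)]] ..
  qed
  moreover have "Psi_inv (perm_basis n q \<nu> t) = tensor_basis n \<nu> t" if t: "t \<in> RStd n \<nu>" for t
  proof -
    have "word_tensor (tableau_word n \<nu> t) \<in> weight_space"
      using t by (intro supported_closed tableau_word_has_weight) (simp add: RStd_def)
    from Psi_inv_Psi[OF this] show ?thesis
      by (simp only: Psi_simps perm_basis_eq[OF t] tensor_basis_eq)
  qed
  ultimately show ?thesis by (simp add: is_iota_def Psi_inv_def)
qed

text \<open>The elements \<open>perm_basis\<close> span the module: every word of the given weight
  comes from a row standard tableau, and \<open>Psi\<close> is onto.\<close>

lemma is_iota_unique:
  assumes f: "is_iota n q r N \<nu> f"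
  shows "f = Psi_inv"
proof -
  have lin: "\<lbrakk>m \<in> carrier (perm_module n q \<nu>); m' \<in> carrier (perm_module n q \<nu>)\<rbrakk> \<Longrightarrow>
      f (m \<oplus>\<^bsub>Q\<^esub> m') = f m + f m'"
    "m \<in> carrier (perm_module n q \<nu>) \<Longrightarrow> f (bt_class n q (free_const a) \<otimes>\<^bsub>Q\<^esub> m) = scale a (f m)"
    for m m' a
    using f unfolding is_iota_def linear_maps_def by auto
  have mem: "Psi v \<in> carrier (perm_module n q \<nu>)" if "v \<in> weight_space" for v
    using that by (auto simp: carrier_perm_module_Psi)
  have Psi: "f (Psi v) = v" if "v \<in> weight_space" for v
    using that
  proof (induction v rule: supported_induct)
    case zero
    \<comment> \<open>Membership in \<open>linear_maps\<close> gives the value at zero only through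
      multiplication by the scalar 0.\<close>
    have "f (Psi (scale 0 0)) = scale 0 (f (Psi 0))"
      unfolding Psi_simps(3) by (rule lin(2)) (intro mem supported_closed)+
    then show ?case by simp
  next
    case (add a w u)
    have w: "word_tensor w \<in> weight_space" using add(1) by (rule supported_closed)
    have "f (Psi (word_tensor w)) = word_tensor w"
      using Psi_word_is_perm_basis[OF add(1)] f unfolding is_iota_def by metis
    moreover have "f (Psi (scale a (word_tensor w) + u)) = f (Psi (scale a (word_tensor w))) + f (Psi u)"
      unfolding Psi_simps(2) by (rule lin(1)) (intro mem supported_closed w add(2))+
    moreover have "f (Psi (scale a (word_tensor w))) = scale a (f (Psi (word_tensor w)))"
      unfolding Psi_simps(3) by (rule lin(2)) (intro mem w)+
    ultimately show ?case using add(3) by (simp only:)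
  qed
  show ?thesis
  proof (rule extensionalityI)
    show "f \<in> extensional (carrier (perm_module n q \<nu>))" using f by (simp add: is_iota_def)
    show "Psi_inv \<in> extensional (carrier (perm_module n q \<nu>))" by (simp add: Psi_inv_def)
    fix m assume "m \<in> carrier (perm_module n q \<nu>)"
    then obtain v where "v \<in> weight_space" "m = Psi v" by (auto simp: carrier_perm_module_Psi)
    then show "f m = Psi_inv m" using Psi Psi_inv_Psi by simp
  qed
qed

lemma iota_eq:
  assumes "\<nu> \<in> multicomps r n N"
  shows "iota n q r N \<nu> = Psi_inv"
  unfolding iota_def using is_iota_Psi_inv[OF assms] is_iota_unique by (rule the_equality)

lemma Psi_inv_act:
  assumes "m \<in> carrier (perm_module n q \<nu>)" "a \<in> carrier Q"
  shows "Psi_inv (m \<otimes>\<^bsub>Q\<^esub> a) = Psi_inv m \<star> a"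
proof -
  obtain v where v: "v \<in> weight_space" "m = Psi v" using assms(1) by (auto simp: carrier_perm_module_Psi)
  show ?thesis
    unfolding v Psi_act[OF v(1) assms(2)] Psi_inv_Psi[OF v(1)]
      Psi_inv_Psi[OF ract_supported[OF stable_has_weight v(1) assms(2)]] ..
qed

lemma Psi_inv_bij: "bij_betw Psi_inv (carrier (perm_module n q \<nu>)) weight_space"
  unfolding Psi_inv_def carrier_perm_module_Psi
  by (subst bij_betw_restrict_eq) (rule bij_betw_inv_into[OF inj_on_imp_bij_betw[OF inj_on_Psi]])

lemma module_embedding_iota:
  assumes mc: "\<nu> \<in> multicomps r n N"
  shows "module_embedding (bt_block n q (sp_type (comp_partition \<nu>))) (perm_module n q \<nu>)
    (tensor_space n q r N) (iota n q r N \<nu>)"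
  unfolding module_embedding_def module_homs_def iota_eq[OF mc]
proof (intro conjI CollectI ballI)
  show "right_module (bt_block n q (sp_type (comp_partition \<nu>))) (perm_module n q \<nu>)"
    using unital_right_module_perm_module by (simp add: unital_right_module_def)
  show "right_module (bt_block n q (sp_type (comp_partition \<nu>))) (tensor_space n q r N)"
    by (rule right_module_tensor_space)
  show "Psi_inv \<in> linear_maps (perm_module n q \<nu>) (tensor_space n q r N)"
    using is_iota_Psi_inv[OF mc] by (simp add: is_iota_def)
  show "inj_on Psi_inv (carrier (perm_module n q \<nu>))" by (rule bij_betw_imp_inj_on[OF Psi_inv_bij])
  fix m a assume "m \<in> carrier (perm_module n q \<nu>)"
    and a: "a \<in> carrier (bt_block n q (sp_type (comp_partition \<nu>)))"
  then show "Psi_inv (m \<lhd>\<^bsub>perm_module n q \<nu>\<^esub> a) = Psi_inv m \<lhd>\<^bsub>tensor_space n q r N\<^esub> a"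
    unfolding perm_module_simps tensor_space_simps by (intro Psi_inv_act block_closed)
qed

end

context bt_unit
begin

lemma finsum_tensor_space:
  assumes "finite S" "\<And>x. x \<in> S \<Longrightarrow> f x \<in> carrier (tensor_space n q r N)"
  shows "(\<Oplus>\<^bsub>tensor_space n q r N\<^esub>x\<in>S. f x) = sum f S"
proof -
  interpret T: abelian_group "tensor_space n q r N"
    by (rule module.axioms(2)[OF right_module.scalar_module[OF right_module_tensor_space]])
  show ?thesis
    using assms
  proof (induction S rule: finite_induct)
    case (insert x S)
    then have "(\<Oplus>\<^bsub>tensor_space n q r N\<^esub>x\<in>insert x S. f x) =
        f x \<oplus>\<^bsub>tensor_space n q r N\<^esub> (\<Oplus>\<^bsub>tensor_space n q r N\<^esub>x\<in>S. f x)"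
      by (intro T.finsum_insert) auto
    then show ?case using insert by (simp del: tensor_space_simps(1))
  qed simp
qed

text \<open>Each word of type \<alpha> has the weight of exactly one member of
  \<open>\<Lambda>\<close>. A tensor in the block part therefore splits uniquely into weight parts,
  and each part is the image of exactly one element of a permutation module.\<close>

theorem tensor_space_decomposition:
  fixes r N :: nat and \<alpha> :: "nat list"
  defines "\<Lambda> \<equiv> multicomps_of_type r n N \<alpha>"
  shows "(\<forall>\<nu>\<in>\<Lambda>. (\<exists>!f. is_iota n q r N \<nu> f) \<and>
        module_embedding (bt_block n q \<alpha>) (perm_module n q \<nu>) (tensor_space n q r N)
          (iota n q r N \<nu>)) \<and>
      (\<forall>\<nu>\<in>\<Lambda>. iota n q r N \<nu> ` carrier (perm_module n q \<nu>)
        \<subseteq> carrier (block_tensor_space n q r N \<alpha>)) \<and>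
      module_isomorphism (bt_block n q \<alpha>) (direct_sum \<Lambda> (perm_module n q))
        (block_tensor_space n q r N \<alpha>)
        (\<lambda>m. \<Oplus>\<^bsub>tensor_space n q r N\<^esub>\<nu>\<in>\<Lambda>. iota n q r N \<nu> (m \<nu>))"
proof -
  let ?A = "bt_block n q \<alpha>" and ?T = "tensor_space n q r N" and ?B = "block_tensor_space n q r N \<alpha>"
  let ?M = "perm_module n q" and ?i = "iota n q r N" and ?W = "\<lambda>\<nu>. supported (has_weight n \<nu>)"
  have \<Lambda>: "\<nu> \<in> multicomps r n N" "sp_type (comp_partition \<nu>) = \<alpha>" "bt_weight n q q' \<nu>" if "\<nu> \<in> \<Lambda>" for \<nu>
    using that unit
    by (auto simp: \<Lambda>_def multicomps_of_type_def multicomps_def bt_weight_def bt_weight_axioms_def bt_unit_def)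
  have fin: "finite \<Lambda>"
    unfolding \<Lambda>_def multicomps_of_type_def using finite_multicomps[of r n N] by simp
  have emb: "module_embedding ?A (?M \<nu>) ?T (?i \<nu>)" if "\<nu> \<in> \<Lambda>" for \<nu>
    using bt_weight.module_embedding_iota[OF \<Lambda>(3)[OF that] \<Lambda>(1)[OF that]] \<Lambda>(2)[OF that] by simp
  have ex1: "\<exists>!f. is_iota n q r N \<nu> f" if "\<nu> \<in> \<Lambda>" for \<nu>
    using bt_weight.is_iota_Psi_inv[OF \<Lambda>(3)[OF that] \<Lambda>(1)[OF that]] bt_weight.is_iota_unique[OF \<Lambda>(3)[OF that]]
    by (rule ex1I)
  have unital: "unital_right_module ?A (?M \<nu>)" if "\<nu> \<in> \<Lambda>" for \<nu>
    using bt_weight.unital_right_module_perm_module[OF \<Lambda>(3)[OF that]] \<Lambda>(2)[OF that] by simp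
  have bij: "bij_betw (?i \<nu>) (carrier (?M \<nu>)) (?W \<nu>)" if "\<nu> \<in> \<Lambda>" for \<nu>
    using bt_weight.Psi_inv_bij[OF \<Lambda>(3)[OF that]] bt_weight.iota_eq[OF \<Lambda>(3)[OF that] \<Lambda>(1)[OF that]] by simp
  have iW: "?i \<nu> m \<in> ?W \<nu>" if "\<nu> \<in> \<Lambda>" "m \<in> carrier (?M \<nu>)" for \<nu> m
    using bij_betwE[OF bij[OF that(1)]] that(2) by blast
  have typed: "typed_word r N \<alpha> w" if "\<nu> \<in> \<Lambda>" "has_weight n \<nu> w" for \<nu> w
    using has_weight_valid_word[OF \<Lambda>(1)[OF that(1)] that(2)]
      word_type_of_weight[OF bt_weight.total[OF \<Lambda>(3)[OF that(1)]] that(2)] \<Lambda>(2)[OF that(1)]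
    by (simp add: typed_word_def)
  have WB: "?W \<nu> \<subseteq> carrier ?B" if "\<nu> \<in> \<Lambda>" for \<nu>
    unfolding carrier_block_tensor_space using typed[OF that] by (rule supported_mono)
  have WT: "?W \<nu> \<subseteq> carrier ?T" if "\<nu> \<in> \<Lambda>" for \<nu>
    unfolding carrier_tensor_space using has_weight_valid_word[OF \<Lambda>(1)[OF that]] by (rule supported_mono)
  have weight_unique: "\<nu> = \<mu>" if "\<nu> \<in> \<Lambda>" "\<mu> \<in> \<Lambda>" "has_weight n \<nu> w" "has_weight n \<mu> w" for \<nu> \<mu> w
    using weight_determines_multicomp[OF \<Lambda>(1)[OF that(1)] \<Lambda>(1)[OF that(2)]] that(3,4)
    by (simp add: has_weight_def)
  have weight_exists: "\<exists>\<nu>\<in>\<Lambda>. has_weight n \<nu> w" if w: "typed_word r N \<alpha> w" for w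
  proof -
    obtain \<nu> where \<nu>: "\<nu> \<in> multicomps r n N" "has_weight n \<nu> w"
      using w exists_multicomp_of_word[of w n N r] by (auto simp: typed_word_def valid_word_def)
    moreover have "sp_type (comp_partition \<nu>) = \<alpha>"
      using word_type_of_weight[of \<nu> n w] \<nu> w by (simp add: multicomps_def typed_word_def)
    ultimately show ?thesis by (auto simp: \<Lambda>_def multicomps_of_type_def)
  qed
  let ?D = "direct_sum \<Lambda> ?M"
  define F where "F m = (\<Sum>\<nu>\<in>\<Lambda>. ?i \<nu> (m \<nu>))" for m
  have D: "carrier ?D = (\<Pi>\<^sub>E \<nu>\<in>\<Lambda>. carrier (?M \<nu>))" using fin by simp
  have mem: "m \<nu> \<in> carrier (?M \<nu>)" if "m \<in> carrier ?D" "\<nu> \<in> \<Lambda>" for m \<nu>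
    using that unfolding D by (rule PiE_mem)
  have FT: "(\<Oplus>\<^bsub>?T\<^esub>\<nu>\<in>\<Lambda>. ?i \<nu> (m \<nu>)) = F m" if "m \<in> carrier ?D" for m
    unfolding F_def using iW mem[OF that] WT by (intro finsum_tensor_space fin) blast
  have FB: "F m \<in> carrier ?B" if "m \<in> carrier ?D" for m
    unfolding F_def carrier_block_tensor_space
    using iW mem[OF that] WB unfolding carrier_block_tensor_space by (intro supported_sum) blast
  have lin: "y \<in> carrier (?M \<nu>) \<Longrightarrow> ?i \<nu> (x \<oplus>\<^bsub>?M \<nu>\<^esub> y) = ?i \<nu> x + ?i \<nu> y"
    "?i \<nu> (c \<odot>\<^bsub>?M \<nu>\<^esub> x) = scale c (?i \<nu> x)"
    if "\<nu> \<in> \<Lambda>" "x \<in> carrier (?M \<nu>)" for \<nu> x y c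
    using emb[OF that(1)] that(2) by (auto simp: module_embedding_def module_homs_def linear_maps_def)
  have act: "?i \<nu> (x \<lhd>\<^bsub>?M \<nu>\<^esub> a) = ?i \<nu> x \<star> a" if "\<nu> \<in> \<Lambda>" "x \<in> carrier (?M \<nu>)" "a \<in> carrier ?A" for \<nu> x a
    using emb[OF that(1)] that(2,3) unfolding module_embedding_def module_homs_def tensor_space_simps by blast
  \<comment> \<open>The images of different summands have disjoint supports, so a coefficient of the
    sum sees a single summand.\<close>
  have lookup_F: "Poly_Mapping.lookup (F m) w = Poly_Mapping.lookup (?i \<nu> (m \<nu>)) w"
    if m: "m \<in> carrier ?D" and \<nu>: "\<nu> \<in> \<Lambda>" "has_weight n \<nu> w" for m \<nu> w
  proof -
    have "Poly_Mapping.lookup (?i \<mu> (m \<mu>)) w = 0" if \<mu>: "\<mu> \<in> \<Lambda> - {\<nu>}" for \<mu>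
    proof -
      have "\<not> has_weight n \<mu> w" using weight_unique[OF \<nu>(1) _ \<nu>(2), of \<mu>] \<mu> by blast
      then have "w \<notin> Poly_Mapping.keys (?i \<mu> (m \<mu>))"
        using iW[of \<mu> "m \<mu>"] mem[OF m, of \<mu>] \<mu> unfolding supported_def by blast
      then show ?thesis by (simp add: in_keys_iff)
    qed
    then show ?thesis
      unfolding F_def sum.remove[OF fin \<nu>(1)] by (simp add: lookup_add lookup_sum)
  qed
  have inj: "inj_on F (carrier ?D)"
  proof (rule inj_onI)
    fix m m' assume m: "m \<in> carrier ?D" and m': "m' \<in> carrier ?D" and eq: "F m = F m'"
    show "m = m'"
    proof (rule PiE_ext[OF m[unfolded D] m'[unfolded D]])
      fix \<nu> assume \<nu>: "\<nu> \<in> \<Lambda>"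
      have "?i \<nu> (m \<nu>) = ?i \<nu> (m' \<nu>)"
      proof (rule poly_mapping_eqI)
        fix w
        show "Poly_Mapping.lookup (?i \<nu> (m \<nu>)) w = Poly_Mapping.lookup (?i \<nu> (m' \<nu>)) w"
        proof (cases "has_weight n \<nu> w")
          case True
          then show ?thesis using lookup_F[OF m \<nu>] lookup_F[OF m' \<nu>] eq by simp
        next
          case False
          then have "w \<notin> Poly_Mapping.keys (?i \<nu> (m \<nu>))" "w \<notin> Poly_Mapping.keys (?i \<nu> (m' \<nu>))"
            using iW[OF \<nu> mem[OF m \<nu>]] iW[OF \<nu> mem[OF m' \<nu>]] unfolding supported_def by blast+
          then show ?thesis by (simp add: in_keys_iff)
        qed
      qed
      then show "m \<nu> = m' \<nu>"
        by (rule inj_onD[OF bij_betw_imp_inj_on[OF bij[OF \<nu>]] _ mem[OF m \<nu>] mem[OF m' \<nu>]])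
    qed
  qed
  have surj: "v \<in> F ` carrier ?D" if v: "v \<in> carrier ?B" for v
  proof -
    \<comment> \<open>The preimage is assembled from the weight parts of \<open>v\<close>, each
      pulled back along its own embedding.\<close>
    define part where "part \<nu> = (\<Sum>w\<in>{w\<in>Poly_Mapping.keys v. has_weight n \<nu> w}.
        scale (Poly_Mapping.lookup v w) (word_tensor w))" for \<nu>
    have partW: "part \<nu> \<in> ?W \<nu>" for \<nu>
      unfolding part_def by (intro supported_sum supported_closed) auto
    define m where "m = (\<lambda>\<nu>\<in>\<Lambda>. inv_into (carrier (?M \<nu>)) (?i \<nu>) (part \<nu>))"
    have m: "?i \<nu> (m \<nu>) = part \<nu>" "m \<nu> \<in> carrier (?M \<nu>)" if "\<nu> \<in> \<Lambda>" for \<nu>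
    proof -
      have "part \<nu> \<in> ?i \<nu> ` carrier (?M \<nu>)" using partW bij[OF that] by (simp add: bij_betw_def)
      then show "?i \<nu> (m \<nu>) = part \<nu>" "m \<nu> \<in> carrier (?M \<nu>)"
        using that by (simp_all add: m_def f_inv_into_f inv_into_into)
    qed
    have mD: "m \<in> carrier ?D" unfolding D using m(2) by (auto simp: m_def)
    have "v = F m"
    proof (rule poly_mapping_eqI)
      fix w
      show "Poly_Mapping.lookup v w = Poly_Mapping.lookup (F m) w"
      proof (cases "\<exists>\<nu>\<in>\<Lambda>. has_weight n \<nu> w")
        case True
        then obtain \<nu> where \<nu>: "\<nu> \<in> \<Lambda>" "has_weight n \<nu> w" by blast
        have "Poly_Mapping.lookup (part \<nu>) w = Poly_Mapping.lookup v w"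
          unfolding part_def using \<nu>(2)
          by (auto simp: lookup_sum lookup_single when_def in_keys_iff sum.delta)
        then show ?thesis using lookup_F[OF mD \<nu>] m(1)[OF \<nu>(1)] by simp
      next
        case False
        have "\<not> typed_word r N \<alpha> w" using False weight_exists by blast
        then have "w \<notin> Poly_Mapping.keys v" "w \<notin> Poly_Mapping.keys (F m)"
          using v FB[OF mD] unfolding carrier_block_tensor_space supported_def by blast+
        then show ?thesis by (simp add: in_keys_iff)
      qed
    qed
    then show ?thesis using mD by blast
  qed
  have DM: "unital_right_module ?A ?D"
    by (rule unital_right_module_direct_sum[OF fin unital])
  have closed: "m \<oplus>\<^bsub>?D\<^esub> m' \<in> carrier ?D" "c \<odot>\<^bsub>?D\<^esub> m \<in> carrier ?D" "m \<lhd>\<^bsub>?D\<^esub> a \<in> carrier ?D"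
    if "m \<in> carrier ?D" "m' \<in> carrier ?D" "a \<in> carrier ?A" for m m' a c
  proof -
    have R: "right_module ?A ?D" using DM by (simp add: unital_right_module_def)
    have M: "module scalars ?D" by (rule right_module.scalar_module[OF R])
    show "m \<oplus>\<^bsub>?D\<^esub> m' \<in> carrier ?D"
      using abelian_monoid.a_closed[OF abelian_group.axioms(1)[OF module.axioms(2)[OF M]]] that by blast
    show "c \<odot>\<^bsub>?D\<^esub> m \<in> carrier ?D" by (rule module.smult_closed[OF M]) (use that in simp_all)
    show "m \<lhd>\<^bsub>?D\<^esub> a \<in> carrier ?D" by (rule right_module.act_closed[OF R that(1,3)])
  qed
  let ?\<Phi> = "\<lambda>m. \<Oplus>\<^bsub>?T\<^esub>\<nu>\<in>\<Lambda>. ?i \<nu> (m \<nu>)"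
  \<comment> \<open>An element of the block algebra with which the third premise of
    \<open>closed\<close> can be discharged when only sums or multiples are concerned.\<close>
  have e\<alpha>: "bt_central_idem n q \<alpha> \<in> carrier ?A"
    by (simp add: image_iff) (metis Q.r_one Q.one_closed bt_idems_closed(3))
  have "?\<Phi> \<in> module_homs ?A ?D ?B"
    unfolding module_homs_def linear_maps_def
  proof (intro CollectI conjI funcsetI ballI allI)
    fix m assume m: "m \<in> carrier ?D"
    show "?\<Phi> m \<in> carrier ?B" unfolding FT[OF m] by (rule FB[OF m])
    show "?\<Phi> (m \<oplus>\<^bsub>?D\<^esub> m') = ?\<Phi> m \<oplus>\<^bsub>?B\<^esub> ?\<Phi> m'" if m': "m' \<in> carrier ?D" for m'
      unfolding FT[OF m] FT[OF m'] FT[OF closed(1)[OF m m' e\<alpha>]] block_tensor_space_simps F_def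
        sum.distrib[symmetric]
      by (rule sum.cong[OF refl])
        (use lin(1) mem[OF m] mem[OF m'] in \<open>simp del: perm_module_simps\<close>)
    show "?\<Phi> (c \<odot>\<^bsub>?D\<^esub> m) = c \<odot>\<^bsub>?B\<^esub> ?\<Phi> m" for c
      unfolding FT[OF m] FT[OF closed(2)[OF m m e\<alpha>]] block_tensor_space_simps F_def scale_sum
      by (rule sum.cong[OF refl]) (use lin(2) mem[OF m] in \<open>simp del: perm_module_simps\<close>)
    fix a assume a: "a \<in> carrier ?A"
    obtain p where p: "p \<in> carrier (free_algebra n)" "a = bt_class n q p"
      using bt_class_surj[OF block_closed[OF a]] .
    have w: "?i \<nu> (m \<nu>) \<in> words" if "\<nu> \<in> \<Lambda>" for \<nu>
      using iW[OF that mem[OF m that]] bt_weight.weight_space_words[OF \<Lambda>(3)[OF that]] by blast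
    have "F (m \<lhd>\<^bsub>?D\<^esub> a) = (\<Sum>\<nu>\<in>\<Lambda>. ?i \<nu> (m \<nu>) \<star> a)"
      unfolding F_def
      by (rule sum.cong[OF refl]) (use act[OF _ mem[OF m] a] in \<open>simp del: perm_module_simps\<close>)
    also have "\<dots> = (\<Sum>\<nu>\<in>\<Lambda>. act_free q (?i \<nu> (m \<nu>)) p)"
      unfolding p(2) by (intro sum.cong refl ract_class w)
    also have "\<dots> = act_free q (F m) p"
      unfolding F_def linear_opD(5)[OF linear_op_act_free_left] ..
    also have "\<dots> = F m \<star> a"
      unfolding p(2) F_def by (intro ract_class[symmetric] supported_sum w)
    finally show "?\<Phi> (m \<lhd>\<^bsub>?D\<^esub> a) = ?\<Phi> m \<lhd>\<^bsub>?B\<^esub> a"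
      unfolding FT[OF m] FT[OF closed(3)[OF m m a]] block_tensor_space_simps .
  qed
  moreover have "bij_betw ?\<Phi> (carrier ?D) (carrier ?B)"
  proof -
    have "bij_betw F (carrier ?D) (carrier ?B)"
      using inj surj FB by (auto simp: bij_betw_def simp del: direct_sum_simps)
    then show ?thesis using bij_betw_cong[of "carrier ?D" ?\<Phi> F "carrier ?B"] FT by blast
  qed
  ultimately have "module_isomorphism ?A ?D ?B ?\<Phi>"
    unfolding module_isomorphism_def using DM unital_right_module_block_tensor_space by blast
  moreover have "?i \<nu> ` carrier (?M \<nu>) \<subseteq> carrier ?B" if "\<nu> \<in> \<Lambda>" for \<nu>
    using iW[OF that] WB[OF that] by blast
  ultimately show ?thesis using ex1 emb by blast
qed

end

theorem theorem17:
  fixes n r N :: nat and \<alpha> :: "nat list"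
  assumes "0 < n" and "0 < r" and "0 < N"
    and "is_partition_of \<alpha> n" and "length \<alpha> = r"
  shows
    "(let q = laurent_q; \<Lambda> = multicomps_of_type r n N \<alpha> in
      (\<forall>\<nu>\<in>\<Lambda>. (\<exists>!f. is_iota n q r N \<nu> f) \<and>
        module_embedding (bt_block n q \<alpha>) (perm_module n q \<nu>) (tensor_space n q r N)
          (iota n q r N \<nu>)) \<and>
      (\<forall>\<nu>\<in>\<Lambda>. iota n q r N \<nu> ` carrier (perm_module n q \<nu>)
        \<subseteq> carrier (block_tensor_space n q r N \<alpha>)) \<and>
      module_isomorphism (bt_block n q \<alpha>) (direct_sum \<Lambda> (perm_module n q))
        (block_tensor_space n q r N \<alpha>)
        (\<lambda>m. \<Oplus>\<^bsub>tensor_space n q r N\<^esub>\<nu>\<in>\<Lambda>. iota n q r N \<nu> (m \<nu>)))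
     \<and>
     (\<forall>q :: 'k::field. q \<noteq> 0 \<longrightarrow> (let \<Lambda> = multicomps_of_type r n N \<alpha> in
      (\<forall>\<nu>\<in>\<Lambda>. (\<exists>!f. is_iota n q r N \<nu> f) \<and>
        module_embedding (bt_block n q \<alpha>) (perm_module n q \<nu>) (tensor_space n q r N)
          (iota n q r N \<nu>)) \<and>
      (\<forall>\<nu>\<in>\<Lambda>. iota n q r N \<nu> ` carrier (perm_module n q \<nu>)
        \<subseteq> carrier (block_tensor_space n q r N \<alpha>)) \<and>
      module_isomorphism (bt_block n q \<alpha>) (direct_sum \<Lambda> (perm_module n q))
        (block_tensor_space n q r N \<alpha>)
        (\<lambda>m. \<Oplus>\<^bsub>tensor_space n q r N\<^esub>\<nu>\<in>\<Lambda>. iota n q r N \<nu> (m \<nu>))))"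
proof -
  \<comment> \<open>The exponent \<open>- 1\<close> stands for the inverse of the variable.\<close>
  have "laurent_q * Poly_Mapping.single (- 1) 1 = 1"
    by (simp add: laurent_q_def mult_single)
  then have laurent: "bt_unit laurent_q (Poly_Mapping.single (- 1) 1)" by (rule bt_unit.intro)
  have field: "bt_unit q (inverse q)" if "q \<noteq> 0" for q :: 'k
    using that by (intro bt_unit.intro) simp
  show ?thesis
    unfolding Let_def
    using bt_unit.tensor_space_decomposition[OF laurent, of r n N \<alpha>]
      bt_unit.tensor_space_decomposition[OF field, of _ r n N \<alpha>] by blast
qed

end
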